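(* For every $n\geq 2$ there exist $\psi_n\in C\big(\overline{B_1};(-n\frac{\pi}{2},n\frac{\pi}{2})\big)$ and $g_n\in C(\partial B_1)$ such that the Dirichlet problem $$\sum_{i=1}^n\arctan\lambda_i(D^2u)=\psi_n(x)\ \text{ in } B_1,\qquad u=g_n\ \text{ on }\partial B_1,$$ admits a continuum of distinct solutions $u\in C(\overline{B_1})$ in the viscosity sense. Moreover, for every $n\geq 3$ and every $m\in\{1,\dots,n-1\}$, there exist functions $\psi_n\in C\big(\overline{B_1};(-n\frac{\pi}{2},n\frac{\pi}{2})\big)$ and $g_n\in C(\partial B_1)$ such that the Dirichlet problem $$\sum_{i=1}^n\arctan\lambda_i(D^2u)=\psi_n(x)\ \text{ in } B_1,\qquad u=g_n\ \text{ on }\partial B_1,$$ admits a continuum of distinct solutions $u\in C(\overline{B_1})$ in the viscosity sense, and such that $$\psi_n(0)=-(n-2m)\frac{\pi}{2},\qquad \psi_n(te_1)<-(n-2m)\frac{\pi}{2}<\psi_n(te_n)$$ for all sufficiently small $t>0$.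
   Context: $B_1$ is the open unit ball in $\mathbb{R}^n$ centered at the origin, $\overline{B_1}$ its closure, $\partial B_1$ its boundary, and $e_1,\dots,e_n$ is the standard basis of $\mathbb{R}^n$. For a real symmetric $n\times n$ matrix $A$ with eigenvalues $\lambda_1(A),\dots,\lambda_n(A)$, put $F_n(A)=\sum_{i=1}^n\arctan\lambda_i(A)$. A function $u\in C(\Omega)$ on an open set $\Omega\subset\mathbb{R}^n$ is a viscosity subsolution of $F_n(D^2w)=\psi$ in $\Omega$ if, whenever a $C^2$ function $\varphi$ touches $u$ from above at $x_0\in\Omega$ (i.e. $\varphi(x_0)=u(x_0)$ and $\varphi\geq u$ near $x_0$), one has $F_n(D^2\varphi(x_0))\geq\psi(x_0)$. It is a viscosity supersolution if, whenever a $C^2$ function $\varphi$ touches $u$ from below at $x_0\in\Omega$ (i.e. $\varphi(x_0)=u(x_0)$ and $\varphi\leq u$ near $x_0$), one has $F_n(D^2\varphi(x_0))\leq\psi(x_0)$. It is a viscosity solution if it is both. A viscosity solution $u\in C(\overline{B_1})$ of the Dirichlet problem is a function that is a viscosity solution of the equation in $B_1$ and equals the given boundary data on $\partial B_1$. "A continuum" of solutions means a set of solutions with the cardinality of the continuum. *)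

theory Defs
  imports
    "HOL-Analysis.Analysis"
    "HOL-Computational_Algebra.Polynomial"
    "HOL-Library.Equipollence"
begin

definition charpoly :: "real^'n^'n \<Rightarrow> real poly" where
  "charpoly A = det (\<chi> i j. (if i = j then [:0, 1:] else 0) - [:A $ i $ j:])"

text \<open>
  The eigenvalues are listed with multiplicity, as the multiset of real roots of the
  characteristic polynomial; for symmetric \<^term>\<open>A\<close> there are exactly n of them.
\<close>

definition eigenvalues :: "real^'n^'n \<Rightarrow> real multiset" where
  "eigenvalues A = proots (charpoly A)"

definition arctan_op :: "real^'n^'n \<Rightarrow> real" where
  "arctan_op A = (\<Sum>l\<in>#eigenvalues A. arctan l)"

definition grad :: "(real^'n \<Rightarrow> real) \<Rightarrow> real^'n \<Rightarrow> real^'n" where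
  "grad f x = (\<chi> i. frechet_derivative f (at x) (axis i 1))"

definition hessian :: "(real^'n \<Rightarrow> real) \<Rightarrow> real^'n \<Rightarrow> real^'n^'n" where
  "hessian f x = matrix (frechet_derivative (grad f) (at x))"

definition C2_on :: "(real^'n) set \<Rightarrow> (real^'n \<Rightarrow> real) \<Rightarrow> bool" where
  "C2_on U f \<longleftrightarrow> open U \<and>
     (\<forall>x\<in>U. f differentiable (at x) \<and> grad f differentiable (at x)) \<and>
     continuous_on U (hessian f)"

text \<open>
  Test functions only need to be \<open>C\<^sup>2\<close> on some open neighbourhood of the contact point.  By cutting
  off, this is the same as testing with functions that are \<open>C\<^sup>2\<close> on all of space.
\<close>

definition touches_above_at ::
  "(real^'n \<Rightarrow> real) \<Rightarrow> (real^'n \<Rightarrow> real) \<Rightarrow> real^'n \<Rightarrow> bool" where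
  "touches_above_at \<phi> u x0 \<longleftrightarrow> \<phi> x0 = u x0 \<and> (\<forall>\<^sub>F x in nhds x0. u x \<le> \<phi> x)"

definition touches_below_at ::
  "(real^'n \<Rightarrow> real) \<Rightarrow> (real^'n \<Rightarrow> real) \<Rightarrow> real^'n \<Rightarrow> bool" where
  "touches_below_at \<phi> u x0 \<longleftrightarrow> \<phi> x0 = u x0 \<and> (\<forall>\<^sub>F x in nhds x0. \<phi> x \<le> u x)"

definition viscosity_subsolution ::
  "(real^'n) set \<Rightarrow> (real^'n \<Rightarrow> real) \<Rightarrow> (real^'n \<Rightarrow> real) \<Rightarrow> bool" where
  "viscosity_subsolution \<Omega> \<psi> u \<longleftrightarrow> continuous_on \<Omega> u \<and>
     (\<forall>x0\<in>\<Omega>. \<forall>\<phi> U. x0 \<in> U \<and> C2_on U \<phi> \<and> touches_above_at \<phi> u x0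
        \<longrightarrow> \<psi> x0 \<le> arctan_op (hessian \<phi> x0))"

definition viscosity_supersolution ::
  "(real^'n) set \<Rightarrow> (real^'n \<Rightarrow> real) \<Rightarrow> (real^'n \<Rightarrow> real) \<Rightarrow> bool" where
  "viscosity_supersolution \<Omega> \<psi> u \<longleftrightarrow> continuous_on \<Omega> u \<and>
     (\<forall>x0\<in>\<Omega>. \<forall>\<phi> U. x0 \<in> U \<and> C2_on U \<phi> \<and> touches_below_at \<phi> u x0
        \<longrightarrow> arctan_op (hessian \<phi> x0) \<le> \<psi> x0)"

definition viscosity_solution ::
  "(real^'n) set \<Rightarrow> (real^'n \<Rightarrow> real) \<Rightarrow> (real^'n \<Rightarrow> real) \<Rightarrow> bool" where
  "viscosity_solution \<Omega> \<psi> u \<longleftrightarrow>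
     viscosity_subsolution \<Omega> \<psi> u \<and> viscosity_supersolution \<Omega> \<psi> u"

text \<open>
  A function on the closed ball is represented by its extensional total extension, so that
  distinct members of this set differ at some point of the closed ball.
\<close>

definition dirichlet_solutions ::
  "(real^'n \<Rightarrow> real) \<Rightarrow> (real^'n \<Rightarrow> real) \<Rightarrow> (real^'n \<Rightarrow> real) set" where
  "dirichlet_solutions \<psi> g =
     {u \<in> extensional (cball 0 1). continuous_on (cball 0 1) u \<and>
        viscosity_solution (ball 0 1) \<psi> u \<and> (\<forall>x\<in>sphere 0 1. u x = g x)}"

definition has_continuum_of_solutions ::
  "(real^'n \<Rightarrow> real) \<Rightarrow> (real^'n \<Rightarrow> real) \<Rightarrow> bool" where
  "has_continuum_of_solutions \<psi> g \<longleftrightarrow>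
     (\<exists>S \<subseteq> dirichlet_solutions \<psi> g. S \<approx> (UNIV :: real set))"

definition admissible_data ::
  "(real^'n \<Rightarrow> real) \<Rightarrow> (real^'n \<Rightarrow> real) \<Rightarrow> bool" where
  "admissible_data \<psi> g \<longleftrightarrow>
     continuous_on (cball 0 1) \<psi> \<and>
     \<psi> ` cball 0 1 \<subseteq> {- (real CARD('n) * (pi / 2)) <..< real CARD('n) * (pi / 2)} \<and>
     continuous_on (sphere 0 1) g"

end

theory Submission
  imports Defs "HOL-Real_Asymp.Real_Asymp"
begin

text \<open>
  Let \<open>w\<close> be a piecewise affine hat function supported in the unit ball. If \<open>u\<close> has a convex kink
  and the second derivative \<open>+\<infinity>\<close> across every hyperplane along which \<open>w\<close> is not affine, then, for
  small \<open>s > 0\<close>, \<open>u + s w\<close> has the same Hessian as \<open>u\<close> off these planes and the same boundary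
  values. On the planes no test function touches from above, and one touching from below is only
  controlled in the tangential directions; the phase has the limit belonging to an infinite normal
  eigenvalue, which is exactly the supremum over such test functions. So all \<open>u + s w\<close> solve the
  same equation, whose right-hand side is the continuous extension of the phase of \<open>u\<close>.

  At a point \<open>P\<close> where the normals of the planes span the whole space the phase would tend to
  \<open>n \<pi> / 2\<close>, which is not allowed. There one subtracts the cusp \<open>C q\<^sup>1\<^sup>/\<^sup>2 + q\<^sup>5\<^sup>/\<^sup>8\<close> with
  \<open>q = (\<theta> \<bullet> (x - P))\<^sup>2 + |x - P|\<^sup>4\<close>: its Hessian is infinite in essentially one direction, and of
  higher order than that of the ridges \<open>|l| + |l|\<^sup>3\<^sup>/\<^sup>2\<close> used across the planes, so that
  the phase tends to \<open>(n - 2) \<pi> / 2\<close>, while its kink makes \<open>P\<close> untouchable from below. For a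
  generic direction \<open>\<theta>\<close> the planes through \<open>P\<close> do not interfere. A signed sum of
  such cusps in the coordinate directions produces the prescribed value of the phase at the origin.
\<close>

section \<open>The phase operator on symmetric matrices\<close>

text \<open>The exponents balance two rates. At distance r from a vertex one can choose v with
  \<open>\<theta> \<bullet> v = 1\<close> whose product with each normal there is at most a constant
  times |l| / r, where l is the value of that plane's affine function. A ridge has second derivative
  of order |l| powr (-1/2), so along v it adds at most O(|l| powr (3/2) / r^2) = O(r powr (-1/2)),
  while the 5/8 power of q takes away at least a multiple of r powr (-3/4). The square root alone
  supplies the kink, but the lower bound for its Hessian degenerates to 0; exponents strictly
  between 1/2 and 3/4 meet both demands. The quartic term makes the cusp quadratic orthogonally to
  \<theta>: there its Hessian stays bounded above, so the ridges still send n - 1 eigenvalues to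
  infinity, and their kinks still exclude contact from above at P. The hat is centred off the origin
  so that no plane interferes with the value prescribed there.\<close>

definition eigbasis :: "real^'n^'n \<Rightarrow> ('n \<Rightarrow> real^'n) \<Rightarrow> ('n \<Rightarrow> real) \<Rightarrow> bool" where
  "eigbasis A b l \<longleftrightarrow> (\<forall>i j. b i \<bullet> b j = (if i = j then 1 else 0)) \<and> (\<forall>i. A *v b i = l i *\<^sub>R b i)"

lemma symmetric_matrix_inner:
  fixes A :: "real^'n^'n"
  assumes "transpose A = A"
  shows "(A *v x) \<bullet> y = x \<bullet> (A *v y)"
  by (metis assms dot_lmul_matrix transpose_matrix_vector)

lemma matrix_vector_mult_uminus: "(- A) *v v = - (A *v v)" for A :: "real^'n^'m"
  by (simp add: matrix_vector_mult_def vec_eq_iff sum_negf)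

text \<open>The first-order condition at a maximum, without derivatives: for small t of the sign of
  c the linear term wins over the quadratic one.\<close>

lemma quadratic_nonpos_imp_linear_zero:
  fixes c d :: real
  assumes "\<And>t. t * c + t\<^sup>2 * d \<le> 0"
  shows "c = 0"
proof (rule ccontr)
  assume "c \<noteq> 0"
  \<comment> \<open>Both \<open>D\<close> and \<open>D + d\<close> are positive, whatever the sign
    of d; at t = c / D the expression equals c^2 (D + d) / D^2.\<close>
  define D where "D = \<bar>d\<bar> + 1"
  define t where "t = c / D"
  have D: "D > 0" "D + d > 0" by (auto simp: D_def)
  have "t * c + t\<^sup>2 * d = c\<^sup>2 * (D + d) / D\<^sup>2"
    unfolding t_def using D by (simp add: field_simps power2_eq_square)
  then have "t * c + t\<^sup>2 * d > 0" using \<open>c \<noteq> 0\<close> D by simp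
  with assms[of t] show False by simp
qed

text \<open>Maximise the Rayleigh quotient on the unit sphere of the orthogonal complement of S. The
  elements of S are eigenvectors, so A maps this complement into itself, and varying the maximiser x
  in the admissible direction A x - l x forces that vector to vanish.\<close>

lemma symmetric_matrix_eigenvector_orthogonal:
  fixes A :: "real^'n^'n"
  assumes sym: "transpose A = A"
    and S: "finite S" "card S < CARD('n)" "\<And>s. s \<in> S \<Longrightarrow> \<exists>l. A *v s = l *\<^sub>R s"
  obtains x l where "norm x = 1" "\<And>s. s \<in> S \<Longrightarrow> s \<bullet> x = 0" "A *v x = l *\<^sub>R x"
proof -
  define T where "T = {x. \<forall>s\<in>S. s \<bullet> x = 0}"
  have subT: "subspace T"
    by (auto simp: T_def subspace_def inner_add_right)
  have "dim S < DIM(real^'n)" using S by (metis dim_le_card' le_less_trans DIM_cart DIM_real mult.right_neutral)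
  then obtain a where a: "a \<noteq> 0" "span S \<subseteq> {x. a \<bullet> x = 0}"
    using lowdim_subset_hyperplane by blast
  have "a \<in> T" using a(2) span_base by (fastforce simp: T_def inner_commute)
  then have "a /\<^sub>R norm a \<in> T \<inter> sphere 0 1"
    using subT a(1) by (simp add: subspace_scale)
  then have ne: "T \<inter> sphere 0 1 \<noteq> {}" by blast
  have comp: "compact (T \<inter> sphere 0 1)"
    by (intro closed_Int_compact closed_subspace subT compact_sphere)
  have cont: "continuous_on (T \<inter> sphere 0 1) (\<lambda>x. x \<bullet> (A *v x))"
    by (intro continuous_intros)
  obtain x where x: "x \<in> T \<inter> sphere 0 1"
    and max: "\<And>y. y \<in> T \<inter> sphere 0 1 \<Longrightarrow> y \<bullet> (A *v y) \<le> x \<bullet> (A *v x)"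
    using continuous_attains_sup[OF comp ne cont] by blast
  define l where "l = x \<bullet> (A *v x)"
  have xT: "x \<in> T" and nx: "norm x = 1" using x by auto
  have xx: "x \<bullet> x = 1" using nx by (simp add: norm_eq_1)
  have max': "y \<bullet> (A *v y) \<le> l * (y \<bullet> y)" if "y \<in> T" for y
  proof (cases "y = 0")
    case False
    have "y /\<^sub>R norm y \<in> T \<inter> sphere 0 1" using that False subT by (simp add: subspace_scale)
    from max[OF this] have "(y \<bullet> (A *v y)) / (norm y)\<^sup>2 \<le> l"
      by (simp add: l_def matrix_vector_mult_scaleR power2_eq_square divide_simps)
    then show ?thesis using False by (simp add: pos_divide_le_eq power2_norm_eq_inner)
  qed simp
  define y where "y = A *v x - l *\<^sub>R x"
  have yT: "y \<in> T"
    unfolding T_def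
  proof clarify
    fix s assume "s \<in> S"
    obtain k where "A *v s = k *\<^sub>R s" using S(3)[OF \<open>s \<in> S\<close>] by blast
    have "s \<bullet> (A *v x) = (A *v s) \<bullet> x" by (simp add: symmetric_matrix_inner[OF sym])
    also have "\<dots> = 0" using \<open>A *v s = k *\<^sub>R s\<close> xT \<open>s \<in> S\<close> by (simp add: T_def)
    finally show "s \<bullet> y = 0" using xT \<open>s \<in> S\<close> by (simp add: y_def T_def inner_diff_right)
  qed
  \<comment> \<open>Maximality along x + t y; the linear coefficient is 2 (A x - l x) \<bullet> y,
    which for this y is 2 (y \<bullet> y).\<close>
  have "t * (2 * (y \<bullet> y)) + t\<^sup>2 * (y \<bullet> (A *v y) - l * (y \<bullet> y)) \<le> 0" for t
  proof -
    have "x + t *\<^sub>R y \<in> T" using xT yT subT by (simp add: subspace_add subspace_scale)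
    from max'[OF this]
    have "(x + t *\<^sub>R y) \<bullet> (A *v (x + t *\<^sub>R y)) \<le> l * ((x + t *\<^sub>R y) \<bullet> (x + t *\<^sub>R y))" .
    moreover have "x \<bullet> (A *v y) = y \<bullet> (A *v x)"
      by (metis inner_commute symmetric_matrix_inner[OF sym])
    moreover have "y \<bullet> (A *v x) = y \<bullet> y + l * (x \<bullet> y)"
      by (simp add: y_def inner_diff_right inner_diff_left inner_commute algebra_simps)
    ultimately show ?thesis
      using xx l_def
      by (simp add: matrix_vector_right_distrib matrix_vector_mult_scaleR inner_add_left inner_add_right
          power2_eq_square inner_commute algebra_simps)
  qed
  from quadratic_nonpos_imp_linear_zero[OF this] have "y = 0" by simp
  then have "A *v x = l *\<^sub>R x" by (simp add: y_def)
  with that[of x l] nx xT show thesis by (simp add: T_def)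
qed

lemma symmetric_matrix_eigbasis:
  fixes A :: "real^'n^'n"
  assumes sym: "transpose A = A"
  obtains b l where "eigbasis A b l"
proof -
  have "\<exists>S. finite S \<and> card S = k \<and> (\<forall>x\<in>S. \<forall>y\<in>S. x \<bullet> y = (if x = y then 1 else 0)) \<and>
          (\<forall>x\<in>S. \<exists>l. A *v x = l *\<^sub>R x)" if "k \<le> CARD('n)" for k
    using that
  proof (induction k)
    case 0
    show ?case by (intro exI[of _ "{}"]) auto
  next
    case (Suc k)
    then obtain S where S: "finite S" "card S = k" "\<forall>x\<in>S. \<forall>y\<in>S. x \<bullet> y = (if x = y then 1 else 0)"
      "\<forall>x\<in>S. \<exists>l. A *v x = l *\<^sub>R x" by auto
    obtain x l where x: "norm x = 1" "\<And>s. s \<in> S \<Longrightarrow> s \<bullet> x = 0" "A *v x = l *\<^sub>R x"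
      using symmetric_matrix_eigenvector_orthogonal[OF sym S(1)] S Suc.prems by (metis Suc_le_lessD)
    have xx: "x \<bullet> x = 1" using x(1) by (simp add: norm_eq_1)
    then have "x \<notin> S" using x(2) by fastforce
    then show ?case using S x xx
      by (intro exI[of _ "insert x S"]) (auto simp: inner_commute)
  qed
  then obtain S where S: "finite S" "card S = CARD('n)" "\<forall>x\<in>S. \<forall>y\<in>S. x \<bullet> y = (if x = y then 1 else 0)"
      "\<forall>x\<in>S. \<exists>l. A *v x = l *\<^sub>R x" by blast
  obtain b where b: "bij_betw b (UNIV::'n set) S"
    using S by (metis finite_class.finite_UNIV finite_same_card_bij)
  have "\<forall>i. \<exists>l. A *v b i = l *\<^sub>R b i" using S(4) b by (meson UNIV_I bij_betwE)
  then obtain l where "\<forall>i. A *v b i = l i *\<^sub>R b i" by metis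
  moreover have "b i \<bullet> b j = (if i = j then 1 else 0)" for i j
    using S(3) b by (metis UNIV_I bij_betwE bij_betw_imp_inj_on inj_eq)
  ultimately show thesis using that[of b l] by (simp add: eigbasis_def)
qed

text \<open>The orthogonal matrix of eigenvectors diagonalises A. Lifted to constant polynomials,
  the same conjugation applies to X - A, because the scalar matrix X commutes with every matrix, and
  it does not change the determinant.\<close>

lemma charpoly_eigbasis:
  fixes A :: "real^'n^'n"
  assumes "eigbasis A b l"
  shows "charpoly A = (\<Prod>i\<in>UNIV. [:- l i, 1:])"
proof -
  define C :: "real^'n^'n \<Rightarrow> real poly^'n^'n" where "C M = (\<chi> i j. [:M$i$j:])" for M
  define X :: "real poly^'n^'n" where "X = mat [:0, 1:]"
  define P :: "real^'n^'n" where "P = (\<chi> i j. b j $ i)"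
  define D :: "real^'n^'n" where "D = (\<chi> i j. if i = j then l i else 0)"
  have sum_const: "[:\<Sum>k\<in>S. f k:] = (\<Sum>k\<in>S. [:f k:])" for f :: "'n \<Rightarrow> real" and S
  proof (induction S rule: infinite_finite_induct)
    case (insert x F)
    have "[:\<Sum>k\<in>insert x F. f k:] = [:f x:] + [:\<Sum>k\<in>F. f k:]" using insert(1,2) by simp
    then show ?case using insert by simp
  qed simp_all
  have C_mult: "C (M ** N) = C M ** C N" for M N
    by (simp add: C_def matrix_matrix_mult_def vec_eq_iff sum_const mult.commute)
  have C_1: "C (mat 1) = mat 1" by (simp add: C_def mat_def vec_eq_iff one_pCons)
  have PP: "transpose P ** P = mat 1"
    using assms by (simp add: P_def transpose_def matrix_matrix_mult_def mat_def vec_eq_iff eigbasis_def inner_vec_def)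
  have AP: "A ** P = P ** D"
  proof -
    have "(A ** P) $ i $ j = (P ** D) $ i $ j" for i j
    proof -
      have "(A ** P) $ i $ j = (A *v b j) $ i"
        by (simp add: P_def matrix_matrix_mult_def matrix_vector_mult_def)
      also have "\<dots> = l j * b j $ i" using assms by (simp add: eigbasis_def)
      also have "\<dots> = (P ** D) $ i $ j"
        by (simp add: P_def D_def matrix_matrix_mult_def if_distrib cong: if_cong)
      finally show ?thesis .
    qed
    then show ?thesis by (simp add: vec_eq_iff)
  qed
  have X_comm: "M ** X = X ** M" for M
    by (simp add: X_def matrix_matrix_mult_def mat_def vec_eq_iff if_distrib if_distribR mult.commute cong: if_cong)
  have distl: "M ** (N - K) = M ** N - M ** K" for M N K :: "real poly^'n^'n"
    by (simp add: matrix_matrix_mult_def vec_eq_iff sum_subtractf algebra_simps)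
  have distr: "(N - K) ** M = N ** M - K ** M" for M N K :: "real poly^'n^'n"
    by (simp add: matrix_matrix_mult_def vec_eq_iff sum_subtractf algebra_simps)
  have "C (transpose P) ** (X - C A) ** C P = X - C D"
  proof -
    have "C (transpose P) ** (X - C A) ** C P = C (transpose P) ** (X ** C P - C A ** C P)"
      by (simp add: distr matrix_mul_assoc[symmetric])
    also have "\<dots> = C (transpose P) ** (C P ** X - C P ** C D)"
      by (simp add: X_comm C_mult[symmetric] AP)
    also have "\<dots> = (C (transpose P) ** C P) ** (X - C D)"
      by (simp add: distl matrix_mul_assoc)
    also have "\<dots> = X - C D" by (simp add: C_mult[symmetric] PP C_1)
    finally show ?thesis .
  qed
  then have "det (X - C D) = det (C (transpose P)) * det (X - C A) * det (C P)"
    by (metis det_mul)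
  also have "\<dots> = det (C (transpose P) ** C P) * det (X - C A)" by (simp add: det_mul)
  also have "\<dots> = det (X - C A)" by (simp add: C_mult[symmetric] PP C_1)
  also have "X - C A = (\<chi> i j. (if i = j then [:0, 1:] else 0) - [:A $ i $ j:])"
    by (simp add: X_def C_def mat_def vec_eq_iff)
  finally have "charpoly A = det (X - C D)" by (simp add: charpoly_def)
  also have "\<dots> = (\<Prod>i\<in>UNIV. (X - C D) $ i $ i)"
    by (rule det_diagonal) (simp add: X_def C_def D_def mat_def)
  also have "\<dots> = (\<Prod>i\<in>UNIV. [:- l i, 1:])"
    by (simp add: X_def C_def D_def mat_def)
  finally show ?thesis .
qed

text \<open>The bridge from roots of the characteristic polynomial to eigenbases, through which all
  later estimates of the phase go.\<close>

lemma arctan_op_eigbasis: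
  assumes "eigbasis A b l"
  shows "arctan_op A = (\<Sum>i\<in>UNIV. arctan (l i))"
proof -
  have "eigenvalues A = (\<Sum>i\<in>UNIV. {#l i#})"
    unfolding eigenvalues_def charpoly_eigbasis[OF assms] by (subst proots_prod) auto
  moreover have "(\<Sum>x\<in>#(\<Sum>i\<in>S. {#l i#}). arctan x) = (\<Sum>i\<in>S. arctan (l i))" for S
    by (induction S rule: infinite_finite_induct) auto
  ultimately show ?thesis by (simp add: arctan_op_def)
qed


section \<open>Counting eigenvalues by means of quadratic forms\<close>

definition qf :: "real^'n^'n \<Rightarrow> real^'n \<Rightarrow> real" where
  "qf A v = v \<bullet> (A *v v)"

lemma eigbasis_span:
  fixes A :: "real^'n^'n"
  assumes "eigbasis A b l"
  shows "inj b" and "dim (span (b ` I)) = card I" and "span (range b) = UNIV"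
proof -
  have bb: "\<And>i j. b i \<bullet> b j = (if i = j then 1 else 0)" using assms by (simp add: eigbasis_def)
  show inj: "inj b"
    by (rule injI) (metis bb zero_neq_one)
  have "b i \<noteq> 0" for i using bb[of i i] by auto
  then have ind: "independent (range b)"
    by (intro pairwise_orthogonal_independent) (auto simp: pairwise_def orthogonal_def bb)
  have "independent (b ` I)" using ind by (rule independent_mono) auto
  then show "dim (span (b ` I)) = card I"
    using inj by (simp add: dim_eq_card_independent card_image inj_on_subset)
  have "UNIV \<subseteq> span (range b)"
    by (rule card_ge_dim_independent) (use ind inj in \<open>auto simp: card_image\<close>)
  then show "span (range b) = UNIV" by blast
qed

lemma eigbasis_expand:
  fixes A :: "real^'n^'n"
  assumes "eigbasis A b l"
  shows "v = (\<Sum>i\<in>UNIV. (b i \<bullet> v) *\<^sub>R b i)"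
proof -
  have bb: "\<And>i j. b i \<bullet> b j = (if i = j then 1 else 0)" using assms by (simp add: eigbasis_def)
  let ?w = "v - (\<Sum>i\<in>UNIV. (b i \<bullet> v) *\<^sub>R b i)"
  have "orthogonal ?w y" if "y \<in> range b" for y
  proof -
    obtain j where "y = b j" using \<open>y \<in> range b\<close> by blast
    then show ?thesis
      by (simp add: orthogonal_def inner_diff_left inner_sum_left bb inner_commute[of v] if_distrib cong: if_cong)
  qed
  then have "orthogonal ?w ?w"
    using orthogonal_to_span[of ?w "range b"] eigbasis_span(3)[OF assms] by blast
  then show ?thesis by (simp add: orthogonal_def)
qed

lemma eigbasis_qf:
  fixes A :: "real^'n^'n"
  assumes "eigbasis A b l"
  shows "qf A v = (\<Sum>i\<in>UNIV. l i * (b i \<bullet> v)\<^sup>2)" and "v \<bullet> v = (\<Sum>i\<in>UNIV. (b i \<bullet> v)\<^sup>2)"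
proof -
  have "A *v v = (\<Sum>i\<in>UNIV. (b i \<bullet> v) *\<^sub>R (A *v b i))"
    by (subst eigbasis_expand[OF assms, of v])
      (simp add: linear_sum[OF matrix_vector_mul_linear] matrix_vector_mult_scaleR)
  also have "\<dots> = (\<Sum>i\<in>UNIV. (l i * (b i \<bullet> v)) *\<^sub>R b i)"
    using assms by (simp add: eigbasis_def mult.commute)
  finally show "qf A v = (\<Sum>i\<in>UNIV. l i * (b i \<bullet> v)\<^sup>2)"
    by (simp add: qf_def inner_sum_right power2_eq_square inner_commute mult.assoc)
  show "v \<bullet> v = (\<Sum>i\<in>UNIV. (b i \<bullet> v)\<^sup>2)"
    by (subst (2) eigbasis_expand[OF assms, of v]) (simp add: inner_sum_right power2_eq_square inner_commute)
qed

lemma eigbasis_uminus: "eigbasis A b l \<Longrightarrow> eigbasis (- A) b (\<lambda>i. - l i)"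
  by (simp add: eigbasis_def matrix_vector_mult_uminus)

lemma eigbasis_span_orthogonal:
  assumes "eigbasis A b l" "v \<in> span (b ` J)" "i \<notin> J"
  shows "b i \<bullet> v = 0"
  using assms(2)
proof (induction rule: span_induct_alt)
  case (step c x y)
  then show ?case using assms(1,3) by (auto simp: inner_add_right eigbasis_def split: if_splits)
qed simp

text \<open>One half of the Courant-Fischer principle: S meets the span of the eigenvectors with
  eigenvalue below t only in 0, so the two dimensions add up to at most n.\<close>

lemma eigbasis_count_ge:
  fixes A :: "real^'n^'n"
  assumes e: "eigbasis A b l" and S: "subspace S" "\<And>v. v \<in> S \<Longrightarrow> t * (v \<bullet> v) \<le> qf A v"
  shows "dim S \<le> card {i. t \<le> l i}"
proof -
  define W where "W = span (b ` {i. l i < t})"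
  have "v = 0" if v: "v \<in> S" "v \<in> W" for v
  proof (rule ccontr)
    assume "v \<noteq> 0"
    have 0: "b i \<bullet> v = 0" if "\<not> l i < t" for i
      using eigbasis_span_orthogonal[OF e v(2)[unfolded W_def], of i] that by simp
    have "qf A v - t * (v \<bullet> v) = (\<Sum>i\<in>UNIV. (l i - t) * (b i \<bullet> v)\<^sup>2)"
      by (simp add: eigbasis_qf[OF e] sum_distrib_left sum_subtractf algebra_simps)
    also have "\<dots> < 0"
    proof -
      have "\<exists>i. b i \<bullet> v \<noteq> 0"
      proof (rule ccontr)
        assume "\<nexists>i. b i \<bullet> v \<noteq> 0"
        then have "v \<bullet> v = 0" using eigbasis_qf(2)[OF e, of v] by simp
        then show False using \<open>v \<noteq> 0\<close> by simp
      qed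
      then obtain i where i: "b i \<bullet> v \<noteq> 0" by blast
      then have "l i < t" using 0 by blast
      have "0 < (\<Sum>i\<in>UNIV. (t - l i) * (b i \<bullet> v)\<^sup>2)"
      proof (rule sum_pos2[of _ i])
        show "0 < (t - l i) * (b i \<bullet> v)\<^sup>2" using i \<open>l i < t\<close> by simp
        show "0 \<le> (t - l j) * (b j \<bullet> v)\<^sup>2" for j by (cases "l j < t") (simp_all add: 0)
      qed simp_all
      also have "\<dots> = - (\<Sum>i\<in>UNIV. (l i - t) * (b i \<bullet> v)\<^sup>2)"
        by (simp add: algebra_simps flip: sum_negf)
      finally show ?thesis by simp
    qed
    finally show False using S(2)[OF v(1)] by simp
  qed
  then have "S \<inter> W \<subseteq> {0}" by blast
  then have dim0: "dim (S \<inter> W) = 0" using dim_eq_0 by blast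
  have "subspace W" by (simp add: W_def)
  from dim_sums_Int[OF S(1) this] have "dim S + dim W = dim {x + y |x y. x \<in> S \<and> y \<in> W}"
    by (simp add: dim0)
  also have "\<dots> \<le> CARD('n)" by (rule order_trans[OF dim_subset_UNIV]) simp
  finally have "dim S + card {i. l i < t} \<le> CARD('n)" unfolding W_def eigbasis_span(2)[OF e] .
  moreover have "card {i. l i < t} + card {i. t \<le> l i} = CARD('n)"
    by (subst card_Un_disjoint[symmetric]) (auto intro!: arg_cong[where f = card])
  ultimately show ?thesis by simp
qed

lemma eigbasis_count_le:
  fixes A :: "real^'n^'n"
  assumes e: "eigbasis A b l" and S: "subspace S" "\<And>v. v \<in> S \<Longrightarrow> qf A v \<le> t * (v \<bullet> v)"
  shows "dim S \<le> card {i. l i \<le> t}"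
  using eigbasis_count_ge[OF eigbasis_uminus[OF e] S(1), of "- t"] S(2)
  by (simp add: qf_def matrix_vector_mult_uminus)

text \<open>Comparing the counting functions at every level amounts to comparing the two families
  entry by entry after sorting.\<close>

lemma sum_mono_of_count:
  fixes f g :: "'n::finite \<Rightarrow> real" and h :: "real \<Rightarrow> real"
  assumes h: "mono h" and cnt: "\<And>t. card {i. t \<le> f i} \<le> card {i. t \<le> g i}"
  shows "(\<Sum>i\<in>UNIV. h (f i)) \<le> (\<Sum>i\<in>UNIV. h (g i))"
proof -
  obtain zs :: "'n list" where zs: "set zs = UNIV" "distinct zs"
    using finite_distinct_list[of "UNIV :: 'n set"] by auto
  define xs where "xs = sort (map f zs)"
  define ys where "ys = sort (map g zs)"
  have len: "length xs = length zs" "length ys = length zs" by (auto simp: xs_def ys_def)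
  have sorted: "sorted xs" "sorted ys" by (auto simp: xs_def ys_def)
  have sums: "(\<Sum>i\<in>UNIV. h (u i)) = sum_list (map h (sort (map u zs)))" for u :: "'n \<Rightarrow> real"
  proof -
    have "mset (map h (sort (map u zs))) = mset (map (\<lambda>i. h (u i)) zs)"
      by (simp add: image_mset.compositionality comp_def)
    then have "sum_list (map h (sort (map u zs))) = sum_list (map (\<lambda>i. h (u i)) zs)"
      by (metis sum_mset_sum_list)
    then show ?thesis using zs by (simp add: sum_list_distinct_conv_sum_set)
  qed
  have count: "card {i. t \<le> u i} = card {k. k < length zs \<and> t \<le> sort (map u zs) ! k}" for u :: "'n \<Rightarrow> real" and t
  proof -
    have "card {i. t \<le> u i} = length (filter (\<lambda>i. t \<le> u i) zs)"
      using zs by (simp add: distinct_length_filter)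
    also have "\<dots> = length (filter (\<lambda>x. t \<le> x) (map u zs))" by (simp add: filter_map comp_def)
    also have "\<dots> = size (filter_mset (\<lambda>x. t \<le> x) (mset (map u zs)))"
      by (metis mset_filter size_mset)
    also have "\<dots> = length (filter (\<lambda>x. t \<le> x) (sort (map u zs)))"
      by (metis mset_filter size_mset mset_sort)
    finally show ?thesis by (simp add: length_filter_conv_card)
  qed
  \<comment> \<open>Otherwise, at the level \<open>xs ! k\<close>, at least
    \<open>length zs - k\<close> entries of \<open>xs\<close> reach it, but of \<open>ys\<close>
    only entries with index greater than k, one too few.\<close>
  have le: "xs ! k \<le> ys ! k" if k: "k < length zs" for k
  proof (rule ccontr)
    assume neg: "\<not> xs ! k \<le> ys ! k"
    have "{k..<length zs} \<subseteq> {j. j < length zs \<and> xs ! k \<le> xs ! j}"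
      using sorted_nth_mono[OF sorted(1)] len by auto
    from card_mono[OF _ this] have "length zs - k \<le> card {i. xs ! k \<le> f i}"
      by (simp add: count xs_def)
    moreover have "{j. j < length zs \<and> xs ! k \<le> ys ! j} \<subseteq> {Suc k..<length zs}"
    proof clarify
      fix j assume j: "j < length zs" "xs ! k \<le> ys ! j"
      then have "ys ! k < ys ! j" using neg by linarith
      then have "k < j" using sorted_nth_mono[OF sorted(2), of j k] k len by (cases "j \<le> k") auto
      then show "j \<in> {Suc k..<length zs}" using j by simp
    qed
    from card_mono[OF _ this] have "card {i. xs ! k \<le> g i} \<le> length zs - Suc k"
      by (simp add: count ys_def)
    ultimately show False using cnt[of "xs ! k"] k by linarith
  qed
  have "sum_list (map h xs) \<le> sum_list (map h ys)"
    unfolding sum_list_sum_nth using le h len by (auto intro!: sum_mono simp: mono_def)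
  then show ?thesis by (simp add: sums xs_def ys_def)
qed

lemma mono_arctan: "mono arctan"
  by (simp add: mono_def arctan_le_iff)

text \<open>The span of the eigenvectors of A with eigenvalue at least t is a test subspace for B,
  so B has at least as many eigenvalues above each level.\<close>

lemma arctan_op_mono:
  fixes A B :: "real^'n^'n"
  assumes "transpose A = A" "transpose B = B" and AB: "\<And>v. qf A v \<le> qf B v"
  shows "arctan_op A \<le> arctan_op B"
proof -
  obtain b l where e: "eigbasis A b l" using symmetric_matrix_eigbasis[OF assms(1)] .
  obtain b' l' where e': "eigbasis B b' l'" using symmetric_matrix_eigbasis[OF assms(2)] .
  have "card {i. t \<le> l i} \<le> card {i. t \<le> l' i}" for t
  proof -
    define S where "S = span (b ` {i. t \<le> l i})"
    have "t * (v \<bullet> v) \<le> qf B v" if "v \<in> S" for v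
    proof -
      have 0: "b i \<bullet> v = 0" if "\<not> t \<le> l i" for i
        using eigbasis_span_orthogonal[OF e \<open>v \<in> S\<close>[unfolded S_def], of i] that by simp
      have "t * (v \<bullet> v) \<le> qf A v"
        unfolding eigbasis_qf[OF e] sum_distrib_left
      proof (rule sum_mono)
        show "t * (b i \<bullet> v)\<^sup>2 \<le> l i * (b i \<bullet> v)\<^sup>2" for i
          by (cases "t \<le> l i") (auto simp: 0 mult_right_mono)
      qed
      then show ?thesis using AB[of v] by simp
    qed
    then have "dim S \<le> card {i. t \<le> l' i}"
      by (intro eigbasis_count_ge[OF e']) (simp add: S_def)
    then show ?thesis
      unfolding S_def eigbasis_span(2)[OF e] .
  qed
  then show ?thesis
    unfolding arctan_op_eigbasis[OF e] arctan_op_eigbasis[OF e'] by (rule sum_mono_of_count[OF mono_arctan])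
qed

lemma arctan_op_uminus:
  fixes A :: "real^'n^'n"
  assumes "transpose A = A"
  shows "arctan_op (- A) = - arctan_op A"
proof -
  obtain b l where e: "eigbasis A b l" using symmetric_matrix_eigbasis[OF assms(1)] .
  show ?thesis
    by (simp add: arctan_op_eigbasis[OF e] arctan_op_eigbasis[OF eigbasis_uminus[OF e]] arctan_minus sum_negf)
qed

lemma arctan_op_bounds:
  fixes A :: "real^'n^'n"
  assumes "transpose A = A"
  shows "arctan_op A < real CARD('n) * (pi / 2)" "- (real CARD('n) * (pi / 2)) < arctan_op A"
proof -
  obtain b l where e: "eigbasis A b l" using symmetric_matrix_eigbasis[OF assms(1)] .
  have "(\<Sum>i\<in>UNIV. arctan (l i)) < (\<Sum>i\<in>(UNIV::'n set). pi / 2)"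
    by (rule sum_strict_mono) (use arctan_ubound in simp_all)
  then show "arctan_op A < real CARD('n) * (pi / 2)" by (simp add: arctan_op_eigbasis[OF e])
  have "(\<Sum>i\<in>(UNIV::'n set). - (pi / 2)) < (\<Sum>i\<in>UNIV. arctan (l i))"
    by (rule sum_strict_mono) (use arctan_lbound in simp_all)
  then show "- (real CARD('n) * (pi / 2)) < arctan_op A" by (simp add: arctan_op_eigbasis[OF e])
qed

text \<open>At least k1 eigenvalues lie below t1 and at least k2 below t2; for the rest only the
  bound pi / 2 is available. Two thresholds serve Hessians whose eigenvalues have two different
  scales; with a single scale both are taken equal.\<close>

lemma arctan_op_upper:
  fixes A :: "real^'n^'n"
  assumes sym: "transpose A = A"
    and S1: "subspace S1" "k1 \<le> dim S1" "\<And>v. v \<in> S1 \<Longrightarrow> qf A v \<le> t1 * (v \<bullet> v)"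
    and S2: "subspace S2" "k2 \<le> dim S2" "\<And>v. v \<in> S2 \<Longrightarrow> qf A v \<le> t2 * (v \<bullet> v)"
    and t: "t1 \<le> t2"
  shows "arctan_op A \<le> real k1 * arctan t1 + (real k2 - real k1) * arctan t2 + (real CARD('n) - real k2) * (pi / 2)"
proof -
  obtain b l where e: "eigbasis A b l" using symmetric_matrix_eigbasis[OF sym] .
  define I1 where "I1 = {i. l i \<le> t1}"
  define I2 where "I2 = {i. l i \<le> t2}"
  have k: "k1 \<le> card I1" "k2 \<le> card I2"
    using eigbasis_count_le[OF e S1(1,3)] eigbasis_count_le[OF e S2(1,3)] S1(2) S2(2) by (auto simp: I1_def I2_def)
  have sub: "I1 \<subseteq> I2" using t by (auto simp: I1_def I2_def)
  have "arctan_op A = (\<Sum>i\<in>I1. arctan (l i)) + (\<Sum>i\<in>I2 - I1. arctan (l i)) + (\<Sum>i\<in>UNIV - I2. arctan (l i))"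
    unfolding arctan_op_eigbasis[OF e]
    using sum.subset_diff[OF sub, of "\<lambda>i. arctan (l i)"] sum.subset_diff[OF subset_UNIV[of I2], of "\<lambda>i. arctan (l i)"]
    by simp
  also have "\<dots> \<le> real (card I1) * arctan t1 + real (card (I2 - I1)) * arctan t2 + real (card (UNIV - I2)) * (pi / 2)"
    by (intro add_mono sum_bounded_above) (use arctan_ubound in \<open>auto simp: I1_def I2_def arctan_le_iff less_imp_le\<close>)
  also have "\<dots> = real (card I1) * arctan t1 + (real (card I2) - real (card I1)) * arctan t2 + (real CARD('n) - real (card I2)) * (pi / 2)"
    using sub by (simp add: card_Diff_subset of_nat_diff card_mono)
  also have "\<dots> \<le> real k1 * arctan t1 + (real k2 - real k1) * arctan t2 + (real CARD('n) - real k2) * (pi / 2)"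
  proof -
    \<comment> \<open>Replacing the actual counts by the smaller numbers k1 and k2 moves weight to
      larger bounds, since arctan t1 \<le> arctan t2 \<le> pi / 2.\<close>
    have "(real (card I1) - real k1) * (arctan t1 - arctan t2) \<le> 0"
      using k t by (intro mult_nonneg_nonpos) (auto simp: arctan_le_iff)
    moreover have "(real (card I2) - real k2) * (arctan t2 - pi / 2) \<le> 0"
      using k arctan_ubound[of t2] by (intro mult_nonneg_nonpos) auto
    ultimately show ?thesis by (simp add: algebra_simps)
  qed
  finally show ?thesis .
qed

lemma arctan_op_lower:
  fixes A :: "real^'n^'n"
  assumes sym: "transpose A = A"
    and S1: "subspace S1" "k1 \<le> dim S1" "\<And>v. v \<in> S1 \<Longrightarrow> t1 * (v \<bullet> v) \<le> qf A v"
    and S2: "subspace S2" "k2 \<le> dim S2" "\<And>v. v \<in> S2 \<Longrightarrow> t2 * (v \<bullet> v) \<le> qf A v"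
    and t: "t2 \<le> t1"
  shows "real k1 * arctan t1 + (real k2 - real k1) * arctan t2 - (real CARD('n) - real k2) * (pi / 2) \<le> arctan_op A"
proof -
  have "transpose (- A) = - A" using sym by (simp add: transpose_def vec_eq_iff)
  from arctan_op_upper[OF this S1(1,2) _ S2(1,2), of "- t1" "- t2"] S1(3) S2(3) t
  show ?thesis
    by (simp add: arctan_op_uminus[OF sym] qf_def matrix_vector_mult_uminus arctan_minus algebra_simps)
qed

text \<open>Adding e times the identity keeps the eigenbasis and raises every eigenvalue by e; as
  arctan is 1-Lipschitz, each of the n summands grows by at most e.\<close>

lemma arctan_op_lipschitz:
  fixes A B :: "real^'n^'n"
  assumes "transpose A = A" "transpose B = B" and AB: "\<And>v. qf A v \<le> qf B v + e * (v \<bullet> v)" and e0: "0 \<le> e"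
  shows "arctan_op A \<le> arctan_op B + real CARD('n) * e"
proof -
  define C where "C = B + e *\<^sub>R mat 1"
  obtain b l where eb: "eigbasis B b l" using symmetric_matrix_eigbasis[OF assms(2)] .
  have Cv: "C *v v = B *v v + e *\<^sub>R v" for v
    by (simp add: C_def matrix_vector_mult_add_rdistrib scaleR_matrix_vector_assoc[symmetric])
  have ec: "eigbasis C b (\<lambda>i. l i + e)"
    using eb by (simp add: eigbasis_def Cv algebra_simps)
  have "transpose C = C"
    using assms(2) by (simp add: C_def transpose_def vec_eq_iff mat_def eq_commute)
  then have "arctan_op A \<le> arctan_op C"
    using assms by (intro arctan_op_mono) (auto simp: qf_def Cv inner_add_right)
  also have "\<dots> = (\<Sum>i\<in>UNIV. arctan (l i + e))" by (rule arctan_op_eigbasis[OF ec])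
  also have "\<dots> \<le> (\<Sum>i\<in>UNIV. arctan (l i) + e)"
  proof (rule sum_mono)
    fix i
    have "arctan (l i + e) - (l i + e) \<le> arctan (l i) - l i"
    proof (rule DERIV_nonpos_imp_nonincreasing[of "l i" "l i + e" "\<lambda>x. arctan x - x"])
      fix x :: real
      have "((\<lambda>x. arctan x - x) has_real_derivative inverse (1 + x\<^sup>2) - 1) (at x)"
        by (auto intro!: derivative_eq_intros)
      moreover have "inverse (1 + x\<^sup>2) - 1 \<le> 0" by (simp add: inverse_le_1_iff)
      ultimately show "\<exists>y. ((\<lambda>x. arctan x - x) has_real_derivative y) (at x) \<and> y \<le> 0" by blast
    qed (use e0 in simp)
    then show "arctan (l i + e) \<le> arctan (l i) + e" by simp
  qed
  also have "\<dots> = arctan_op B + real CARD('n) * e" by (simp add: arctan_op_eigbasis[OF eb] sum.distrib)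
  finally show ?thesis .
qed

section \<open>Second derivatives along lines\<close>

text \<open>A relation on functions of one variable: the solutions are not twice differentiable in
  space at points of the planes, but their restrictions to tangential lines are.\<close>

definition second_deriv0 :: "(real \<Rightarrow> real) \<Rightarrow> real \<Rightarrow> bool" where
  "second_deriv0 h L \<longleftrightarrow> (\<exists>h'. (\<forall>\<^sub>F t in nhds 0. (h has_real_derivative h' t) (at t)) \<and>
     (h' has_real_derivative L) (at 0))"

lemma second_deriv0I:
  assumes "\<forall>\<^sub>F t in nhds 0. (h has_real_derivative h' t) (at t)" "(h' has_real_derivative L) (at 0)"
  shows "second_deriv0 h L"
  using assms by (auto simp: second_deriv0_def)

lemma second_deriv0E:
  assumes "second_deriv0 h L"
  obtains h' where "\<forall>\<^sub>F t in nhds 0. (h has_real_derivative h' t) (at t)" "(h' has_real_derivative L) (at 0)"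
  using assms by (auto simp: second_deriv0_def)

lemma second_deriv0_imp_deriv:
  assumes "second_deriv0 h L"
  obtains d where "(h has_real_derivative d) (at 0)"
  using assms unfolding second_deriv0_def by (metis eventually_nhds_x_imp_x)

lemma second_deriv0_add:
  assumes "second_deriv0 f L" "second_deriv0 g M"
  shows "second_deriv0 (\<lambda>t. f t + g t) (L + M)"
proof -
  obtain f' where f: "\<forall>\<^sub>F t in nhds 0. (f has_real_derivative f' t) (at t)" "(f' has_real_derivative L) (at 0)"
    using assms by (auto elim: second_deriv0E)
  obtain g' where g: "\<forall>\<^sub>F t in nhds 0. (g has_real_derivative g' t) (at t)" "(g' has_real_derivative M) (at 0)"
    using assms by (auto elim: second_deriv0E)
  show ?thesis
    by (rule second_deriv0I[of _ "\<lambda>t. f' t + g' t"])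
      (use f g in \<open>auto intro!: DERIV_add elim: eventually_elim2\<close>)
qed

lemma second_deriv0_cmult:
  assumes "second_deriv0 f L"
  shows "second_deriv0 (\<lambda>t. c * f t) (c * L)"
proof -
  obtain f' where f: "\<forall>\<^sub>F t in nhds 0. (f has_real_derivative f' t) (at t)" "(f' has_real_derivative L) (at 0)"
    using assms by (auto elim: second_deriv0E)
  show ?thesis
    by (rule second_deriv0I[of _ "\<lambda>t. c * f' t"])
      (use f in \<open>auto intro!: DERIV_cmult elim: eventually_mono\<close>)
qed

lemma second_deriv0_diff:
  assumes "second_deriv0 f L" "second_deriv0 g M"
  shows "second_deriv0 (\<lambda>t. f t - g t) (L - M)"
  using second_deriv0_add[OF assms(1) second_deriv0_cmult[OF assms(2), of "-1"]] by simp

lemma second_deriv0_affine: "second_deriv0 (\<lambda>t. a + t * b) 0"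
  by (rule second_deriv0I[of _ "\<lambda>t. b"]) (auto intro!: derivative_eq_intros always_eventually)

lemma second_deriv0_sum:
  assumes "\<And>i. i \<in> I \<Longrightarrow> second_deriv0 (f i) (L i)"
  shows "second_deriv0 (\<lambda>t. \<Sum>i\<in>I. f i t) (\<Sum>i\<in>I. L i)"
  using assms
proof (induction I rule: infinite_finite_induct)
  case (insert x F)
  then show ?case by (simp add: second_deriv0_add)
qed (use second_deriv0_affine[of 0 0] in simp_all)

lemma second_deriv0_cong:
  assumes "second_deriv0 f L" "\<forall>\<^sub>F t in nhds 0. g t = f t"
  shows "second_deriv0 g L"
proof -
  obtain f' where f: "\<forall>\<^sub>F t in nhds 0. (f has_real_derivative f' t) (at t)" "(f' has_real_derivative L) (at 0)"
    using assms by (auto elim: second_deriv0E)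
  have "\<forall>\<^sub>F t in nhds 0. \<forall>\<^sub>F s in nhds t. g s = f s"
    using assms(2) by (simp add: eventually_eventually)
  then have "\<forall>\<^sub>F t in nhds 0. (g has_real_derivative f' t) (at t)"
    using f(1)
  proof eventually_elim
    case (elim t)
    then show ?case using DERIV_cong_ev[OF refl, of g f t] by blast
  qed
  then show ?thesis using f(2) by (rule second_deriv0I)
qed

text \<open>At the maximum h' vanishes; if L were positive, h' would be positive just to the right
  of 0, and the mean value theorem would give h > 0 there.\<close>

lemma second_deriv0_max_nonpos:
  assumes h: "second_deriv0 h L" and h0: "h 0 = 0" and le: "\<forall>\<^sub>F t in nhds 0. h t \<le> 0"
  shows "L \<le> 0"
proof (rule ccontr)
  assume "\<not> L \<le> 0"
  obtain h' where h': "\<forall>\<^sub>F t in nhds 0. (h has_real_derivative h' t) (at t)" "(h' has_real_derivative L) (at 0)"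
    using h by (auto simp: second_deriv0_def)
  obtain e where e: "e > 0" "\<And>t. \<bar>t\<bar> < e \<Longrightarrow> (h has_real_derivative h' t) (at t)" "\<And>t. \<bar>t\<bar> < e \<Longrightarrow> h t \<le> 0"
    using eventually_conj[OF h'(1) le] unfolding eventually_nhds_metric by (auto simp: dist_real_def)
  have "h' 0 = 0"
    by (rule DERIV_local_max[OF e(2)[of 0] e(1)]) (use e h0 in auto)
  obtain d where d: "d > 0" "\<And>t. 0 < t \<Longrightarrow> t < d \<Longrightarrow> h' 0 < h' (0 + t)"
    using DERIV_pos_inc_right[OF h'(2)] \<open>\<not> L \<le> 0\<close> by auto
  define t where "t = min d e / 2"
  have t: "0 < t" "t < d" "t < e" using d e by (auto simp: t_def min_def)
  obtain z where z: "0 < z" "z < t" "h t - h 0 = (t - 0) * h' z"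
    using MVT2[of 0 t h h'] t e by auto
  have "h' z > 0" using d(2)[of z] z t \<open>h' 0 = 0\<close> by simp
  then have "h t > 0" using z t h0 by simp
  with e(3)[of t] t show False by simp
qed

text \<open>A minimum at 0 forces the derivative to be 0, whereas the difference quotients from the
  right are at least c.\<close>

lemma differentiable_no_kink:
  fixes r :: "real \<Rightarrow> real"
  assumes r: "(r has_real_derivative d) (at 0)" "r 0 = 0" and c: "0 < c"
    and ge: "\<forall>\<^sub>F t in nhds 0. c * \<bar>t\<bar> \<le> r t"
  shows False
proof -
  have "\<forall>\<^sub>F t in nhds 0. 0 \<le> r t"
    using ge
  proof eventually_elim
    case (elim t)
    have "0 \<le> c * \<bar>t\<bar>" using c by simp
    with elim show ?case by linarith
  qed
  then obtain e where e: "e > 0" "\<And>t. \<bar>t\<bar> < e \<Longrightarrow> 0 \<le> r t"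
    unfolding eventually_nhds_metric by (auto simp: dist_real_def)
  have "d = 0"
    by (rule DERIV_local_min[OF r(1) e(1)]) (use e r in auto)
  then have "((\<lambda>t. r t / t) \<longlongrightarrow> 0) (at 0)"
    using r unfolding DERIV_def by simp
  then have "((\<lambda>t. r t / t) \<longlongrightarrow> 0) (at_right 0)"
    by (rule tendsto_mono[OF at_le, rotated]) simp
  moreover have "\<forall>\<^sub>F t in at_right 0. c \<le> r t / t"
    using eventually_at_right_less[of "0::real"] ge[THEN filter_leD[OF at_within_le_nhds]]
    by eventually_elim (simp add: pos_le_divide_eq)
  ultimately have "c \<le> 0"
    by (rule tendsto_lowerbound) simp
  with c show False by simp
qed

section \<open>Gradient, Hessian and the symmetry of the Hessian\<close>

lemma has_derivative_grad:
  fixes f :: "real^'n \<Rightarrow> real"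
  assumes "f differentiable at x"
  shows "(f has_derivative (\<lambda>h. grad f x \<bullet> h)) (at x)"
proof -
  have d: "(f has_derivative frechet_derivative f (at x)) (at x)"
    using assms by (simp add: frechet_derivative_works)
  then have lin: "linear (frechet_derivative f (at x))" by (rule has_derivative_linear)
  have "frechet_derivative f (at x) h = grad f x \<bullet> h" for h
  proof -
    have "frechet_derivative f (at x) h = frechet_derivative f (at x) (\<Sum>i\<in>UNIV. h $ i *\<^sub>R axis i 1)"
      by (simp add: basis_expansion[of h, unfolded scalar_mult_eq_scaleR])
    also have "\<dots> = (\<Sum>i\<in>UNIV. h $ i * frechet_derivative f (at x) (axis i 1))"
      by (simp add: linear_sum[OF lin] linear_cmul[OF lin])
    finally show ?thesis by (simp add: grad_def inner_vec_def mult.commute)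
  qed
  then have "frechet_derivative f (at x) = (\<lambda>h. grad f x \<bullet> h)" by blast
  then show ?thesis using d by simp
qed

lemma has_derivative_hessian:
  fixes f :: "real^'n \<Rightarrow> real"
  assumes "grad f differentiable at x"
  shows "(grad f has_derivative (\<lambda>h. hessian f x *v h)) (at x)"
proof -
  have d: "(grad f has_derivative frechet_derivative (grad f) (at x)) (at x)"
    using assms by (simp add: frechet_derivative_works)
  then have lin: "linear (frechet_derivative (grad f) (at x))" by (rule has_derivative_linear)
  have "(\<lambda>h. hessian f x *v h) = frechet_derivative (grad f) (at x)"
    using lin by (simp add: hessian_def matrix_works fun_eq_iff)
  then show ?thesis using d by simp
qed

lemma deriv_along_line:
  fixes f :: "real^'n \<Rightarrow> real"
  assumes "f differentiable at (x + t *\<^sub>R v)"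
  shows "((\<lambda>t. f (x + t *\<^sub>R v)) has_real_derivative grad f (x + t *\<^sub>R v) \<bullet> v) (at t)"
proof -
  have "((\<lambda>t. x + t *\<^sub>R v) has_derivative (\<lambda>h. h *\<^sub>R v)) (at t)"
    by (auto intro!: derivative_eq_intros)
  from diff_chain_at[OF this has_derivative_grad[OF assms]]
  show ?thesis by (simp add: has_field_derivative_def comp_def mult_commute_abs)
qed

text \<open>The mean value theorem in the direction u turns the second difference into a difference
  of gradients; then differentiability of the gradient at the single point x suffices.\<close>

lemma second_difference_hessian:
  fixes f :: "real^'n \<Rightarrow> real"
  assumes U: "open U" "x \<in> U" "\<And>y. y \<in> U \<Longrightarrow> f differentiable at y" and g: "grad f differentiable at x"
    and e: "e > 0"
  shows "\<forall>\<^sub>F t in at_right 0. \<bar>f (x + t *\<^sub>R u + t *\<^sub>R v) - f (x + t *\<^sub>R u) - f (x + t *\<^sub>R v) + f x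
           - t\<^sup>2 * ((hessian f x *v v) \<bullet> u)\<bar> \<le> e * t\<^sup>2"
proof -
  define A where "A = hessian f x"
  define N where "N = norm u + norm v + 1"
  have N: "N > 0" unfolding N_def by (smt (verit) norm_ge_zero)
  \<comment> \<open>Two remainders of size \<open>e1 * (t * N) * N\<close> will occur, multiplied by
    t.\<close>
  define e1 where "e1 = e / (2 * N * N)"
  have e1: "e1 > 0" using e N by (simp add: e1_def)
  obtain d0 where d0: "d0 > 0" "ball x d0 \<subseteq> U" using U openE by blast
  obtain d1 where d1: "d1 > 0"
    "\<And>h. norm h < d1 \<Longrightarrow> norm (grad f (x + h) - grad f x - A *v h) \<le> e1 * norm h"
    using has_derivative_hessian[OF g] e1 unfolding has_derivative_at_alt A_def
    by (metis add_diff_cancel_left')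
  define d where "d = min d0 d1 / N"
  have "d > 0" using d0 d1 N by (simp add: d_def)
  have main: "\<bar>f (x + t *\<^sub>R u + t *\<^sub>R v) - f (x + t *\<^sub>R u) - f (x + t *\<^sub>R v) + f x - t\<^sup>2 * ((A *v v) \<bullet> u)\<bar> \<le> e * t\<^sup>2"
    if t: "0 < t" "t < d" for t
  proof -
    have tN: "t * N < d0" "t * N < d1" using t N by (auto simp: d_def pos_less_divide_eq)
    have small: "norm (s *\<^sub>R u + r *\<^sub>R v) \<le> t * N" if "0 \<le> s" "s \<le> t" "0 \<le> r" "r \<le> t" for s r
    proof -
      have "norm (s *\<^sub>R u + r *\<^sub>R v) \<le> s * norm u + r * norm v"
        using norm_triangle_ineq[of "s *\<^sub>R u" "r *\<^sub>R v"] that by simp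
      also have "\<dots> \<le> t * norm u + t * norm v" using that by (intro add_mono mult_right_mono) auto
      also have "\<dots> \<le> t * N" using t by (simp add: N_def algebra_simps)
      finally show ?thesis .
    qed
    have inU: "x + s *\<^sub>R u + r *\<^sub>R v \<in> U" if "0 \<le> s" "s \<le> t" "0 \<le> r" "r \<le> t" for s r
    proof -
      have "dist x (x + s *\<^sub>R u + r *\<^sub>R v) = norm (s *\<^sub>R u + r *\<^sub>R v)"
        by (metis add.assoc add_diff_cancel_left' dist_norm norm_minus_commute)
      then show ?thesis using small[OF that] tN(1) d0(2) by (auto simp: subset_iff)
    qed
    define p where "p s = f ((x + t *\<^sub>R v) + s *\<^sub>R u) - f (x + s *\<^sub>R u)" for s
    have "(p has_real_derivative (grad f ((x + t *\<^sub>R v) + s *\<^sub>R u) \<bullet> u - grad f (x + s *\<^sub>R u) \<bullet> u)) (at s)"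
      if "0 \<le> s" "s \<le> t" for s
      unfolding p_def using inU[of s t] inU[of s 0] that t
      by (intro DERIV_diff deriv_along_line U(3)) (simp_all add: add_ac)
    then obtain z where z: "0 < z" "z < t"
      "p t - p 0 = (t - 0) * (grad f ((x + t *\<^sub>R v) + z *\<^sub>R u) \<bullet> u - grad f (x + z *\<^sub>R u) \<bullet> u)"
      using MVT2[of 0 t p "\<lambda>s. grad f ((x + t *\<^sub>R v) + s *\<^sub>R u) \<bullet> u - grad f (x + s *\<^sub>R u) \<bullet> u"] t by auto
    define R where "R h = grad f (x + h) - grad f x - A *v h" for h
    have R: "\<bar>R h \<bullet> u\<bar> \<le> e1 * (t * N) * N" if "norm h \<le> t * N" for h
    proof -
      have "\<bar>R h \<bullet> u\<bar> \<le> norm (R h) * norm u" by (rule Cauchy_Schwarz_ineq2)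
      also have "\<dots> \<le> (e1 * norm h) * N"
        using d1(2)[of h] that tN(2) e1 by (intro mult_mono) (auto simp: R_def N_def)
      also have "\<dots> \<le> e1 * (t * N) * N" using that e1 N t by (intro mult_mono) auto
      finally show ?thesis .
    qed
    have E1: "grad f ((x + t *\<^sub>R v) + z *\<^sub>R u) \<bullet> u - grad f (x + z *\<^sub>R u) \<bullet> u
        = t * ((A *v v) \<bullet> u) + R (z *\<^sub>R u + t *\<^sub>R v) \<bullet> u - R (z *\<^sub>R u + 0 *\<^sub>R v) \<bullet> u"
      by (simp add: R_def inner_diff_left inner_add_left matrix_vector_right_distrib matrix_vector_mult_scaleR add_ac)
    have "p t - p 0 - t\<^sup>2 * ((A *v v) \<bullet> u) = t * (R (z *\<^sub>R u + t *\<^sub>R v) \<bullet> u - R (z *\<^sub>R u + 0 *\<^sub>R v) \<bullet> u)"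
      unfolding z(3) E1 by (simp add: power2_eq_square algebra_simps)
    then have "\<bar>p t - p 0 - t\<^sup>2 * ((A *v v) \<bullet> u)\<bar> = t * \<bar>R (z *\<^sub>R u + t *\<^sub>R v) \<bullet> u - R (z *\<^sub>R u + 0 *\<^sub>R v) \<bullet> u\<bar>"
      using t by (simp add: abs_mult)
    also have "\<dots> \<le> t * (e1 * (t * N) * N + e1 * (t * N) * N)"
    proof (rule mult_left_mono)
      have "\<bar>R (z *\<^sub>R u + t *\<^sub>R v) \<bullet> u\<bar> \<le> e1 * (t * N) * N" "\<bar>R (z *\<^sub>R u + 0 *\<^sub>R v) \<bullet> u\<bar> \<le> e1 * (t * N) * N"
        using z t by (intro R small; simp)+
      then show "\<bar>R (z *\<^sub>R u + t *\<^sub>R v) \<bullet> u - R (z *\<^sub>R u + 0 *\<^sub>R v) \<bullet> u\<bar> \<le> e1 * (t * N) * N + e1 * (t * N) * N"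
        by linarith
    qed (use t in simp)
    also have "\<dots> = e * t\<^sup>2" using N by (simp add: e1_def power2_eq_square field_simps)
    finally show ?thesis by (simp add: p_def add_ac algebra_simps)
  qed
  show ?thesis
    unfolding eventually_at_right_field using main[unfolded A_def] \<open>d > 0\<close> by blast
qed

text \<open>The second difference does not change when u and v are exchanged, so its two expansions
  agree up to e t^2 for every positive e.\<close>

lemma hessian_symmetric:
  assumes "C2_on U f" "x \<in> U"
  shows "transpose (hessian f x) = hessian f x"
proof -
  have *: "(hessian f x *v v) \<bullet> u \<le> (hessian f x *v u) \<bullet> v" for u v
  proof (rule field_le_epsilon)
    fix e :: real assume e: "e > 0"
    have U: "open U" "\<And>y. y \<in> U \<Longrightarrow> f differentiable at y" "grad f differentiable at x"
      using assms by (auto simp: C2_on_def)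
    have sd: "\<forall>\<^sub>F t in at_right 0. \<bar>f (x + t *\<^sub>R u + t *\<^sub>R v) - f (x + t *\<^sub>R u) - f (x + t *\<^sub>R v) + f x
           - t\<^sup>2 * ((hessian f x *v v) \<bullet> u)\<bar> \<le> e / 2 * t\<^sup>2" for u v
      using e by (intro second_difference_hessian[OF U(1) assms(2)] U) auto
    have "\<forall>\<^sub>F t in at_right 0. t\<^sup>2 * ((hessian f x *v v) \<bullet> u) \<le> t\<^sup>2 * ((hessian f x *v u) \<bullet> v + e) \<and> 0 < t"
      using sd[of u v] sd[of v u] eventually_at_right_less[of "0::real"]
    proof eventually_elim
      case (elim t)
      have comm: "x + t *\<^sub>R v + t *\<^sub>R u = x + t *\<^sub>R u + t *\<^sub>R v" by simp
      have "t\<^sup>2 * ((hessian f x *v v) \<bullet> u) \<le> t\<^sup>2 * ((hessian f x *v u) \<bullet> v) + e * t\<^sup>2"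
        using elim(1,2) unfolding comm by linarith
      then show ?case using elim(3) by (simp add: algebra_simps)
    qed
    then obtain t where "t\<^sup>2 * ((hessian f x *v v) \<bullet> u) \<le> t\<^sup>2 * ((hessian f x *v u) \<bullet> v + e)" "0 < t"
      using eventually_happens'[OF trivial_limit_at_right_real] by blast
    then show "(hessian f x *v v) \<bullet> u \<le> (hessian f x *v u) \<bullet> v + e"
      by simp
  qed
  have "hessian f x $ i $ j \<le> hessian f x $ j $ i" for i j
    using *[of "axis j 1" "axis i 1"] by (simp add: inner_axis matrix_vector_mult_basis column_def)
  then show ?thesis by (simp add: transpose_def vec_eq_iff order_antisym)
qed

lemma second_deriv0_C2:
  assumes "C2_on U f" "x \<in> U"
  shows "second_deriv0 (\<lambda>t. f (x + t *\<^sub>R v)) (qf (hessian f x) v)"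
proof (rule second_deriv0I)
  have U: "open U" "\<And>y. y \<in> U \<Longrightarrow> f differentiable at y" "grad f differentiable at x"
    using assms by (auto simp: C2_on_def)
  have "((\<lambda>t. x + t *\<^sub>R v) \<longlongrightarrow> x + 0 *\<^sub>R v) (nhds 0)"
    by (intro tendsto_intros filterlim_ident)
  then have "\<forall>\<^sub>F t in nhds 0. x + t *\<^sub>R v \<in> U"
    using U(1) assms(2) by (simp add: topological_tendstoD)
  then show "\<forall>\<^sub>F t in nhds 0. ((\<lambda>t. f (x + t *\<^sub>R v)) has_real_derivative grad f (x + t *\<^sub>R v) \<bullet> v) (at t)"
    by eventually_elim (intro deriv_along_line U)
  have "((\<lambda>t. x + t *\<^sub>R v) has_derivative (\<lambda>h. h *\<^sub>R v)) (at (0::real))"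
    by (auto intro!: derivative_eq_intros)
  then have "((\<lambda>t. grad f (x + t *\<^sub>R v)) has_derivative (\<lambda>h. hessian f x *v (h *\<^sub>R v))) (at 0)"
    using diff_chain_at[of "\<lambda>t. x + t *\<^sub>R v" "\<lambda>h. h *\<^sub>R v" 0 "grad f" "\<lambda>h. hessian f x *v h"] has_derivative_hessian[OF U(3)]
    by (simp add: comp_def)
  then have "((\<lambda>t. grad f (x + t *\<^sub>R v) \<bullet> v) has_derivative (\<lambda>h. (hessian f x *v (h *\<^sub>R v)) \<bullet> v)) (at 0)"
    by (rule has_derivative_inner_left)
  then show "((\<lambda>t. grad f (x + t *\<^sub>R v) \<bullet> v) has_real_derivative qf (hessian f x) v) (at 0)"
    by (simp add: has_field_derivative_def qf_def matrix_vector_mult_scaleR inner_commute mult_commute_abs)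
qed


section \<open>Algebra and compactness for quadratic forms\<close>

lemma qf_add: "qf (A + B) v = qf A v + qf B v"
  by (simp add: qf_def matrix_vector_mult_add_rdistrib inner_add_right)

lemma qf_scaleR: "qf (c *\<^sub>R A) v = c * qf A v"
  by (simp add: qf_def scaleR_matrix_vector_assoc[symmetric])

lemma qf_uminus: "qf (- A) v = - qf A v"
  by (simp add: qf_def matrix_vector_mult_uminus)

lemma qf_diff: "qf (A - B) v = qf A v - qf B v"
  using qf_add[of A "- B" v] by (simp add: qf_uminus)

lemma qf_0: "qf 0 v = 0"
  by (simp add: qf_def)

lemma qf_sum: "qf (\<Sum>i\<in>I. A i) v = (\<Sum>i\<in>I. qf (A i) v)"
  by (induction I rule: infinite_finite_induct) (simp_all add: qf_add qf_0)

lemma qf_mat_1: "qf (mat 1) v = v \<bullet> v"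
  by (simp add: qf_def)

lemma qf_scaleR_vec: "qf A (c *\<^sub>R v) = c\<^sup>2 * qf A v"
  by (simp add: qf_def matrix_vector_mult_scaleR power2_eq_square mult.assoc)

definition outer :: "real^'n \<Rightarrow> real^'n^'n" where
  "outer a = (\<chi> i j. a $ i * a $ j)"

lemma qf_outer: "qf (outer a) v = (a \<bullet> v)\<^sup>2"
proof -
  have "outer a *v v = (a \<bullet> v) *\<^sub>R a"
    by (simp add: outer_def matrix_vector_mult_def vec_eq_iff inner_vec_def sum_distrib_left mult_ac)
  then show ?thesis by (simp add: qf_def power2_eq_square inner_commute)
qed

lemma transpose_simps:
  fixes A B :: "real^'n^'n"
  shows "transpose A = A \<Longrightarrow> transpose B = B \<Longrightarrow> transpose (A + B) = A + B"
    and "transpose A = A \<Longrightarrow> transpose B = B \<Longrightarrow> transpose (A - B) = A - B"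
    and "transpose A = A \<Longrightarrow> transpose (c *\<^sub>R A) = c *\<^sub>R A"
    and "transpose (outer a) = outer a"
    and "(\<And>i. i \<in> I \<Longrightarrow> transpose (M i) = M i) \<Longrightarrow> transpose (\<Sum>i\<in>I. M i) = (\<Sum>i\<in>I. (M i :: real^'n^'n))"
  by (simp_all add: transpose_def vec_eq_iff outer_def)

lemma continuous_qf: "continuous_on S (qf A)"
  unfolding qf_def by (intro continuous_intros)

lemma qf_le_onorm: "\<bar>qf A v\<bar> \<le> onorm ((*v) A) * (v \<bullet> v)"
proof -
  have "norm (A *v v) \<le> onorm ((*v) A) * norm v"
    by (intro onorm matrix_vector_mul_bounded_linear)
  then have "\<bar>qf A v\<bar> \<le> norm v * (onorm ((*v) A) * norm v)"
    unfolding qf_def using Cauchy_Schwarz_ineq2[of v "A *v v"] by (meson mult_left_mono norm_ge_zero order_trans)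
  then show ?thesis by (simp flip: power2_norm_eq_inner) (simp add: power2_eq_square mult_ac)
qed

lemma qf_tendsto_uniform:
  fixes B :: "'a \<Rightarrow> real^'n^'n"
  assumes B: "(B \<longlongrightarrow> B0) F" and e: "e > 0"
  shows "\<forall>\<^sub>F x in F. \<forall>v. \<bar>qf (B x) v - qf B0 v\<bar> \<le> e * (v \<bullet> v)"
proof -
  have "((\<lambda>x. \<Sum>i\<in>UNIV. \<Sum>j\<in>UNIV. \<bar>(B x - B0) $ i $ j\<bar>) \<longlongrightarrow> (\<Sum>i\<in>UNIV. \<Sum>j\<in>UNIV. \<bar>(B0 - B0) $ i $ j\<bar>)) F"
    by (intro tendsto_intros B)
  then have "\<forall>\<^sub>F x in F. (\<Sum>i\<in>UNIV. \<Sum>j\<in>UNIV. \<bar>(B x - B0) $ i $ j\<bar>) < e"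
    using e by (auto dest: order_tendstoD(2))
  then show ?thesis
  proof eventually_elim
    case (elim x)
    let ?C = "B x - B0"
    show ?case
    proof
      fix v
      have "\<bar>qf ?C v\<bar> \<le> onorm ((*v) ?C) * (v \<bullet> v)" by (rule qf_le_onorm)
      also have "\<dots> \<le> e * (v \<bullet> v)"
        using onorm_le_matrix_component_sum[of ?C] elim by (intro mult_right_mono) auto
      finally show "\<bar>qf (B x) v - qf B0 v\<bar> \<le> e * (v \<bullet> v)" by (simp add: qf_diff)
    qed
  qed
qed

lemma qf_unit_sphereI:
  assumes "\<And>v. norm v = 1 \<Longrightarrow> qf S v \<le> K * qf P v + e"
  shows "qf S v \<le> K * qf P v + e * (v \<bullet> v)"
proof (cases "v = 0")
  case False
  let ?u = "v /\<^sub>R norm v"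
  have v: "v = norm v *\<^sub>R ?u" using False by simp
  have u: "norm ?u = 1" using False by simp
  have "qf S v = (norm v)\<^sup>2 * qf S ?u" by (subst v) (rule qf_scaleR_vec)
  also have "\<dots> \<le> (norm v)\<^sup>2 * (K * qf P ?u + e)" by (intro mult_left_mono assms u) simp
  also have "\<dots> = K * ((norm v)\<^sup>2 * qf P ?u) + e * (v \<bullet> v)"
    by (simp add: power2_norm_eq_inner algebra_simps)
  also have "(norm v)\<^sup>2 * qf P ?u = qf P v" by (subst (3) v) (rule qf_scaleR_vec[symmetric])
  finally show ?thesis .
qed (simp add: qf_def)

text \<open>Finsler's lemma with an error term: on the compact part of the unit sphere where S is at
  least e, the form P has a positive minimum; elsewhere e alone suffices. It is used with the Gram
  form of the active normals as P, whose kernel consists of the tangential directions.\<close>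

lemma qf_dominate:
  fixes S P :: "real^'n^'n"
  assumes P: "\<And>v. 0 \<le> qf P v" and S: "\<And>v. qf P v = 0 \<Longrightarrow> qf S v \<le> 0" and e: "e > 0"
  obtains K where "0 \<le> K" "\<And>v. qf S v \<le> K * qf P v + e * (v \<bullet> v)"
proof -
  define C where "C = sphere 0 1 \<inter> {v. e \<le> qf S v}"
  have "closed {v. e \<le> qf S v}"
    using continuous_qf[of UNIV S] by (intro closed_Collect_le) auto
  then have cC: "compact C" unfolding C_def by (intro compact_Int_closed compact_sphere)
  have "\<exists>K\<ge>0. \<forall>v\<in>C. qf S v \<le> K * qf P v"
  proof (cases "C = {}")
    case False
    obtain a where a: "a \<in> C" "\<And>v. v \<in> C \<Longrightarrow> qf P a \<le> qf P v"
      using continuous_attains_inf[OF cC False continuous_qf[of C P]] by blast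
    obtain b where b: "b \<in> C" "\<And>v. v \<in> C \<Longrightarrow> qf S v \<le> qf S b"
      using continuous_attains_sup[OF cC False continuous_qf[of C S]] by blast
    have "qf P a \<noteq> 0" using S[of a] a(1) e by (auto simp: C_def)
    then have pos: "qf P a > 0" using P[of a] by simp
    have posb: "qf S b > 0" using b(1) e by (auto simp: C_def)
    have "qf S v \<le> qf S b / qf P a * qf P v" if "v \<in> C" for v
    proof -
      have "qf S v \<le> qf S b / qf P a * qf P a" using b(2)[OF that] pos by simp
      also have "\<dots> \<le> qf S b / qf P a * qf P v" using a(2)[OF that] pos posb by (intro mult_left_mono) auto
      finally show ?thesis .
    qed
    then show ?thesis using pos posb by (intro exI[of _ "qf S b / qf P a"]) auto
  qed auto
  then obtain K where K: "K \<ge> 0" "\<And>v. v \<in> C \<Longrightarrow> qf S v \<le> K * qf P v" by blast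
  have "qf S v \<le> K * qf P v + e" if "norm v = 1" for v
  proof (cases "v \<in> C")
    case True
    then show ?thesis using K(2)[OF True] e by simp
  next
    case False
    have "0 \<le> K * qf P v" using K(1) P[of v] by simp
    then show ?thesis using False that by (simp add: C_def)
  qed
  then show thesis using that[of K] K(1) qf_unit_sphereI by blast
qed

lemma second_deriv0_powr:
  assumes Q: "\<forall>\<^sub>F t in nhds 0. (Q has_real_derivative Q' t) (at t)" "(Q' has_real_derivative Q2) (at 0)" and pos: "Q 0 > 0"
  shows "second_deriv0 (\<lambda>t. Q t powr a) (a * Q 0 powr (a - 1) * Q2 + a * (a - 1) * Q 0 powr (a - 2) * (Q' 0)\<^sup>2)"
proof (rule second_deriv0I)
  have Q0: "(Q has_real_derivative Q' 0) (at 0)" using Q(1) by (rule eventually_nhds_x_imp_x)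
  have "isCont Q 0" using Q0 DERIV_isCont by blast
  then have "(Q \<longlongrightarrow> Q 0) (nhds 0)" by (simp add: tendsto_at_iff_tendsto_nhds continuous_at)
  then have "\<forall>\<^sub>F t in nhds 0. Q t > 0" using pos by (rule order_tendstoD)
  then show "\<forall>\<^sub>F t in nhds 0. ((\<lambda>t. Q t powr a) has_real_derivative a * Q t powr (a - 1) * Q' t) (at t)"
    using Q(1)
  proof eventually_elim
    case (elim t)
    show ?case by (rule DERIV_chain2[OF has_real_derivative_powr elim(2)]) (rule elim(1))
  qed
  have "((\<lambda>t. Q t powr (a - 1)) has_real_derivative (a - 1) * Q 0 powr (a - 1 - 1) * Q' 0) (at 0)"
    by (rule DERIV_chain2[OF has_real_derivative_powr Q0]) (rule pos)
  from DERIV_cmult[OF DERIV_mult[OF this Q(2)], of a]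
  show "((\<lambda>t. a * Q t powr (a - 1) * Q' t) has_real_derivative
      a * Q 0 powr (a - 1) * Q2 + a * (a - 1) * Q 0 powr (a - 2) * (Q' 0)\<^sup>2) (at 0)"
    by (simp add: mult.assoc power2_eq_square algebra_simps)
qed

section \<open>Ridges and cusps\<close>

definition ridge :: "real \<Rightarrow> real" where
  "ridge t = \<bar>t\<bar> + \<bar>t\<bar> powr (3/2)"

text \<open>The second derivative of \<open>ridge\<close> away from 0. At 0 it evaluates to 0,
  because \<open>0 powr a = 0\<close>, and not to the infinite limit; there the cut Hessian uses its
  parameter K instead.\<close>

definition ridge2 :: "real \<Rightarrow> real" where
  "ridge2 t = 3/4 * \<bar>t\<bar> powr (-1/2)"

lemma ridge_0 [simp]: "ridge 0 = 0" by (simp add: ridge_def)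

lemma ridge_ge: "\<bar>t\<bar> \<le> ridge t" by (simp add: ridge_def)

lemma ridge_le: assumes "\<bar>t\<bar> \<le> 1" shows "ridge t \<le> 2 * \<bar>t\<bar>"
  using powr_mono'[of 1 "3/2" "\<bar>t\<bar>"] assms by (cases "t = 0") (auto simp: ridge_def)

lemma second_deriv0_ridge:
  assumes "c \<noteq> 0"
  shows "second_deriv0 (\<lambda>t. ridge (c + t * k)) (ridge2 c * k\<^sup>2)"
proof -
  define Q where "Q t = \<bar>c\<bar> + t * (sgn c * k)" for t
  have "second_deriv0 (\<lambda>t. Q t powr (3/2)) (3/2 * Q 0 powr (3/2 - 1) * 0 + 3/2 * (3/2 - 1) * Q 0 powr (3/2 - 2) * (sgn c * k)\<^sup>2)"
    by (rule second_deriv0_powr) (use assms in \<open>auto simp: Q_def intro!: derivative_eq_intros always_eventually\<close>)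
  from second_deriv0_add[OF this second_deriv0_affine[of "\<bar>c\<bar>" "sgn c * k"]]
  have "second_deriv0 (\<lambda>t. Q t powr (3/2) + Q t) (ridge2 c * k\<^sup>2)"
  proof -
    have "(sgn c * k)\<^sup>2 = k\<^sup>2" using assms by (simp add: power_mult_distrib sgn_if)
    moreover have "Q 0 = \<bar>c\<bar>" by (simp add: Q_def)
    ultimately show ?thesis
      using \<open>second_deriv0 (\<lambda>t. Q t powr (3/2) + (\<bar>c\<bar> + t * (sgn c * k))) _\<close>
      by (simp add: ridge2_def flip: Q_def)
  qed
  moreover have "\<forall>\<^sub>F t in nhds 0. ridge (c + t * k) = Q t powr (3/2) + Q t"
  proof -
    have "((\<lambda>t. sgn c * (c + t * k)) \<longlongrightarrow> sgn c * (c + 0 * k)) (nhds 0)"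
      by (intro tendsto_intros filterlim_ident)
    then have "\<forall>\<^sub>F t in nhds 0. sgn c * (c + t * k) > 0"
      by (rule order_tendstoD(1)) (use assms in \<open>simp add: sgn_if\<close>)
    then show ?thesis
    proof eventually_elim
      case (elim t)
      then have "\<bar>c + t * k\<bar> = Q t" using assms by (auto simp: Q_def sgn_if abs_if split: if_splits)
      then show ?case by (simp add: ridge_def)
    qed
  qed
  ultimately show ?thesis by (rule second_deriv0_cong)
qed

lemma continuous_ridge: "continuous_on S ridge"
  unfolding ridge_def[abs_def] by (intro continuous_intros continuous_on_powr') auto

lemma tendsto_ridge2: "c \<noteq> 0 \<Longrightarrow> (f \<longlongrightarrow> c) F \<Longrightarrow> ((\<lambda>x. ridge2 (f x)) \<longlongrightarrow> ridge2 c) F"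
  unfolding ridge2_def by (intro tendsto_intros) auto

lemma ridge2_nonneg: "0 \<le> ridge2 t" by (simp add: ridge2_def)

text \<open>For a unit vector \<theta> the square root is comparable near P to the distance from the
  hyperplane through P orthogonal to \<theta>, plus the squared distance from P.\<close>

definition gauge :: "real^'n \<Rightarrow> real^'n \<Rightarrow> real^'n \<Rightarrow> real" where
  "gauge P \<theta> x = (\<theta> \<bullet> (x - P))\<^sup>2 + ((x - P) \<bullet> (x - P))\<^sup>2"

definition gauge_grad :: "real^'n \<Rightarrow> real^'n \<Rightarrow> real^'n \<Rightarrow> real^'n" where
  "gauge_grad P \<theta> x = (2 * (\<theta> \<bullet> (x - P))) *\<^sub>R \<theta> + (4 * ((x - P) \<bullet> (x - P))) *\<^sub>R (x - P)"

definition gauge_hess :: "real^'n \<Rightarrow> real^'n \<Rightarrow> real^'n \<Rightarrow> real^'n^'n" where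
  "gauge_hess P \<theta> x = 2 *\<^sub>R outer \<theta> + (4 * ((x - P) \<bullet> (x - P))) *\<^sub>R mat 1 + 8 *\<^sub>R outer (x - P)"

definition gauge_powr_hess :: "real \<Rightarrow> real^'n \<Rightarrow> real^'n \<Rightarrow> real^'n \<Rightarrow> real^'n^'n" where
  "gauge_powr_hess a P \<theta> x = (a * gauge P \<theta> x powr (a - 1)) *\<^sub>R gauge_hess P \<theta> x
     + (a * (a - 1) * gauge P \<theta> x powr (a - 2)) *\<^sub>R outer (gauge_grad P \<theta> x)"

lemma gauge_pos: "x \<noteq> P \<Longrightarrow> gauge P \<theta> x > 0"
  unfolding gauge_def by (intro add_nonneg_pos) auto

lemma gauge_nonneg: "gauge P \<theta> x \<ge> 0"
  unfolding gauge_def by (intro add_nonneg_nonneg) auto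

lemma qf_gauge_hess: "qf (gauge_hess P \<theta> x) v = 2 * (\<theta> \<bullet> v)\<^sup>2 + 4 * ((x - P) \<bullet> (x - P)) * (v \<bullet> v) + 8 * ((x - P) \<bullet> v)\<^sup>2"
  by (simp add: gauge_hess_def qf_add qf_scaleR qf_outer qf_mat_1)

lemma second_deriv0_gauge_powr:
  assumes "x \<noteq> P"
  shows "second_deriv0 (\<lambda>t. gauge P \<theta> (x + t *\<^sub>R v) powr a) (qf (gauge_powr_hess a P \<theta> x) v)"
proof -
  define d where "d = x - P"
  define Q where "Q t = (\<theta> \<bullet> d + t * (\<theta> \<bullet> v))\<^sup>2 + (d \<bullet> d + 2 * t * (d \<bullet> v) + t\<^sup>2 * (v \<bullet> v))\<^sup>2" for t
  define Q' where "Q' t = 2 * (\<theta> \<bullet> d + t * (\<theta> \<bullet> v)) * (\<theta> \<bullet> v)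
     + 2 * (d \<bullet> d + 2 * t * (d \<bullet> v) + t\<^sup>2 * (v \<bullet> v)) * (2 * (d \<bullet> v) + 2 * t * (v \<bullet> v))" for t
  have Q: "gauge P \<theta> (x + t *\<^sub>R v) = Q t" for t
  proof -
    have "x + t *\<^sub>R v - P = d + t *\<^sub>R v" by (simp add: d_def)
    then show ?thesis
      by (simp add: gauge_def Q_def inner_add_left inner_add_right inner_commute power2_eq_square algebra_simps)
  qed
  have "\<forall>\<^sub>F t in nhds 0. (Q has_real_derivative Q' t) (at t)"
    unfolding Q_def[abs_def] Q'_def
    by (intro always_eventually allI) (auto intro!: derivative_eq_intros simp: algebra_simps)
  moreover have "(Q' has_real_derivative qf (gauge_hess P \<theta> x) v) (at 0)"
    unfolding Q'_def[abs_def] qf_gauge_hess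
    by (auto intro!: derivative_eq_intros simp: d_def power2_eq_square algebra_simps)
  moreover have "Q 0 > 0" using Q[of 0] gauge_pos[OF assms, of \<theta>] by simp
  ultimately have "second_deriv0 (\<lambda>t. Q t powr a) (a * Q 0 powr (a - 1) * qf (gauge_hess P \<theta> x) v + a * (a - 1) * Q 0 powr (a - 2) * (Q' 0)\<^sup>2)"
    by (rule second_deriv0_powr)
  moreover have "Q' 0 = gauge_grad P \<theta> x \<bullet> v"
    by (simp add: Q'_def gauge_grad_def d_def inner_add_left)
  ultimately show ?thesis
    using Q[of 0] by (simp add: Q gauge_powr_hess_def qf_add qf_scaleR qf_outer)
qed

text \<open>The only negative contribution is the rank-one term from the squared gradient.
  Cauchy-Schwarz bounds it by 1 - a times 4 s^2 + 16 z^2, against 2 s^2 + 8 z^2 from the Hessian of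
  the gauge; what is left is nonnegative exactly from a = 1/2 on, where the bound becomes 0.\<close>

lemma gauge_powr_hess_lower:
  assumes "x \<noteq> P" and a: "1/2 \<le> a" "a \<le> 1"
  shows "a * (4 * a - 2) * gauge P \<theta> x powr (a - 1) * (\<theta> \<bullet> v)\<^sup>2 \<le> qf (gauge_powr_hess a P \<theta> x) v"
proof -
  define q where "q = gauge P \<theta> x"
  define y where "y = \<theta> \<bullet> (x - P)"
  define r where "r = (x - P) \<bullet> (x - P)"
  define s where "s = \<theta> \<bullet> v"
  define z where "z = (x - P) \<bullet> v"
  have q: "q > 0" "q = y\<^sup>2 + r\<^sup>2" using gauge_pos[OF assms(1), of \<theta>] by (simp_all add: q_def gauge_def y_def r_def)
  have w: "gauge_grad P \<theta> x \<bullet> v = 2 * y * s + 4 * r * z"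
    by (simp add: gauge_grad_def inner_add_left y_def r_def s_def z_def)
  have "(2 * y * s + 4 * r * z)\<^sup>2 \<le> q * (4 * s\<^sup>2 + 16 * z\<^sup>2)"
  proof -
    \<comment> \<open>Lagrange's identity for the pairs (y, r) and (2 s, 4 z).\<close>
    have "q * (4 * s\<^sup>2 + 16 * z\<^sup>2) - (2 * y * s + 4 * r * z)\<^sup>2 = (4 * y * z - 2 * r * s)\<^sup>2"
      unfolding q(2) by (simp add: power2_eq_square algebra_simps)
    then show ?thesis by (metis diff_ge_0_iff_ge zero_le_power2)
  qed
  then have "q powr (a - 2) * (2 * y * s + 4 * r * z)\<^sup>2 \<le> q powr (a - 2) * (q * (4 * s\<^sup>2 + 16 * z\<^sup>2))"
    by (intro mult_left_mono) auto
  also have "\<dots> = q powr (a - 1) * (4 * s\<^sup>2 + 16 * z\<^sup>2)"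
    using q(1) powr_add[of q "a - 2" 1] by (simp add: mult.assoc[symmetric])
  finally have cs: "q powr (a - 2) * (2 * y * s + 4 * r * z)\<^sup>2 \<le> q powr (a - 1) * (4 * s\<^sup>2 + 16 * z\<^sup>2)" .
  have nn: "0 \<le> r" "0 \<le> v \<bullet> v" by (simp_all add: r_def)
  have "a * (4 * a - 2) * q powr (a - 1) * s\<^sup>2
     \<le> (a * q powr (a - 1)) * ((4 * a - 2) * s\<^sup>2 + (16 * a - 8) * z\<^sup>2 + 4 * r * (v \<bullet> v))"
  proof -
    have "0 \<le> (16 * a - 8) * z\<^sup>2 + 4 * r * (v \<bullet> v)" using a nn by simp
    then have "0 \<le> (a * q powr (a - 1)) * ((16 * a - 8) * z\<^sup>2 + 4 * r * (v \<bullet> v))"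
      using a by (intro mult_nonneg_nonneg) auto
    then show ?thesis by (simp add: algebra_simps)
  qed
  also have "\<dots> = a * q powr (a - 1) * (2 * s\<^sup>2 + 4 * r * (v \<bullet> v) + 8 * z\<^sup>2) - a * (1 - a) * (q powr (a - 1) * (4 * s\<^sup>2 + 16 * z\<^sup>2))"
    by (simp add: algebra_simps)
  also have "\<dots> \<le> a * q powr (a - 1) * (2 * s\<^sup>2 + 4 * r * (v \<bullet> v) + 8 * z\<^sup>2) - a * (1 - a) * (q powr (a - 2) * (2 * y * s + 4 * r * z)\<^sup>2)"
    using cs a by (intro diff_left_mono mult_left_mono) auto
  also have "\<dots> = qf (gauge_powr_hess a P \<theta> x) v"
    by (simp add: gauge_powr_hess_def qf_add qf_scaleR qf_outer w qf_gauge_hess flip: q_def r_def s_def z_def) (simp add: algebra_simps)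
  finally show ?thesis by (simp add: q_def s_def)
qed

text \<open>The rank-one term is negative and is dropped. Since r^2 \<le> q, the factor
  \<open>q powr (a - 1) * r\<close> is at most \<open>q powr (a - 1/2)\<close>, hence at most 1, and
  the isotropic terms with coefficients 4 and 8 make up the constant 12.\<close>

lemma gauge_powr_hess_upper:
  assumes "x \<noteq> P" and a: "1/2 \<le> a" "a \<le> 1" and q1: "gauge P \<theta> x \<le> 1"
  shows "qf (gauge_powr_hess a P \<theta> x) v \<le> 2 * a * gauge P \<theta> x powr (a - 1) * (\<theta> \<bullet> v)\<^sup>2 + 12 * (v \<bullet> v)"
proof -
  define q where "q = gauge P \<theta> x"
  define r where "r = (x - P) \<bullet> (x - P)"
  have q: "q > 0" using gauge_pos[OF assms(1), of \<theta>] by (simp add: q_def)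
  have nn: "0 \<le> r" "0 \<le> v \<bullet> v" by (simp_all add: r_def)
  have "r\<^sup>2 \<le> q" by (simp add: q_def gauge_def r_def)
  then have "r \<le> sqrt q" by (simp add: real_le_rsqrt)
  then have "q powr (a - 1) * r \<le> q powr (a - 1) * q powr (1/2)"
    using q by (intro mult_left_mono) (auto simp: powr_half_sqrt)
  also have "\<dots> = q powr (a - 1/2)" by (simp flip: powr_add)
  also have "\<dots> \<le> 1" using q q1 a powr_le1[of "a - 1/2" q] by (simp add: q_def)
  finally have qr: "q powr (a - 1) * r \<le> 1" .
  have cs: "((x - P) \<bullet> v)\<^sup>2 \<le> r * (v \<bullet> v)" unfolding r_def by (rule Cauchy_Schwarz_ineq)
  have "qf (gauge_powr_hess a P \<theta> x) v \<le> a * q powr (a - 1) * (2 * (\<theta> \<bullet> v)\<^sup>2 + 4 * r * (v \<bullet> v) + 8 * ((x - P) \<bullet> v)\<^sup>2)"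
  proof -
    have "a * (a - 1) * q powr (a - 2) * (gauge_grad P \<theta> x \<bullet> v)\<^sup>2 \<le> 0"
    proof -
      have "a * (a - 1) \<le> 0" using a by (intro mult_nonneg_nonpos) auto
      then show ?thesis by (simp add: mult_nonpos_nonneg)
    qed
    then show ?thesis
      by (simp add: gauge_powr_hess_def qf_add qf_scaleR qf_outer qf_gauge_hess flip: q_def r_def)
  qed
  also have "\<dots> \<le> a * q powr (a - 1) * (2 * (\<theta> \<bullet> v)\<^sup>2 + 4 * r * (v \<bullet> v) + 8 * (r * (v \<bullet> v)))"
    using cs a by (intro mult_left_mono add_left_mono) auto
  also have "\<dots> = 2 * a * q powr (a - 1) * (\<theta> \<bullet> v)\<^sup>2 + 12 * a * ((q powr (a - 1) * r) * (v \<bullet> v))"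
    by (simp add: algebra_simps)
  also have "\<dots> \<le> 2 * a * q powr (a - 1) * (\<theta> \<bullet> v)\<^sup>2 + 12 * (v \<bullet> v)"
  proof -
    have "(q powr (a - 1) * r) * (v \<bullet> v) \<le> v \<bullet> v" using mult_right_mono[OF qr nn(2)] by simp
    then have "a * ((q powr (a - 1) * r) * (v \<bullet> v)) \<le> 1 * (v \<bullet> v)"
      using a nn by (intro mult_mono) auto
    then show ?thesis by simp
  qed
  finally show ?thesis by (simp add: q_def)
qed

lemma transpose_gauge_powr_hess: "transpose (gauge_powr_hess a P \<theta> x) = gauge_powr_hess a P \<theta> x"
  unfolding gauge_powr_hess_def gauge_hess_def by (intro transpose_simps) (simp_all add: transpose_mat)

lemma tendsto_outer: "(f \<longlongrightarrow> a) F \<Longrightarrow> ((\<lambda>x. outer (f x)) \<longlongrightarrow> outer a) F"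
  unfolding outer_def by (intro vec_tendstoI) (auto intro!: tendsto_intros)

lemma tendsto_gauge_powr_hess:
  assumes "x \<noteq> P"
  shows "((\<lambda>y. gauge_powr_hess a P \<theta> y) \<longlongrightarrow> gauge_powr_hess a P \<theta> x) (nhds x)"
proof -
  have q: "((\<lambda>y. gauge P \<theta> y) \<longlongrightarrow> gauge P \<theta> x) (nhds x)"
    unfolding gauge_def by (intro tendsto_intros filterlim_ident)
  show ?thesis
    unfolding gauge_powr_hess_def gauge_hess_def gauge_grad_def
    using gauge_pos[OF assms, of \<theta>] by (intro tendsto_intros tendsto_outer q filterlim_ident) auto
qed

definition cusp :: "real \<Rightarrow> real^'n \<Rightarrow> real^'n \<Rightarrow> real^'n \<Rightarrow> real" where
  "cusp C P \<theta> x = C * gauge P \<theta> x powr (1/2) + gauge P \<theta> x powr (5/8)"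

definition cusp_hess :: "real \<Rightarrow> real^'n \<Rightarrow> real^'n \<Rightarrow> real^'n \<Rightarrow> real^'n^'n" where
  "cusp_hess C P \<theta> x = C *\<^sub>R gauge_powr_hess (1/2) P \<theta> x + gauge_powr_hess (5/8) P \<theta> x"

lemma second_deriv0_cusp:
  "x \<noteq> P \<Longrightarrow> second_deriv0 (\<lambda>t. cusp C P \<theta> (x + t *\<^sub>R v)) (qf (cusp_hess C P \<theta> x) v)"
  unfolding cusp_def cusp_hess_def qf_add qf_scaleR
  by (intro second_deriv0_add second_deriv0_cmult second_deriv0_gauge_powr)

lemma transpose_cusp_hess: "transpose (cusp_hess C P \<theta> x) = cusp_hess C P \<theta> x"
  unfolding cusp_hess_def by (intro transpose_simps transpose_gauge_powr_hess)

lemma tendsto_cusp_hess: "x \<noteq> P \<Longrightarrow> ((\<lambda>y. cusp_hess C P \<theta> y) \<longlongrightarrow> cusp_hess C P \<theta> x) (nhds x)"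
  unfolding cusp_hess_def by (intro tendsto_intros tendsto_gauge_powr_hess)

lemma continuous_cusp: "continuous_on S (cusp C P \<theta>)"
proof -
  have q: "continuous_on S (gauge P \<theta>)"
    unfolding gauge_def[abs_def] by (intro continuous_intros)
  show ?thesis
    unfolding cusp_def[abs_def] by (intro continuous_intros continuous_on_powr' q) (auto simp: gauge_nonneg)
qed

text \<open>The square-root part contributes at least 0; for a = 5/8 the coefficient a (4 a - 2) is
  5/16 and the exponent a - 1 is -3/8.\<close>

lemma cusp_hess_lower:
  assumes "x \<noteq> P" "C \<ge> 0"
  shows "5/16 * gauge P \<theta> x powr (-3/8) * (\<theta> \<bullet> v)\<^sup>2 \<le> qf (cusp_hess C P \<theta> x) v"
proof -
  have "0 \<le> qf (gauge_powr_hess (1/2) P \<theta> x) v" using gauge_powr_hess_lower[OF assms(1), of "1/2" \<theta> v] by simp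
  then have "0 \<le> C * qf (gauge_powr_hess (1/2) P \<theta> x) v" using assms(2) by simp
  then show ?thesis
    using gauge_powr_hess_lower[OF assms(1), of "5/8" \<theta> v] by (simp add: cusp_hess_def qf_add qf_scaleR)
qed

lemma cusp_hess_upper:
  assumes "x \<noteq> P" "C \<ge> 0" "gauge P \<theta> x \<le> 1"
  shows "qf (cusp_hess C P \<theta> x) v \<le> (C + 2) * gauge P \<theta> x powr (-1/2) * (\<theta> \<bullet> v)\<^sup>2 + 12 * (C + 1) * (v \<bullet> v)"
proof -
  have 1: "C * qf (gauge_powr_hess (1/2) P \<theta> x) v \<le> C * (gauge P \<theta> x powr (-1/2) * (\<theta> \<bullet> v)\<^sup>2 + 12 * (v \<bullet> v))"
    using gauge_powr_hess_upper[OF assms(1), of "1/2" \<theta> v] assms by (intro mult_left_mono) auto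
  have "gauge P \<theta> x powr (-3/8) \<le> gauge P \<theta> x powr (-1/2)"
    using assms gauge_pos[OF assms(1), of \<theta>] by (intro powr_mono') auto
  then have "5/4 * gauge P \<theta> x powr (-3/8) * (\<theta> \<bullet> v)\<^sup>2 \<le> 2 * gauge P \<theta> x powr (-1/2) * (\<theta> \<bullet> v)\<^sup>2"
    by (intro mult_right_mono mult_mono) auto
  then have 2: "qf (gauge_powr_hess (5/8) P \<theta> x) v \<le> 2 * gauge P \<theta> x powr (-1/2) * (\<theta> \<bullet> v)\<^sup>2 + 12 * (v \<bullet> v)"
    using gauge_powr_hess_upper[OF assms(1), of "5/8" \<theta> v] assms(3) by simp
  show ?thesis using 1 2 by (simp add: cusp_hess_def qf_add qf_scaleR algebra_simps)
qed

lemma cusp_kink: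
  assumes "norm \<theta> = 1" "C \<ge> 0"
  shows "C * \<bar>t\<bar> \<le> cusp C P \<theta> (P + t *\<^sub>R \<theta>)"
proof -
  have "\<bar>t\<bar> = (t\<^sup>2) powr (1/2)" by (simp add: powr_half_sqrt)
  also have "\<dots> \<le> gauge P \<theta> (P + t *\<^sub>R \<theta>) powr (1/2)"
    using assms(1) by (intro powr_mono2) (auto simp: gauge_def norm_eq_1)
  finally have "C * \<bar>t\<bar> \<le> C * gauge P \<theta> (P + t *\<^sub>R \<theta>) powr (1/2)" using assms(2) by (rule mult_left_mono)
  then show ?thesis by (simp add: cusp_def add_increasing2)
qed

text \<open>Orthogonally to \<theta> the gauge is t^4, so its square root is t^2 and the cusp has no
  kink in these directions.\<close>

lemma cusp_orthogonal:
  assumes "\<theta> \<bullet> v = 0" "norm v = 1" "C \<ge> 0" "\<bar>t\<bar> \<le> 1"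
  shows "0 \<le> cusp C P \<theta> (P + t *\<^sub>R v)" "cusp C P \<theta> (P + t *\<^sub>R v) \<le> (C + 1) * t\<^sup>2"
proof -
  show "0 \<le> cusp C P \<theta> (P + t *\<^sub>R v)" using assms(3) by (simp add: cusp_def)
  have q: "gauge P \<theta> (P + t *\<^sub>R v) = (t\<^sup>2)\<^sup>2"
    using assms by (simp add: gauge_def norm_eq_1 power2_eq_square)
  have 1: "gauge P \<theta> (P + t *\<^sub>R v) powr (1/2) = t\<^sup>2"
    unfolding q using powr_half_sqrt[of "(t\<^sup>2)\<^sup>2"] real_sqrt_abs[of "t\<^sup>2"] by (simp only: abs_power2 zero_le_power2)
  have "t\<^sup>2 \<le> 1" using assms(4) by (simp add: abs_square_le_1)
  then have "(t\<^sup>2)\<^sup>2 \<le> 1" by (rule power_le_one[rotated]) simp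
  then have "gauge P \<theta> (P + t *\<^sub>R v) powr (5/8) \<le> gauge P \<theta> (P + t *\<^sub>R v) powr (1/2)"
    unfolding q by (cases "t = 0") (auto intro!: powr_mono')
  then show "cusp C P \<theta> (P + t *\<^sub>R v) \<le> (C + 1) * t\<^sup>2"
    by (simp add: cusp_def 1 algebra_simps)
qed

section \<open>Singular functions on a hyperplane arrangement\<close>

definition ell :: "(real^'n) \<times> real \<Rightarrow> real^'n \<Rightarrow> real" where
  "ell a x = fst a \<bullet> x - snd a"

lemma tendsto_ell: "((\<lambda>x. ell a x) \<longlongrightarrow> ell a x0) (nhds x0)"
  unfolding ell_def by (intro tendsto_intros filterlim_ident)

lemma ell_add: "ell a (x + v) = ell a x + fst a \<bullet> v"
  by (simp add: ell_def inner_add_right)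

lemma line_filterlim: "filterlim (\<lambda>t. x0 + t *\<^sub>R v) (nhds (x0::real^'n)) (nhds (0::real))"
proof -
  have "((\<lambda>t. x0 + t *\<^sub>R v) \<longlongrightarrow> x0 + 0 *\<^sub>R v) (nhds (0::real))"
    by (intro tendsto_intros filterlim_ident)
  then show ?thesis by simp
qed

text \<open>The function r carries the part of the solution that is regular along the line;
  subtracting it from the test function leaves something differentiable, which cannot have a kink.
  The factor k is 1 or - 1, for contact from above or from below.\<close>

lemma C2_no_kink:
  assumes "C2_on U \<phi>" "x0 \<in> U" and r: "second_deriv0 r L" and c: "0 < c"
    and ev: "\<forall>\<^sub>F t in nhds 0. c * \<bar>t\<bar> \<le> k * ((\<phi> (x0 + t *\<^sub>R v) - r t) - (\<phi> x0 - r 0))"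
  shows False
proof -
  have "second_deriv0 (\<lambda>t. \<phi> (x0 + t *\<^sub>R v) - r t) (qf (hessian \<phi> x0) v - L)"
    by (intro second_deriv0_diff second_deriv0_C2[OF assms(1,2)] r)
  then obtain d where "((\<lambda>t. \<phi> (x0 + t *\<^sub>R v) - r t) has_real_derivative d) (at 0)"
    by (rule second_deriv0_imp_deriv)
  from DERIV_cmult[OF DERIV_diff[OF this DERIV_const]] show False
    by (rule differentiable_no_kink[OF _ _ c ev]) simp
qed

lemma no_touch_above:
  assumes \<phi>: "C2_on U \<phi>" "x0 \<in> U" "touches_above_at \<phi> u x0" and r: "second_deriv0 r L" and c: "0 < c"
    and ev: "\<forall>\<^sub>F t in nhds 0. r t - r 0 + c * \<bar>t\<bar> \<le> u (x0 + t *\<^sub>R v) - u x0"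
  shows False
proof (rule C2_no_kink[OF \<phi>(1,2) r c])
  have u: "\<forall>\<^sub>F x in nhds x0. u x \<le> \<phi> x" "\<phi> x0 = u x0" using \<phi>(3) by (auto simp: touches_above_at_def)
  show "\<forall>\<^sub>F t in nhds 0. c * \<bar>t\<bar> \<le> 1 * ((\<phi> (x0 + t *\<^sub>R v) - r t) - (\<phi> x0 - r 0))"
    using eventually_compose_filterlim[OF u(1) line_filterlim[of x0 v]] ev by eventually_elim (simp add: u(2))
qed

lemma no_touch_below:
  assumes \<phi>: "C2_on U \<phi>" "x0 \<in> U" "touches_below_at \<phi> u x0" and r: "second_deriv0 r L" and c: "0 < c"
    and ev: "\<forall>\<^sub>F t in nhds 0. u (x0 + t *\<^sub>R v) - u x0 \<le> r t - r 0 - c * \<bar>t\<bar>"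
  shows False
proof (rule C2_no_kink[OF \<phi>(1,2) r c])
  have u: "\<forall>\<^sub>F x in nhds x0. \<phi> x \<le> u x" "\<phi> x0 = u x0" using \<phi>(3) by (auto simp: touches_below_at_def)
  show "\<forall>\<^sub>F t in nhds 0. c * \<bar>t\<bar> \<le> - 1 * ((\<phi> (x0 + t *\<^sub>R v) - r t) - (\<phi> x0 - r 0))"
    using eventually_compose_filterlim[OF u(1) line_filterlim[of x0 v]] ev by eventually_elim (simp add: u(2))
qed

section \<open>Spanning normals and generic directions\<close>

lemma spanning_quadratic_lower:
  fixes f :: "'a \<Rightarrow> real^'n"
  assumes fin: "finite J" and sp: "span (f ` J) = UNIV"
  obtains \<kappa> where "\<kappa> > 0" "\<And>v. \<kappa> * (v \<bullet> v) \<le> (\<Sum>a\<in>J. (f a \<bullet> v)\<^sup>2)"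
proof -
  define P where "P = (\<Sum>a\<in>J. outer (f a))"
  have P: "qf P v = (\<Sum>a\<in>J. (f a \<bullet> v)\<^sup>2)" for v by (simp add: P_def qf_sum qf_outer)
  have "sphere (0 :: real^'n) 1 \<noteq> {}" by simp
  then obtain b where b: "b \<in> sphere 0 1" "\<And>v. v \<in> sphere 0 1 \<Longrightarrow> qf P b \<le> qf P v"
    using continuous_attains_inf[OF compact_sphere _ continuous_qf[of "sphere 0 1" P]] by blast
  have "qf P b \<noteq> 0"
  proof
    assume "qf P b = 0"
    then have "\<forall>a\<in>J. f a \<bullet> b = 0" unfolding P using fin by (simp add: sum_nonneg_eq_0_iff)
    then have "orthogonal b y" if "y \<in> f ` J" for y using that by (auto simp: orthogonal_def inner_commute)
    then have "orthogonal b b" using orthogonal_to_span[of b "f ` J" b] sp by blast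
    then show False using b(1) by (simp add: orthogonal_def)
  qed
  moreover have "0 \<le> qf P b" unfolding P by (simp add: sum_nonneg)
  ultimately have pos: "qf P b > 0" by simp
  have "- qf P v \<le> 0 * qf P v + (- qf P b) * (v \<bullet> v)" for v
    using qf_unit_sphereI[of "- P" 0 P "- qf P b"] b(2) by (simp add: qf_uminus)
  then show thesis using that[OF pos] by (simp add: P)
qed

text \<open>If \<open>z\<close> is close to the common kernel of some of the normals, it can be traded for a
  vector \<open>v\<close> in that kernel which is not orthogonal to \<open>\<theta>\<close>.\<close>

lemma transversal_direction:
  fixes \<theta> :: "real^'n" and f :: "'a \<Rightarrow> real^'n"
  assumes fin: "finite N"
    and gen: "\<And>J. J \<subseteq> N \<Longrightarrow> \<theta> \<in> span (f ` J) \<Longrightarrow> span (f ` J) = UNIV"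
  obtains C1 C2 where "0 \<le> C1" "0 < C2"
    "\<And>z. z \<noteq> 0 \<Longrightarrow> \<exists>v. \<theta> \<bullet> v = 1 \<and> norm v \<le> C2 \<and> (\<forall>a\<in>N. \<bar>f a \<bullet> v\<bar> \<le> C1 * (\<bar>f a \<bullet> z\<bar> / norm z))"
proof -
  \<comment> \<open>The component of \<theta> orthogonal to the span, suitably scaled, is such a
    vector.\<close>
  have "\<exists>v. \<theta> \<bullet> v = 1 \<and> (\<forall>a\<in>J. f a \<bullet> v = 0)" if "\<theta> \<notin> span (f ` J)" for J
  proof -
    obtain y z where yz: "y \<in> span (f ` J)" "\<And>u. u \<in> span (f ` J) \<Longrightarrow> orthogonal z u" "\<theta> = y + z"
      using orthogonal_subspace_decomp_exists by blast
    have "z \<noteq> 0" using yz that by auto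
    have "\<theta> \<bullet> z = z \<bullet> z"
      using yz(2)[OF yz(1)] by (simp add: yz(3) inner_add_left orthogonal_def inner_commute[of y])
    then have "\<theta> \<bullet> (z /\<^sub>R (z \<bullet> z)) = 1" using \<open>z \<noteq> 0\<close> by simp
    moreover have "f a \<bullet> (z /\<^sub>R (z \<bullet> z)) = 0" if "a \<in> J" for a
      using yz(2)[of "f a"] that by (simp add: orthogonal_def inner_commute span_base)
    ultimately show ?thesis by blast
  qed
  then obtain V where V: "\<And>J. \<theta> \<notin> span (f ` J) \<Longrightarrow> \<theta> \<bullet> V J = 1"
    "\<And>J a. \<theta> \<notin> span (f ` J) \<Longrightarrow> a \<in> J \<Longrightarrow> f a \<bullet> V J = 0" by metis
  \<comment> \<open>If \<theta> lies in the span of the normals in J, these span everything, and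
    then no z can be nearly orthogonal to all of them.\<close>
  have "\<exists>\<epsilon>>0. \<forall>z. z \<noteq> 0 \<longrightarrow> (\<exists>a\<in>J. \<epsilon> * norm z < \<bar>f a \<bullet> z\<bar>)" if J: "J \<subseteq> N" "\<theta> \<in> span (f ` J)" for J
  proof -
    have finJ: "finite J" using J fin finite_subset by blast
    obtain \<kappa> where \<kappa>: "\<kappa> > 0" "\<And>v. \<kappa> * (v \<bullet> v) \<le> (\<Sum>a\<in>J. (f a \<bullet> v)\<^sup>2)"
      using spanning_quadratic_lower[OF finJ gen[OF J]] by blast
    \<comment> \<open>The summand 1 makes \<open>card J * \<epsilon>^2\<close> strictly smaller than
      \<kappa>, also for empty J.\<close>
    define \<epsilon> where "\<epsilon> = sqrt (\<kappa> / (real (card J) + 1))"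
    have \<epsilon>: "\<epsilon> > 0" "\<epsilon>\<^sup>2 = \<kappa> / (real (card J) + 1)" using \<kappa> by (auto simp: \<epsilon>_def)
    have "\<exists>a\<in>J. \<epsilon> * norm z < \<bar>f a \<bullet> z\<bar>" if "z \<noteq> 0" for z
    proof (rule ccontr)
      assume "\<not> (\<exists>a\<in>J. \<epsilon> * norm z < \<bar>f a \<bullet> z\<bar>)"
      then have "(f a \<bullet> z)\<^sup>2 \<le> (\<epsilon> * norm z)\<^sup>2" if "a \<in> J" for a
        using that \<epsilon>(1) by (intro abs_le_square_iff[THEN iffD1]) (auto simp: not_less)
      then have "(\<Sum>a\<in>J. (f a \<bullet> z)\<^sup>2) \<le> real (card J) * (\<epsilon> * norm z)\<^sup>2"
        by (rule sum_bounded_above)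
      with \<kappa>(2)[of z] have "\<kappa> * (norm z)\<^sup>2 \<le> real (card J) * (\<kappa> / (real (card J) + 1)) * (norm z)\<^sup>2"
        by (simp add: power_mult_distrib \<epsilon>(2) power2_norm_eq_inner)
      then have "\<kappa> \<le> real (card J) * (\<kappa> / (real (card J) + 1))"
        by (rule mult_right_le_imp_le) (use that in simp)
      then show False using \<kappa>(1) by (simp add: field_simps)
    qed
    then show ?thesis using \<epsilon>(1) by blast
  qed
  then have "\<exists>E. \<forall>J. J \<subseteq> N \<longrightarrow> \<theta> \<in> span (f ` J) \<longrightarrow> (E J > 0 \<and> (\<forall>z. z \<noteq> 0 \<longrightarrow> (\<exists>a\<in>J. E J * norm z < \<bar>f a \<bullet> z\<bar>)))"
    by metis
  then obtain E where E: "\<And>J. J \<subseteq> N \<Longrightarrow> \<theta> \<in> span (f ` J) \<Longrightarrow> E J > 0"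
    "\<And>J z. J \<subseteq> N \<Longrightarrow> \<theta> \<in> span (f ` J) \<Longrightarrow> z \<noteq> 0 \<Longrightarrow> \<exists>a\<in>J. E J * norm z < \<bar>f a \<bullet> z\<bar>" by blast
  define \<epsilon> where "\<epsilon> = Min (insert 1 (E ` {J. J \<subseteq> N \<and> \<theta> \<in> span (f ` J)}))"
  have finE: "finite (insert 1 (E ` {J. J \<subseteq> N \<and> \<theta> \<in> span (f ` J)}))" using fin by simp
  have \<epsilon>: "\<epsilon> > 0" unfolding \<epsilon>_def using finE E(1) by (subst Min_gr_iff) auto
  have \<epsilon>E: "\<epsilon> \<le> E J" if "J \<subseteq> N" "\<theta> \<in> span (f ` J)" for J
    unfolding \<epsilon>_def using finE that by (intro Min_le) auto
  define C2 where "C2 = 1 + (\<Sum>J\<in>Pow N. norm (V J))"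
  have C2: "0 < C2" unfolding C2_def by (intro add_pos_nonneg sum_nonneg) auto
  define F where "F = (\<Sum>a\<in>N. norm (f a))"
  have F: "0 \<le> F" "\<And>a. a \<in> N \<Longrightarrow> norm (f a) \<le> F"
    unfolding F_def using fin by (auto intro!: sum_nonneg member_le_sum)
  show thesis
  proof (rule that[of "F * C2 / \<epsilon>" C2])
    show "0 \<le> F * C2 / \<epsilon>" using F C2 \<epsilon> by simp
    fix z :: "real^'n" assume z: "z \<noteq> 0"
    \<comment> \<open>The normals nearly orthogonal to z. By the choice of \<epsilon> their span
      misses \<theta>, so \<open>V J\<close> annihilates all of them; for the remaining normals the
      ratio on the right is at least \<epsilon>, and a large \<open>C1\<close> makes the trivial
      bound sufficient.\<close>
    define J where "J = {a \<in> N. \<bar>f a \<bullet> z\<bar> \<le> \<epsilon> * norm z}"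
    have JN: "J \<subseteq> N" by (auto simp: J_def)
    have nJ: "\<theta> \<notin> span (f ` J)"
    proof
      assume "\<theta> \<in> span (f ` J)"
      from E(2)[OF JN this z] obtain a where a: "a \<in> J" "E J * norm z < \<bar>f a \<bullet> z\<bar>" by blast
      moreover have "\<epsilon> * norm z \<le> E J * norm z" using \<epsilon>E[OF JN \<open>\<theta> \<in> span (f ` J)\<close>] by (intro mult_right_mono) auto
      ultimately show False by (auto simp: J_def)
    qed
    have nv: "norm (V J) \<le> C2"
      using member_le_sum[of J "Pow N" "\<lambda>J. norm (V J)"] JN fin by (simp add: C2_def)
    have "\<bar>f a \<bullet> V J\<bar> \<le> F * C2 / \<epsilon> * (\<bar>f a \<bullet> z\<bar> / norm z)" if "a \<in> N" for a
    proof (cases "a \<in> J")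
      case True
      then show ?thesis using V(2)[OF nJ True] F C2 \<epsilon> by simp
    next
      case False
      then have "\<epsilon> * norm z \<le> \<bar>f a \<bullet> z\<bar>" using that by (auto simp: J_def)
      then have "\<epsilon> \<le> \<bar>f a \<bullet> z\<bar> / norm z" using z by (simp add: pos_le_divide_eq)
      have "\<bar>f a \<bullet> V J\<bar> \<le> norm (f a) * norm (V J)" by (rule Cauchy_Schwarz_ineq2)
      also have "\<dots> \<le> F * C2" using F that nv by (intro mult_mono) auto
      also have "\<dots> = F * C2 / \<epsilon> * \<epsilon>" using \<epsilon> by simp
      also have "\<dots> \<le> F * C2 / \<epsilon> * (\<bar>f a \<bullet> z\<bar> / norm z)"
        using \<open>\<epsilon> \<le> _\<close> F C2 \<epsilon> by (intro mult_left_mono) auto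
      finally show ?thesis .
    qed
    then show "\<exists>v. \<theta> \<bullet> v = 1 \<and> norm v \<le> C2 \<and> (\<forall>a\<in>N. \<bar>f a \<bullet> v\<bar> \<le> F * C2 / \<epsilon> * (\<bar>f a \<bullet> z\<bar> / norm z))"
      using V(1)[OF nJ] nv by blast
  qed (rule C2)
qed

text \<open>A plane is a pair of normal and offset. The function w must be affine along every
  direction tangential to all planes through the point, and \<theta> avoids every proper subspace
  spanned by normals. The set I holds the axes whose cusp at the origin has positive sign; p and q
  witness that both signs occur.\<close>

locale arrangement =
  fixes planes :: "((real^'n) \<times> real) set" and w :: "real^'n \<Rightarrow> real" and L :: real
    and \<theta> :: "real^'n" and I :: "'n set" and p q :: 'n
  assumes fin: "finite planes"
    and normal: "a \<in> planes \<Longrightarrow> 1 \<le> norm (fst a)"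
    and off0: "a \<in> planes \<Longrightarrow> snd a \<noteq> 0"
    and L0: "0 \<le> L" and w_lip: "\<bar>w x - w y\<bar> \<le> L * norm (x - y)"
    and w_affine: "(\<And>a. a \<in> planes \<Longrightarrow> ell a x = 0 \<Longrightarrow> fst a \<bullet> v = 0) \<Longrightarrow>
        \<exists>d. \<forall>\<^sub>F t in nhds 0. w (x + t *\<^sub>R v) = w x + t * d"
    and w_sphere: "norm x = 1 \<Longrightarrow> w x = 0"
    and w_nonzero: "\<exists>x\<in>ball 0 1. w x \<noteq> 0"
    and norm_\<theta>: "norm \<theta> = 1"
    and generic: "J \<subseteq> planes \<Longrightarrow> \<theta> \<in> span (fst ` J) \<Longrightarrow> span (fst ` J) = UNIV"
    and pI: "p \<in> I" and qI: "q \<notin> I"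
begin

definition active :: "real^'n \<Rightarrow> ((real^'n) \<times> real) set" where
  "active x = {a \<in> planes. ell a x = 0}"

definition vertices :: "(real^'n) set" where
  "vertices = {x. span (fst ` active x) = UNIV}"

text \<open>The coefficient of the square root in every cusp. Along the axis of the cusp its kink
  exceeds those of all ridges together, at most \<open>2 * norm (fst a)\<close> each for small
  arguments, and the Lipschitz constant of w, with a margin of 1.\<close>

definition slope :: real where
  "slope = (\<Sum>a\<in>planes. 2 * norm (fst a)) + L + 1"

definition orient :: "'n \<Rightarrow> real" where
  "orient i = (if i \<in> I then 1 else - 1)"

text \<open>What is left of the solution when the terms singular at x0 and the multiple of w are
  removed. The set \<open>{i. x0 \<noteq> 0}\<close> is everything or empty: it switches off the
  cusps of the origin precisely when x0 is the origin.\<close>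

definition reg_part :: "real^'n \<Rightarrow> real^'n \<Rightarrow> real" where
  "reg_part x0 x = (\<Sum>a\<in>planes - active x0. ridge (ell a x))
     + (\<Sum>i\<in>{i. x0 \<noteq> 0}. orient i * cusp slope 0 (axis i 1) x) - (\<Sum>P\<in>vertices - {x0}. cusp slope P \<theta> x)"

definition soln :: "real \<Rightarrow> real^'n \<Rightarrow> real" where
  "soln s x = (\<Sum>a\<in>planes. ridge (ell a x))
     + (\<Sum>i\<in>UNIV. orient i * cusp slope 0 (axis i 1) x) - (\<Sum>P\<in>vertices. cusp slope P \<theta> x) + s * w x"

text \<open>The first argument decides which singular terms are omitted, the second is the point of
  evaluation. With x0 fixed this is continuous at x0.\<close>

definition reg_hess :: "real^'n \<Rightarrow> real^'n \<Rightarrow> real^'n^'n" where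
  "reg_hess x0 x = (\<Sum>a\<in>planes - active x0. ridge2 (ell a x) *\<^sub>R outer (fst a))
     + (\<Sum>i\<in>{i. x0 \<noteq> 0}. orient i *\<^sub>R cusp_hess slope 0 (axis i 1) x) - (\<Sum>P\<in>vertices - {x0}. cusp_hess slope P \<theta> x)"

text \<open>Its kernel is the space of directions tangential to all planes through x.\<close>

definition normal_gram :: "real^'n \<Rightarrow> real^'n^'n" where
  "normal_gram x = (\<Sum>a\<in>active x. outer (fst a))"

definition cut_hess :: "real \<Rightarrow> real^'n \<Rightarrow> real^'n^'n" where
  "cut_hess K x = K *\<^sub>R normal_gram x + reg_hess x x"

text \<open>
  On the active planes the coefficient \<open>K\<close> stands for the infinite second derivative of \<open>ridge\<close>
  at its kink, so the supremum is the limit \<open>K \<rightarrow> \<infinity>\<close>.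
\<close>

definition psi :: "real^'n \<Rightarrow> real" where
  "psi x = (if x = 0 then (2 * real (card I) - real CARD('n)) * (pi / 2)
     else if x \<in> vertices then (real CARD('n) - 2) * (pi / 2)
     else SUP K\<in>{0..}. arctan_op (cut_hess K x))"

lemma finite_active: "finite (active x)"
  using fin by (simp add: active_def)

lemma active_0: "active 0 = {}"
  using off0 by (auto simp: active_def ell_def)

lemma zero_notin_vertices: "0 \<notin> vertices"
proof -
  have "axis p 1 \<noteq> (0::real^'n)" by (simp add: axis_eq_0_iff)
  then have "{0::real^'n} \<noteq> UNIV" by blast
  then show ?thesis by (simp add: vertices_def active_0)
qed

lemma slope_ge: "1 \<le> slope" "0 \<le> slope"
proof -
  have "0 \<le> (\<Sum>a\<in>planes. 2 * norm (fst a))" by (intro sum_nonneg) simp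
  then show "1 \<le> slope" "0 \<le> slope" using L0 by (auto simp: slope_def)
qed

text \<open>A vertex is determined by the set of planes through it: the difference of two vertices
  with the same planes is orthogonal to normals that span the space.\<close>

lemma finite_vertices: "finite vertices"
proof (rule inj_on_finite[of active vertices "Pow planes"])
  show "inj_on active vertices"
  proof (rule inj_onI)
    fix x y assume "x \<in> vertices" "y \<in> vertices" and eq: "active x = active y"
    have "orthogonal (x - y) u" if "u \<in> fst ` active x" for u
    proof -
      obtain a where a: "a \<in> active x" "u = fst a" using \<open>u \<in> fst ` active x\<close> by blast
      then have "ell a x = 0" "ell a y = 0" using eq by (auto simp: active_def)
      then show ?thesis using a by (simp add: ell_def orthogonal_def inner_diff_left inner_diff_right inner_commute)
    qed
    then have "orthogonal (x - y) (x - y)"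
      using orthogonal_to_span[of "x - y" "fst ` active x" "x - y"] \<open>x \<in> vertices\<close> by (auto simp: vertices_def)
    then show "x = y" by (simp add: orthogonal_def)
  qed
qed (use fin in \<open>auto simp: active_def\<close>)

lemma soln_split:
  "soln s x = reg_part x0 x + (\<Sum>a\<in>active x0. ridge (ell a x))
     + (\<Sum>i\<in>{i. x0 = 0}. orient i * cusp slope 0 (axis i 1) x) - (\<Sum>P\<in>vertices \<inter> {x0}. cusp slope P \<theta> x) + s * w x"
proof -
  have "(\<Sum>a\<in>planes. ridge (ell a x)) = (\<Sum>a\<in>planes - active x0. ridge (ell a x)) + (\<Sum>a\<in>active x0. ridge (ell a x))"
    by (rule sum.subset_diff) (auto simp: active_def fin)
  moreover have "(\<Sum>P\<in>vertices. cusp slope P \<theta> x) = (\<Sum>P\<in>vertices - {x0}. cusp slope P \<theta> x) + (\<Sum>P\<in>vertices \<inter> {x0}. cusp slope P \<theta> x)"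
    using sum.subset_diff[of "vertices \<inter> {x0}" vertices "\<lambda>P. cusp slope P \<theta> x"] finite_vertices by (simp add: Diff_Int)
  ultimately show ?thesis by (cases "x0 = 0") (auto simp: soln_def reg_part_def)
qed

lemma second_deriv0_reg_part: "second_deriv0 (\<lambda>t. reg_part x0 (x0 + t *\<^sub>R v)) (qf (reg_hess x0 x0) v)"
proof -
  have "second_deriv0 (\<lambda>t. ridge (ell a x0 + t * (fst a \<bullet> v))) (ridge2 (ell a x0) * (fst a \<bullet> v)\<^sup>2)"
    if "a \<in> planes - active x0" for a
    by (rule second_deriv0_ridge) (use that in \<open>auto simp: active_def\<close>)
  then have 1: "second_deriv0 (\<lambda>t. \<Sum>a\<in>planes - active x0. ridge (ell a (x0 + t *\<^sub>R v)))
      (\<Sum>a\<in>planes - active x0. ridge2 (ell a x0) * (fst a \<bullet> v)\<^sup>2)"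
    by (intro second_deriv0_sum) (simp add: ell_add)
  have 2: "second_deriv0 (\<lambda>t. \<Sum>i\<in>{i. x0 \<noteq> 0}. orient i * cusp slope 0 (axis i 1) (x0 + t *\<^sub>R v))
      (\<Sum>i\<in>{i. x0 \<noteq> 0}. orient i * qf (cusp_hess slope 0 (axis i 1) x0) v)"
    by (intro second_deriv0_sum second_deriv0_cmult second_deriv0_cusp) auto
  have 3: "second_deriv0 (\<lambda>t. \<Sum>P\<in>vertices - {x0}. cusp slope P \<theta> (x0 + t *\<^sub>R v))
      (\<Sum>P\<in>vertices - {x0}. qf (cusp_hess slope P \<theta> x0) v)"
    by (intro second_deriv0_sum second_deriv0_cusp) auto
  show ?thesis
    unfolding reg_part_def reg_hess_def qf_add qf_diff qf_sum qf_scaleR qf_outer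
    by (intro second_deriv0_diff second_deriv0_add 1 2 3)
qed

lemma tendsto_reg_hess: "(reg_hess x0 \<longlongrightarrow> reg_hess x0 x0) (nhds x0)"
proof -
  have 1: "((\<lambda>x. ridge2 (ell a x)) \<longlongrightarrow> ridge2 (ell a x0)) (nhds x0)" if "a \<in> planes - active x0" for a
    using that by (intro tendsto_ridge2 tendsto_ell) (auto simp: active_def)
  show ?thesis
    unfolding reg_hess_def by (intro tendsto_intros tendsto_cusp_hess 1) auto
qed

lemma transpose_reg_hess: "transpose (reg_hess x0 x) = reg_hess x0 x"
  unfolding reg_hess_def by (intro transpose_simps transpose_cusp_hess)

lemma transpose_normal_gram: "transpose (normal_gram x) = normal_gram x"
  unfolding normal_gram_def by (intro transpose_simps)

lemma transpose_cut_hess: "transpose (cut_hess K x) = cut_hess K x"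
  unfolding cut_hess_def by (intro transpose_simps transpose_reg_hess transpose_normal_gram)

lemma qf_normal_gram: "qf (normal_gram x) v = (\<Sum>a\<in>active x. (fst a \<bullet> v)\<^sup>2)"
  by (simp add: normal_gram_def qf_sum qf_outer)

lemma qf_normal_gram_nonneg: "0 \<le> qf (normal_gram x) v"
  by (simp add: qf_normal_gram sum_nonneg)

lemma qf_normal_gram_eq_0: "qf (normal_gram x) v = 0 \<longleftrightarrow> (\<forall>a\<in>active x. fst a \<bullet> v = 0)"
  by (simp add: qf_normal_gram sum_nonneg_eq_0_iff finite_active)

lemma psi_upper: assumes "x \<noteq> 0" "x \<notin> vertices" "0 \<le> K" shows "arctan_op (cut_hess K x) \<le> psi x"
proof -
  have "bdd_above ((\<lambda>K. arctan_op (cut_hess K x)) ` {0..})"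
    using arctan_op_bounds(1)[OF transpose_cut_hess] by (intro bdd_aboveI2[of _ _ "real CARD('n) * (pi / 2)"]) (simp add: less_imp_le)
  then show ?thesis using assms by (auto simp: psi_def intro!: cSUP_upper)
qed

lemma psi_least: assumes "x \<noteq> 0" "x \<notin> vertices" "\<And>K. 0 \<le> K \<Longrightarrow> arctan_op (cut_hess K x) \<le> b" shows "psi x \<le> b"
  using assms by (auto simp: psi_def intro!: cSUP_least)

lemma psi_approx: assumes "x \<noteq> 0" "x \<notin> vertices" "e > 0" obtains K where "0 \<le> K" "psi x - e < arctan_op (cut_hess K x)"
proof -
  have "\<exists>K\<ge>0. psi x - e < arctan_op (cut_hess K x)"
  proof (rule ccontr)
    assume "\<not> ?thesis"
    then have "psi x \<le> psi x - e" by (intro psi_least[OF assms(1,2)]) (auto simp: not_less)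
    then show False using assms(3) by simp
  qed
  then show thesis using that by blast
qed

lemma eventually_active: "\<forall>\<^sub>F x in at x0. active x \<subseteq> active x0"
proof (rule filter_leD[OF at_within_le_nhds])
  have "\<forall>\<^sub>F x in nhds x0. ell a x \<noteq> 0" if "a \<in> planes - active x0" for a
    by (rule tendsto_imp_eventually_ne[OF tendsto_ell]) (use that in \<open>auto simp: active_def\<close>)
  then have "\<forall>\<^sub>F x in nhds x0. \<forall>a\<in>planes - active x0. ell a x \<noteq> 0"
    using fin by (intro eventually_ball_finite) auto
  then show "\<forall>\<^sub>F x in nhds x0. active x \<subseteq> active x0" by eventually_elim (auto simp: active_def)
qed

lemma eventually_regular:
  "\<forall>\<^sub>F x in at x0. x \<noteq> 0 \<and> x \<notin> vertices"
proof -
  have "finite (insert 0 vertices)" using finite_vertices by simp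
  then have "open (- (insert 0 vertices - {x0}))" by (intro open_Compl finite_imp_closed) auto
  then have "\<forall>\<^sub>F x in nhds x0. x \<in> - (insert 0 vertices - {x0})" by (rule eventually_nhds_in_open) auto
  then show ?thesis unfolding eventually_at_filter by eventually_elim auto
qed

lemma eventually_ridge2:
  "\<forall>\<^sub>F x in at x0. \<forall>a\<in>active x0 - active x. K \<le> ridge2 (ell a x)"
proof (rule filter_leD[OF at_within_le_nhds])
  have "\<forall>\<^sub>F x in nhds x0. ell a x \<noteq> 0 \<longrightarrow> K \<le> ridge2 (ell a x)" if "a \<in> active x0" for a
  proof -
    have "ell a x0 = 0" using that by (simp add: active_def)
    then have *: "((\<lambda>x. ell a x) \<longlongrightarrow> 0) (nhds x0)" using tendsto_ell[of a x0] by simp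
    \<comment> \<open>With this k one has 3/4 k = |K| + 1, and |l| < k powr (-2) makes |l| powr
      (-1/2) at least k.\<close>
    define k where "k = 4 / 3 * (\<bar>K\<bar> + 1)"
    have k: "k > 0" by (simp add: k_def)
    have "\<forall>\<^sub>F x in nhds x0. \<bar>ell a x\<bar> < k powr (-2)"
      using tendstoD[OF *, of "k powr (-2)"] k by (simp add: dist_real_def)
    then show ?thesis
    proof eventually_elim
      case (elim x)
      show ?case
      proof
        assume ne: "ell a x \<noteq> 0"
        have "k = (k powr (-2)) powr (-1/2)" using k by (simp add: powr_powr)
        also have "\<dots> \<le> \<bar>ell a x\<bar> powr (-1/2)" using elim ne by (intro powr_mono2') auto
        finally have "\<bar>K\<bar> + 1 \<le> ridge2 (ell a x)" by (simp add: ridge2_def k_def)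
        then show "K \<le> ridge2 (ell a x)" by simp
      qed
    qed
  qed
  then have "\<forall>\<^sub>F x in nhds x0. \<forall>a\<in>active x0. ell a x \<noteq> 0 \<longrightarrow> K \<le> ridge2 (ell a x)"
    using finite_active by (intro eventually_ball_finite) auto
  then show "\<forall>\<^sub>F x in nhds x0. \<forall>a\<in>active x0 - active x. K \<le> ridge2 (ell a x)" by eventually_elim (auto simp: active_def)
qed

text \<open>The coefficient of a plane in the cut Hessian at x, whether or not x lies on it. It
  allows one sum over the planes through a nearby x0.\<close>

definition cut_ridge2 :: "real \<Rightarrow> real^'n \<Rightarrow> (real^'n) \<times> real \<Rightarrow> real" where
  "cut_ridge2 K x a = (if ell a x = 0 then K else ridge2 (ell a x))"

text \<open>The Hessian at x is regrouped according to what is singular at a nearby point x0. Every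
  limit of the phase as x tends to x0 is read off from this form.\<close>

lemma qf_cut_hess:
  assumes sub: "active x \<subseteq> active x0" and x: "x \<noteq> 0" "x \<notin> vertices"
  shows "qf (cut_hess K x) v = (\<Sum>a\<in>active x0. cut_ridge2 K x a * (fst a \<bullet> v)\<^sup>2) + qf (reg_hess x0 x) v
    + (\<Sum>i\<in>{i. x0 = 0}. orient i * qf (cusp_hess slope 0 (axis i 1) x) v) - (\<Sum>P\<in>vertices \<inter> {x0}. qf (cusp_hess slope P \<theta> x) v)"
proof -
  have A: "(\<Sum>a\<in>active x. K * (fst a \<bullet> v)\<^sup>2) + (\<Sum>a\<in>planes - active x. ridge2 (ell a x) * (fst a \<bullet> v)\<^sup>2)
     = (\<Sum>a\<in>active x0. cut_ridge2 K x a * (fst a \<bullet> v)\<^sup>2) + (\<Sum>a\<in>planes - active x0. ridge2 (ell a x) * (fst a \<bullet> v)\<^sup>2)"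
  proof -
    have "(\<Sum>a\<in>planes. cut_ridge2 K x a * (fst a \<bullet> v)\<^sup>2) = (\<Sum>a\<in>planes - active x. cut_ridge2 K x a * (fst a \<bullet> v)\<^sup>2) + (\<Sum>a\<in>active x. cut_ridge2 K x a * (fst a \<bullet> v)\<^sup>2)"
      by (rule sum.subset_diff) (auto simp: active_def fin)
    moreover have "(\<Sum>a\<in>planes. cut_ridge2 K x a * (fst a \<bullet> v)\<^sup>2) = (\<Sum>a\<in>planes - active x0. cut_ridge2 K x a * (fst a \<bullet> v)\<^sup>2) + (\<Sum>a\<in>active x0. cut_ridge2 K x a * (fst a \<bullet> v)\<^sup>2)"
      by (rule sum.subset_diff) (auto simp: active_def fin)
    moreover have "(\<Sum>a\<in>active x. cut_ridge2 K x a * (fst a \<bullet> v)\<^sup>2) = (\<Sum>a\<in>active x. K * (fst a \<bullet> v)\<^sup>2)"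
      by (rule sum.cong) (auto simp: cut_ridge2_def active_def)
    moreover have "(\<Sum>a\<in>planes - active x. cut_ridge2 K x a * (fst a \<bullet> v)\<^sup>2) = (\<Sum>a\<in>planes - active x. ridge2 (ell a x) * (fst a \<bullet> v)\<^sup>2)"
      by (rule sum.cong) (auto simp: cut_ridge2_def active_def)
    moreover have "(\<Sum>a\<in>planes - active x0. cut_ridge2 K x a * (fst a \<bullet> v)\<^sup>2) = (\<Sum>a\<in>planes - active x0. ridge2 (ell a x) * (fst a \<bullet> v)\<^sup>2)"
      using sub by (intro sum.cong) (auto simp: cut_ridge2_def active_def)
    ultimately show ?thesis by simp
  qed
  have D: "(\<Sum>P\<in>vertices. qf (cusp_hess slope P \<theta> x) v) = (\<Sum>P\<in>vertices - {x0}. qf (cusp_hess slope P \<theta> x) v) + (\<Sum>P\<in>vertices \<inter> {x0}. qf (cusp_hess slope P \<theta> x) v)"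
    using sum.subset_diff[of "vertices \<inter> {x0}" vertices "\<lambda>P. qf (cusp_hess slope P \<theta> x) v"] finite_vertices by (simp add: Diff_Int)
  have "vertices - {x} = vertices" using x by auto
  then show ?thesis
    using A D x by (cases "x0 = 0")
      (simp_all add: cut_hess_def reg_hess_def qf_add qf_diff qf_sum qf_scaleR qf_outer qf_normal_gram sum_distrib_left algebra_simps)
qed

lemma psi_bounds: "psi x < real CARD('n) * (pi / 2)" "- (real CARD('n) * (pi / 2)) < psi x"
proof -
  have n: "1 \<le> card I" "card I < CARD('n)"
  proof -
    show "1 \<le> card I" using pI by (metis One_nat_def Suc_leI card_gt_0_iff empty_iff finite_class.finite)
    show "card I < CARD('n)" using qI by (metis UNIV_I finite_class.finite_UNIV psubset_card_mono psubsetI subset_UNIV)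
  qed
  consider "x = 0" | "x \<noteq> 0" "x \<in> vertices" | "x \<noteq> 0" "x \<notin> vertices" by blast
  then have "psi x < real CARD('n) * (pi / 2) \<and> - (real CARD('n) * (pi / 2)) < psi x"
  proof cases
    case 1
    have "(2 * real (card I) - real CARD('n)) * (pi / 2) < real CARD('n) * (pi / 2)"
      using n by (intro mult_strict_right_mono) auto
    moreover have "- real CARD('n) * (pi / 2) < (2 * real (card I) - real CARD('n)) * (pi / 2)"
      using n by (intro mult_strict_right_mono) auto
    ultimately show ?thesis using 1 by (simp add: psi_def)
  next
    case 2
    have "(real CARD('n) - 2) * (pi / 2) < real CARD('n) * (pi / 2)"
      by (intro mult_strict_right_mono) auto
    moreover have "- real CARD('n) * (pi / 2) < (real CARD('n) - 2) * (pi / 2)"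
      using n by (intro mult_strict_right_mono) auto
    ultimately show ?thesis using 2 by (simp add: psi_def)
  next
    case 3
    have "\<not> UNIV \<subseteq> span (fst ` active x)" using 3 by (auto simp: vertices_def)
    then have "dim (fst ` active x) < DIM(real^'n)"
      by (metis dim_eq_full dim_subset_UNIV le_neq_implies_less subset_UNIV top.extremum_unique)
    then obtain v where v: "v \<noteq> 0" "span (fst ` active x) \<subseteq> {u. v \<bullet> u = 0}"
      using lowdim_subset_hyperplane by blast
    have Pv: "qf (normal_gram x) v = 0"
      unfolding qf_normal_gram_eq_0
    proof
      fix a assume "a \<in> active x"
      then have "fst a \<in> span (fst ` active x)" by (intro span_base imageI)
      then show "fst a \<bullet> v = 0" using v(2) by (auto simp: inner_commute)
    qed
    \<comment> \<open>On the line spanned by v the form does not depend on K, so one eigenvalue is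
      at most t uniformly in K and the supremum stays strictly below n pi / 2.\<close>
    define t where "t = qf (reg_hess x x) v / (v \<bullet> v)"
    have up: "arctan_op (cut_hess K x) \<le> 1 * arctan t + (real CARD('n) - 1) * (pi / 2)" for K
    proof -
      have "qf (cut_hess K x) u \<le> t * (u \<bullet> u)" if "u \<in> span {v}" for u
      proof -
        obtain k where "u = k *\<^sub>R v" using \<open>u \<in> span {v}\<close> by (auto simp: span_singleton)
        then show ?thesis using v(1)
          by (simp add: qf_scaleR_vec cut_hess_def qf_add qf_scaleR Pv t_def power2_eq_square)
      qed
      then show ?thesis
        using arctan_op_upper[OF transpose_cut_hess subspace_span _ _ subspace_span, of 1 "{v}" K x t 1 "{v}" t] v(1)
        by simp
    qed
    have "psi x \<le> 1 * arctan t + (real CARD('n) - 1) * (pi / 2)"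
      by (intro psi_least up 3)
    also have "\<dots> < pi / 2 + (real CARD('n) - 1) * (pi / 2)" using arctan_ubound[of t] by simp
    also have "\<dots> = real CARD('n) * (pi / 2)" by (simp add: field_simps)
    finally have "psi x < real CARD('n) * (pi / 2)" .
    moreover have "- (real CARD('n) * (pi / 2)) < psi x"
      using arctan_op_bounds(2)[OF transpose_cut_hess[of 0 x]] psi_upper[OF 3, of 0] by simp
    ultimately show ?thesis by blast
  qed
  then show "psi x < real CARD('n) * (pi / 2)" "- (real CARD('n) * (pi / 2)) < psi x" by auto
qed

text \<open>From below: a K that is almost optimal at x0 is exceeded by the true ridge curvatures
  close to x0. From above: the coefficients at x are finite, hence bounded by some K' at x0, and the
  supremum at x0 already includes every K'. The regular part costs only the Lipschitz error.\<close>

lemma tendsto_psi_regular: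
  assumes x0: "x0 \<noteq> 0" "x0 \<notin> vertices"
  shows "(psi \<longlongrightarrow> psi x0) (at x0)"
proof (rule tendstoI)
  fix e0 :: real assume "e0 > 0"
  \<comment> \<open>Two errors must be absorbed: e from the almost optimal K, and n e from the
    Lipschitz bound.\<close>
  define e where "e = e0 / (2 * (real CARD('n) + 1))"
  have e: "e > 0" using \<open>e0 > 0\<close> by (simp add: e_def)
  have e2: "e + real CARD('n) * e < e0"
  proof -
    have "e + real CARD('n) * e = e * (real CARD('n) + 1)" by (simp add: algebra_simps)
    also have "\<dots> = e0 / 2"
    proof -
      have "real CARD('n) + 1 \<noteq> 0" by linarith
      then show ?thesis unfolding e_def by (simp only: times_divide_eq_left mult.commute[of 2] divide_divide_eq_left[symmetric] nonzero_mult_div_cancel_right)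
        (simp add: field_simps)
    qed
    finally show ?thesis using \<open>e0 > 0\<close> by simp
  qed
  obtain K0 where K0: "0 \<le> K0" "psi x0 - e < arctan_op (cut_hess K0 x0)"
    using psi_approx[OF x0 e] .
  have V0: "vertices \<inter> {x0} = {}" "{i::'n. x0 = 0} = {}" using x0 by auto
  have ev: "\<forall>\<^sub>F x in at x0. \<forall>v. \<bar>qf (reg_hess x0 x) v - qf (reg_hess x0 x0) v\<bar> \<le> e * (v \<bullet> v)"
    using qf_tendsto_uniform[OF tendsto_reg_hess e] by (rule filter_leD[OF at_within_le_nhds])
  show "\<forall>\<^sub>F x in at x0. dist (psi x) (psi x0) < e0"
    using ev eventually_active eventually_regular
      eventually_ridge2[of x0 K0]
  proof eventually_elim
    case (elim x)
    have sub: "active x \<subseteq> active x0" and x: "x \<noteq> 0" "x \<notin> vertices" using elim by auto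
    note q = qf_cut_hess[OF sub x, unfolded V0 sum.empty add_0_right diff_0_right]
    have "arctan_op (cut_hess K0 x0) \<le> arctan_op (cut_hess K0 x) + real CARD('n) * e"
    proof (rule arctan_op_lipschitz[OF transpose_cut_hess transpose_cut_hess])
      fix v
      have "qf (reg_hess x0 x0) v \<le> qf (reg_hess x0 x) v + e * (v \<bullet> v)" using elim(1)[rule_format, of v] by linarith
      moreover have "(\<Sum>a\<in>active x0. K0 * (fst a \<bullet> v)\<^sup>2) \<le> (\<Sum>a\<in>active x0. cut_ridge2 K0 x a * (fst a \<bullet> v)\<^sup>2)"
        using elim(4) by (intro sum_mono mult_right_mono) (auto simp: cut_ridge2_def active_def)
      ultimately show "qf (cut_hess K0 x0) v \<le> qf (cut_hess K0 x) v + e * (v \<bullet> v)"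
        by (simp add: q) (simp add: cut_hess_def qf_add qf_scaleR qf_normal_gram sum_distrib_left)
    qed (use e in simp)
    then have 1: "psi x0 - e - real CARD('n) * e < psi x" using K0 psi_upper[OF x K0(1)] by linarith
    have "psi x \<le> psi x0 + real CARD('n) * e"
    proof (rule psi_least[OF x])
      fix K :: real assume K: "0 \<le> K"
      define K' where "K' = K + (\<Sum>a\<in>active x0. ridge2 (ell a x))"
      have cut_ridge2: "cut_ridge2 K x a \<le> K'" if "a \<in> active x0" for a
        using member_le_sum[OF that, of "\<lambda>a. ridge2 (ell a x)"] K finite_active
          sum_nonneg[of "active x0" "\<lambda>a. ridge2 (ell a x)"] by (auto simp: cut_ridge2_def K'_def ridge2_nonneg)
      have K': "0 \<le> K'" unfolding K'_def using K by (intro add_nonneg_nonneg sum_nonneg) (auto simp: ridge2_nonneg)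
      have "arctan_op (cut_hess K x) \<le> arctan_op (cut_hess K' x0) + real CARD('n) * e"
      proof (rule arctan_op_lipschitz[OF transpose_cut_hess transpose_cut_hess])
        fix v
        have "qf (reg_hess x0 x) v \<le> qf (reg_hess x0 x0) v + e * (v \<bullet> v)" using elim(1)[rule_format, of v] by linarith
        moreover have "(\<Sum>a\<in>active x0. cut_ridge2 K x a * (fst a \<bullet> v)\<^sup>2) \<le> (\<Sum>a\<in>active x0. K' * (fst a \<bullet> v)\<^sup>2)"
          using cut_ridge2 by (intro sum_mono mult_right_mono) auto
        ultimately show "qf (cut_hess K x) v \<le> qf (cut_hess K' x0) v + e * (v \<bullet> v)"
          by (simp add: q) (simp add: cut_hess_def qf_add qf_scaleR qf_normal_gram sum_distrib_left)
      qed (use e in simp)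
      then show "arctan_op (cut_hess K x) \<le> psi x0 + real CARD('n) * e" using psi_upper[OF x0 K'] by linarith
    qed
    with 1 e2 e show ?case by (simp add: dist_real_def abs_less_iff)
  qed
qed

end

section \<open>Continuity of the phase at the singular points\<close>

lemma qf_bounded:
  obtains M where "0 \<le> M" "\<And>v. \<bar>qf A v\<bar> \<le> M * (v \<bullet> v)"
proof -
  have "0 \<le> onorm ((*v) A)" by (intro onorm_pos_le matrix_vector_mul_bounded_linear)
  then show thesis using that qf_le_onorm by blast
qed

section \<open>Signed cusps at the origin\<close>

definition supported :: "'n set \<Rightarrow> (real^'n) set" where
  "supported J = {v. \<forall>i. i \<notin> J \<longrightarrow> v $ i = 0}"

lemma subspace_supported: "subspace (supported J)"
  by (auto simp: supported_def subspace_def)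

lemma dim_supported: "dim (supported J :: (real^'n) set) = card J"
proof -
  let ?d = "(\<lambda>i. axis i (1::real)) ` J"
  have "?d \<subseteq> Basis" by (auto simp: Basis_vec_def)
  moreover have "(supported J :: (real^'n) set) = {x. \<forall>i\<in>Basis. i \<notin> ?d \<longrightarrow> x \<bullet> i = 0}"
    by (auto simp: supported_def Basis_vec_def inner_axis image_iff axis_eq_axis)
  ultimately have "dim (supported J :: (real^'n) set) = card ?d" by (simp add: dim_substandard)
  also have "\<dots> = card J" by (intro card_image) (auto simp: inj_on_def axis_eq_axis)
  finally show ?thesis .
qed

lemma signed_cusps_lower:
  fixes x v :: "real^'n"
  assumes x: "x \<noteq> 0" and C: "0 \<le> C" and q1: "\<And>i. gauge 0 (axis i 1) x \<le> 1"
  shows "(\<Sum>i\<in>I. 5/16 * gauge 0 (axis i 1) x powr (-3/8) * (v $ i)\<^sup>2)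
      - (\<Sum>i\<in>- I. (C + 2) * gauge 0 (axis i 1) x powr (-1/2) * (v $ i)\<^sup>2) - real CARD('n) * (12 * (C + 1)) * (v \<bullet> v)
    \<le> (\<Sum>i\<in>UNIV. (if i \<in> I then 1 else - 1) * qf (cusp_hess C 0 (axis i 1) x) v)"
proof -
  have ax: "axis i 1 \<bullet> v = v $ i" for i by (simp add: inner_axis' )
  have "(\<Sum>i\<in>UNIV. (if i \<in> I then 1 else - 1) * qf (cusp_hess C 0 (axis i 1) x) v)
    = (\<Sum>i\<in>I. qf (cusp_hess C 0 (axis i 1) x) v) + (\<Sum>i\<in>- I. - qf (cusp_hess C 0 (axis i 1) x) v)"
  proof -
    have "(\<Sum>i\<in>UNIV. (if i \<in> I then 1 else - 1) * qf (cusp_hess C 0 (axis i 1) x) v)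
      = (\<Sum>i\<in>UNIV - I. (if i \<in> I then 1 else - 1) * qf (cusp_hess C 0 (axis i 1) x) v)
        + (\<Sum>i\<in>I. (if i \<in> I then 1 else - 1) * qf (cusp_hess C 0 (axis i 1) x) v)"
      by (rule sum.subset_diff) auto
    then show ?thesis by (simp add: Compl_eq_Diff_UNIV)
  qed
  moreover have "(\<Sum>i\<in>I. 5/16 * gauge 0 (axis i 1) x powr (-3/8) * (v $ i)\<^sup>2) \<le> (\<Sum>i\<in>I. qf (cusp_hess C 0 (axis i 1) x) v)"
    by (intro sum_mono) (use cusp_hess_lower[OF x C] in \<open>simp add: ax[symmetric]\<close>)
  moreover have "(\<Sum>i\<in>- I. qf (cusp_hess C 0 (axis i 1) x) v)
      \<le> (\<Sum>i\<in>- I. (C + 2) * gauge 0 (axis i 1) x powr (-1/2) * (v $ i)\<^sup>2) + (\<Sum>i\<in>- I. 12 * (C + 1) * (v \<bullet> v))"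
    unfolding sum.distrib[symmetric]
    by (intro sum_mono) (use cusp_hess_upper[OF x C q1] in \<open>simp add: ax[symmetric]\<close>)
  moreover have "(\<Sum>i\<in>- I. 12 * (C + 1) * (v \<bullet> v)) \<le> real CARD('n) * (12 * (C + 1)) * (v \<bullet> v)"
  proof -
    have "card (- I) \<le> CARD('n)" by (intro card_mono) auto
    moreover have "0 \<le> 12 * (C + 1) * (v \<bullet> v)" using C by simp
    ultimately show ?thesis by (simp add: mult_right_mono mult.assoc)
  qed
  ultimately show ?thesis unfolding sum_negf by linarith
qed

definition signed_cusps_hess :: "'n set \<Rightarrow> real \<Rightarrow> real^'n \<Rightarrow> real^'n^'n" where
  "signed_cusps_hess I C x = (\<Sum>i\<in>UNIV. (if i \<in> I then 1 else - 1) *\<^sub>R cusp_hess C 0 (axis i 1) x)"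

text \<open>By this symmetry every lower bound for the phase near the origin also yields an upper
  bound, applied to - A and the complement of I.\<close>

lemma signed_cusps_hess_Compl: "signed_cusps_hess (- I) C x = - signed_cusps_hess I C x"
  unfolding signed_cusps_hess_def sum_negf[symmetric] by (intro sum.cong) auto

lemma qf_near_signed_cusps_lower:
  fixes x v :: "real^'n"
  assumes x: "x \<noteq> 0" and C: "0 \<le> C" and q1: "\<And>i. gauge 0 (axis i 1) x \<le> 1"
    and A: "\<bar>qf (A - signed_cusps_hess I C x) v\<bar> \<le> M * (v \<bullet> v)"
  shows "(\<Sum>i\<in>I. 5/16 * gauge 0 (axis i 1) x powr (-3/8) * (v $ i)\<^sup>2)
      - (\<Sum>i\<in>- I. (C + 2) * gauge 0 (axis i 1) x powr (-1/2) * (v $ i)\<^sup>2)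
      - (real CARD('n) * (12 * (C + 1)) + M) * (v \<bullet> v) \<le> qf A v"
  using signed_cusps_lower[OF x C q1, where I = I and v = v] A
  by (simp add: signed_cusps_hess_def qf_diff qf_sum qf_scaleR algebra_simps abs_le_iff)

lemma gauge_le:
  assumes "norm \<theta> = 1" "norm (x - P) \<le> 1"
  shows "gauge P \<theta> x \<le> 2 * (norm (x - P))\<^sup>2"
proof -
  let ?z = "x - P"
  have "(\<theta> \<bullet> ?z)\<^sup>2 \<le> (\<theta> \<bullet> \<theta>) * (?z \<bullet> ?z)" by (rule Cauchy_Schwarz_ineq)
  then have 1: "(\<theta> \<bullet> ?z)\<^sup>2 \<le> (norm ?z)\<^sup>2" using assms(1) by (simp add: power2_norm_eq_inner norm_eq_1)
  have le1: "?z \<bullet> ?z \<le> 1" using assms(2) by (metis norm_le_square one_power2 zero_le_one)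
  have "(?z \<bullet> ?z)\<^sup>2 \<le> ?z \<bullet> ?z"
    unfolding power2_eq_square by (rule mult_left_le[OF le1]) simp
  also have "\<dots> = (norm ?z)\<^sup>2" by (rule power2_norm_eq_inner[symmetric])
  finally have "(?z \<bullet> ?z)\<^sup>2 \<le> (norm ?z)\<^sup>2" .
  with 1 show ?thesis unfolding gauge_def by linarith
qed

text \<open>The gauge is at most twice the squared distance. The resulting exponent -3/4 of the
  distance is what beats the ridges at a vertex.\<close>

lemma gauge_powr_ge:
  assumes "norm \<theta> = 1" "norm (x - P) \<le> 1" "x \<noteq> P"
  shows "2 powr (-3/8) * norm (x - P) powr (-3/4) \<le> gauge P \<theta> x powr (-3/8)"
proof -
  have "2 powr (-3/8) * norm (x - P) powr (-3/4) = (2 * (norm (x - P))\<^sup>2) powr (-3/8)"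
  proof -
    have "((norm (x - P))\<^sup>2) powr (-3/8) = norm (x - P) powr (-3/4)"
      using assms(3) by (simp add: powr_powr flip: powr_numeral)
    then show ?thesis by (simp add: powr_mult)
  qed
  also have "\<dots> \<le> gauge P \<theta> x powr (-3/8)"
    using gauge_le[OF assms(1,2)] gauge_pos[OF assms(3)] by (intro powr_mono2') auto
  finally show ?thesis .
qed

lemma eventually_norm_at:
  assumes "\<forall>\<^sub>F r in at_right (0::real). Q r"
  shows "\<forall>\<^sub>F x in at (P::real^'n). Q (norm (x - P))"
proof -
  have "filterlim (\<lambda>x. norm (x - P)) (at_right 0) (at P)"
    unfolding filterlim_at
  proof
    show "((\<lambda>x. norm (x - P)) \<longlongrightarrow> 0) (at P)"
      by (auto intro!: tendsto_eq_intros)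
    show "\<forall>\<^sub>F x in at P. norm (x - P) \<in> {0<..} \<and> norm (x - P) \<noteq> 0"
      unfolding eventually_at_filter by (intro always_eventually) auto
  qed
  then show ?thesis using assms by (auto simp: filterlim_iff)
qed

lemma arctan_near_pi_half:
  assumes "e > 0" obtains T where "T > 0" "pi / 2 - e < arctan T"
proof -
  have "\<forall>\<^sub>F x in at_top. pi / 2 - e < arctan x"
    using tendsto_arctan_at_top assms by (intro order_tendstoD(1)) auto
  then have "\<forall>\<^sub>F x in at_top. pi / 2 - e < arctan x \<and> 0 < x"
    using eventually_gt_at_top[of 0] by eventually_elim auto
  then show thesis using that eventually_happens'[OF trivial_limit_at_top_linorder] by blast
qed

lemma sum_squares_supported:
  assumes "v \<in> supported J" shows "(\<Sum>i\<in>J. (v $ i)\<^sup>2) = v \<bullet> v"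
proof -
  have "v \<bullet> v = (\<Sum>i\<in>UNIV. (v $ i)\<^sup>2)" by (simp add: inner_vec_def power2_eq_square)
  also have "\<dots> = (\<Sum>i\<in>J. (v $ i)\<^sup>2)"
    using assms by (intro sum.mono_neutral_right) (auto simp: supported_def)
  finally show ?thesis ..
qed

lemma eventually_gauge_small:
  "\<forall>\<^sub>F x in at (0::real^'n). x \<noteq> 0 \<and> norm x \<le> 1/2 \<and> (\<forall>i. gauge 0 (axis i 1) x \<le> 1)"
proof -
  have "\<forall>\<^sub>F r in at_right (0::real). 0 < r \<and> r \<le> 1/2"
    unfolding eventually_at_right_field by (intro exI[of _ "1/2"]) auto
  from eventually_norm_at[OF this, of "0::real^'n"] show ?thesis
  proof eventually_elim
    case (elim x)
    have "gauge 0 (axis i 1) x \<le> 1" for i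
    proof -
      have "gauge 0 (axis i 1) x \<le> 2 * (norm (x - 0))\<^sup>2" using elim by (intro gauge_le) (auto simp: norm_axis_1)
      also have "(norm (x - 0))\<^sup>2 \<le> (1/2)\<^sup>2" using elim by (intro power_mono) auto
      finally show ?thesis by (simp add: power2_eq_square)
    qed
    then show ?case using elim by auto
  qed
qed

lemma arctan_op_near_signed_cusps:
  fixes I :: "'n::finite set"
  assumes C: "0 \<le> C"
  shows "\<forall>\<^sub>F x in at 0. \<forall>A. transpose A = A \<longrightarrow> (\<forall>v. \<bar>qf (A - signed_cusps_hess I C x) v\<bar> \<le> M * (v \<bullet> v)) \<longrightarrow>
     real (card I) * arctan T - (real CARD('n) - real (card I)) * (pi / 2) \<le> arctan_op A"
proof -
  define c where "c = 5/16 * 2 powr (-3/8 :: real)"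
  define D where "D = real CARD('n) * (12 * (C + 1)) + M + T"
  have "\<forall>\<^sub>F r in at_right (0::real). D < c * r powr (-3/4)"
  proof -
    have "filterlim (\<lambda>r. c * r powr (-3/4)) at_top (at_right (0::real))"
      unfolding c_def by real_asymp
    then show ?thesis by (simp add: filterlim_at_top_dense)
  qed
  from eventually_norm_at[OF this, of "0::real^'n"] eventually_gauge_small
  show ?thesis
  proof eventually_elim
    case (elim x)
    show ?case
    proof (intro allI impI)
      fix A assume A: "transpose A = A" "\<forall>v. \<bar>qf (A - signed_cusps_hess I C x) v\<bar> \<le> M * (v \<bullet> v)"
      have low: "T * (v \<bullet> v) \<le> qf A v" if v: "v \<in> supported I" for v
      proof -
        have "D \<le> 5/16 * gauge 0 (axis i 1) x powr (-3/8)" for i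
          using gauge_powr_ge[of "axis i 1" x 0] elim by (simp add: c_def norm_axis_1)
        then have "D * (v \<bullet> v) \<le> (\<Sum>i\<in>I. 5/16 * gauge 0 (axis i 1) x powr (-3/8) * (v $ i)\<^sup>2)"
          unfolding sum_squares_supported[OF v, symmetric] sum_distrib_left
          by (intro sum_mono mult_right_mono) auto
        moreover have "(\<Sum>i\<in>- I. (C + 2) * gauge 0 (axis i 1) x powr (-1/2) * (v $ i)\<^sup>2) = 0"
          using v by (intro sum.neutral) (auto simp: supported_def)
        ultimately show ?thesis
          using qf_near_signed_cusps_lower[of x C A I v M] elim C A(2) by (simp add: D_def algebra_simps)
      qed
      have "real (card I) * arctan T + (real (card I) - real (card I)) * arctan T
          - (real CARD('n) - real (card I)) * (pi / 2) \<le> arctan_op A"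
        by (rule arctan_op_lower[OF A(1) subspace_supported[of I] _ low subspace_supported[of I] _ low]) (auto simp: dim_supported)
      then show "real (card I) * arctan T - (real CARD('n) - real (card I)) * (pi / 2) \<le> arctan_op A" by simp
    qed
  qed
qed

lemma axis_ray:
  fixes j :: "'n::finite"
  shows "filterlim (\<lambda>t. t *\<^sub>R axis j 1) (at (0::real^'n)) (at_right (0::real))"
  unfolding filterlim_at
proof
  have "((\<lambda>t. t *\<^sub>R axis j 1) \<longlongrightarrow> 0 *\<^sub>R axis j (1::real)) (at_right 0)"
    by (intro tendsto_intros)
  then show "((\<lambda>t. t *\<^sub>R axis j 1) \<longlongrightarrow> (0::real^'n)) (at_right (0::real))" by simp
  show "\<forall>\<^sub>F t in at_right (0::real). t *\<^sub>R axis j 1 \<in> UNIV \<and> t *\<^sub>R axis j 1 \<noteq> (0::real^'n)"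
    using eventually_at_right_less[of "0::real"] by eventually_elim (auto simp: axis_eq_0_iff)
qed

lemma gauge_axis:
  fixes i j :: "'n::finite"
  assumes "0 < t"
  shows "gauge 0 (axis i 1) (t *\<^sub>R axis j (1::real)) = (if i = j then t\<^sup>2 else 0) + t ^ 4"
  by (simp add: gauge_def inner_axis_axis power_mult_distrib)

text \<open>On the ray through \<open>axis q 1\<close> the eigenvalue in that direction is of order \<open>1 / t\<close> only,
  while all the others are at least of order \<open>t powr (-3/2)\<close>; this decides on which side of its
  limit the phase lies.\<close>

lemma arctan_op_signed_cusps_ray:
  fixes q :: "'n::finite"
  assumes C: "0 \<le> C" and M: "0 \<le> M" and qI: "q \<notin> I"
  shows "\<forall>\<^sub>F t in at_right 0. \<forall>A. transpose A = A \<longrightarrow>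
     (\<forall>v. \<bar>qf (A - signed_cusps_hess I C (t *\<^sub>R axis q 1)) v\<bar> \<le> M * (v \<bullet> v)) \<longrightarrow>
     (2 * real (card I) - real CARD('n)) * (pi / 2) < arctan_op A"
proof -
  define c where "c = real CARD('n) * (12 * (C + 1)) + M"
  define m where "m = real (card I)"
  have C2: "C + 2 > 0" using C by simp
  have c0: "c \<ge> 0" using M C by (simp add: c_def)
  \<comment> \<open>The m large eigenvalues fall short of pi / 2 by O(t powr (3/2)) only, while the
    last summand exceeds - pi / 2 by about t / (C + 2); for small t the gain outweighs the
    loss.\<close>
  have asym: "\<forall>\<^sub>F t in at_right (0::real). m * (pi / 2) - pi / 2 < m * arctan (5/16 * t powr (-3/2) - c) + arctan (- ((C + 2) / t + c))"
    using C2 by real_asymp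
  have "\<forall>\<^sub>F t in at_right (0::real). c < 5/16 * t powr (-3/2)" by real_asymp
  then show ?thesis
    using asym eventually_compose_filterlim[OF eventually_gauge_small axis_ray[of q]] eventually_at_right_less[of "0::real"]
  proof eventually_elim
    case (elim t)
    define x :: "real^'n" where "x = t *\<^sub>R axis q 1"
    have t: "0 < t" using elim by simp
    have x: "x \<noteq> 0" and q1: "\<And>i. gauge 0 (axis i 1) x \<le> 1" using elim by (auto simp: x_def)
    have t4: "(t ^ 4) powr - (3/8) = t powr - (3/2)" using t by (simp add: powr_powr flip: powr_numeral)
    \<comment> \<open>The ray is orthogonal to the axes in I, since q is not in I; their gauge is
      t^4, and t^4 to the power -3/8 is t powr (-3/2).\<close>
    have pos: "(\<Sum>i\<in>I. 5/16 * gauge 0 (axis i 1) x powr (-3/8) * (v $ i)\<^sup>2) = 5/16 * t powr (-3/2) * (\<Sum>i\<in>I. (v $ i)\<^sup>2)" for v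
      unfolding sum_distrib_left by (rule sum.cong) (use qI in \<open>auto simp: x_def gauge_axis[OF t] t4\<close>)
    show ?case
      unfolding x_def[symmetric]
    proof (intro allI impI)
      fix A assume A: "transpose A = A" "\<forall>v. \<bar>qf (A - signed_cusps_hess I C x) v\<bar> \<le> M * (v \<bullet> v)"
      note low = qf_near_signed_cusps_lower[OF x C q1 A(2)[rule_format], unfolded pos, folded c_def]
      have low1: "(5/16 * t powr (-3/2) - c) * (v \<bullet> v) \<le> qf A v" if v: "v \<in> supported I" for v
      proof -
        have "(\<Sum>i\<in>- I. (C + 2) * gauge 0 (axis i 1) x powr (-1/2) * (v $ i)\<^sup>2) = 0"
          using v by (intro sum.neutral) (auto simp: supported_def)
        then show ?thesis
          using low[of v, unfolded sum_squares_supported[OF v]] unfolding left_diff_distrib by linarith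
      qed
      \<comment> \<open>Among the negative cusps only that of axis q acts on this subspace; its
        gauge is at least t^2, so the curvature taken away is at most of order 1 / t.\<close>
      have low2: "- ((C + 2) / t + c) * (v \<bullet> v) \<le> qf A v" if v: "v \<in> supported (insert q I)" for v
      proof -
        have "(\<Sum>i\<in>- I. (C + 2) * gauge 0 (axis i 1) x powr (-1/2) * (v $ i)\<^sup>2) = (\<Sum>i\<in>{q}. (C + 2) * gauge 0 (axis i 1) x powr (-1/2) * (v $ i)\<^sup>2)"
          using v qI by (intro sum.mono_neutral_right) (auto simp: supported_def)
        also have "\<dots> \<le> (C + 2) / t * (v \<bullet> v)"
        proof -
          have "(t\<^sup>2 + t ^ 4) powr (-1/2) \<le> (t\<^sup>2) powr (-1/2)" using t by (intro powr_mono2') auto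
          also have "\<dots> = 1 / t"
            using t powr_minus[of "t\<^sup>2" "1/2"] by (simp add: powr_half_sqrt inverse_eq_divide)
          finally have "(C + 2) * (t\<^sup>2 + t ^ 4) powr (-1/2) * (v $ q)\<^sup>2 \<le> (C + 2) * (1 / t) * (v \<bullet> v)"
            using C2 t sum_squares_supported[of v UNIV] member_le_sum[of q UNIV "\<lambda>i. (v $ i)\<^sup>2"]
            by (intro mult_mono) (auto simp: supported_def)
          then show ?thesis by (simp add: x_def gauge_axis[OF t])
        qed
        finally have "(\<Sum>i\<in>- I. (C + 2) * gauge 0 (axis i 1) x powr (-1/2) * (v $ i)\<^sup>2) \<le> (C + 2) / t * (v \<bullet> v)" .
        moreover have "0 \<le> 5/16 * t powr (-3/2) * (\<Sum>i\<in>I. (v $ i)\<^sup>2)" by (simp add: sum_nonneg)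
        ultimately show ?thesis
          using low[of v] unfolding distrib_right minus_add_distrib minus_mult_left[symmetric] by linarith
      qed
      have card: "card (insert q I) = Suc (card I)" using qI by simp
      have le: "- ((C + 2) / t + c) \<le> 5/16 * t powr (-3/2) - c"
      proof -
        have "0 \<le> (C + 2) / t + c" using C2 t c0 by simp
        then show ?thesis using elim(1) by linarith
      qed
      \<comment> \<open>The n - m - 1 eigenvalues about which nothing is known are counted as - pi /
        2 each.\<close>
      have "(2 * real (card I) - real CARD('n)) * (pi / 2) = m * (pi / 2) - pi / 2 - (real CARD('n) - m - 1) * (pi / 2)"
        by (simp add: m_def field_simps)
      also have "\<dots> < m * arctan (5/16 * t powr (-3/2) - c) + (real (Suc (card I)) - m) * arctan (- ((C + 2) / t + c))
          - (real CARD('n) - real (Suc (card I))) * (pi / 2)"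
        using elim(2) by (simp add: m_def algebra_simps)
      also have "\<dots> \<le> arctan_op A"
        unfolding m_def
        by (rule arctan_op_lower[OF A(1) subspace_supported[of I] _ low1 subspace_supported[of "insert q I"] _ low2 le])
          (simp_all add: dim_supported card)
      finally show "(2 * real (card I) - real CARD('n)) * (pi / 2) < arctan_op A" .
    qed
  qed
qed

section \<open>The phase near the vertices and near the origin\<close>

context arrangement
begin

lemma reg_hess_bounded:
  obtains M where "0 \<le> M" "\<forall>\<^sub>F x in at x0. \<forall>v. \<bar>qf (reg_hess x0 x) v\<bar> \<le> M * (v \<bullet> v)"
proof -
  obtain M where M: "0 \<le> M" "\<And>v. \<bar>qf (reg_hess x0 x0) v\<bar> \<le> M * (v \<bullet> v)" using qf_bounded by blast
  have "\<forall>\<^sub>F x in at x0. \<forall>v. \<bar>qf (reg_hess x0 x) v - qf (reg_hess x0 x0) v\<bar> \<le> 1 * (v \<bullet> v)"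
    using qf_tendsto_uniform[OF tendsto_reg_hess zero_less_one] by (rule filter_leD[OF at_within_le_nhds])
  then have "\<forall>\<^sub>F x in at x0. \<forall>v. \<bar>qf (reg_hess x0 x) v\<bar> \<le> (M + 1) * (v \<bullet> v)"
  proof eventually_elim
    case (elim x)
    show ?case
    proof
      fix v
      show "\<bar>qf (reg_hess x0 x) v\<bar> \<le> (M + 1) * (v \<bullet> v)"
        using elim[rule_format, of v] M(2)[of v] by (simp add: algebra_simps)
    qed
  qed
  then show thesis using that[of "M + 1"] M(1) by simp
qed

text \<open>One eigenvalue tends to minus infinity, uniformly in K. For z = x - P take the
  transversal v: a plane through both P and x has a normal orthogonal to z, hence to v, so that K
  drops out; along v the cusp outweighs the remaining ridges.\<close>

lemma psi_vertex_upper: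
  assumes P: "P \<in> vertices" and T: "T > 0"
  shows "\<forall>\<^sub>F x in at P. psi x \<le> (real CARD('n) - 1) * (pi / 2) - arctan T"
proof -
  have P0: "P \<noteq> 0" using P zero_notin_vertices by blast
  have V0: "vertices \<inter> {P} = {P}" "{i::'n. P = 0} = {}" using P P0 by auto
  obtain C1 C2 where C12: "0 \<le> C1" "0 < C2"
    "\<And>z. z \<noteq> 0 \<Longrightarrow> \<exists>v. \<theta> \<bullet> v = 1 \<and> norm v \<le> C2 \<and> (\<forall>a\<in>active P. \<bar>fst a \<bullet> v\<bar> \<le> C1 * (\<bar>fst a \<bullet> z\<bar> / norm z))"
  proof (rule transversal_direction[where \<theta> = \<theta> and f = fst, OF finite_active[of P]])
    show "span (fst ` J) = UNIV" if "J \<subseteq> active P" "\<theta> \<in> span (fst ` J)" for J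
      using generic[of J] that by (auto simp: active_def)
  qed blast
  obtain M where M: "0 \<le> M" "\<forall>\<^sub>F x in at P. \<forall>v. \<bar>qf (reg_hess P x) v\<bar> \<le> M * (v \<bullet> v)"
    using reg_hess_bounded .
  define S where "S = (\<Sum>a\<in>active P. C1\<^sup>2 * norm (fst a) powr (3/2))"
  define c where "c = 5/16 * 2 powr (-3/8 :: real)"
  \<comment> \<open>The bounded terms: the regular part and the target - T, both multiplied by the
    bound for the squared norm of v.\<close>
  define D where "D = M * C2\<^sup>2 + T * C2\<^sup>2"
  have c: "c > 0" by (simp add: c_def)
  have "\<forall>\<^sub>F r in at_right (0::real). S * r powr (-1/2) - c * r powr (-3/4) + D < 0"
  proof -
    have "filterlim (\<lambda>r. S * r powr (-1/2) - c * r powr (-3/4) + D) at_bot (at_right 0)"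
      using c by real_asymp
    then show ?thesis by (simp add: filterlim_at_bot_dense)
  qed
  moreover have "\<forall>\<^sub>F r in at_right (0::real). 0 < r \<and> r \<le> 1"
    unfolding eventually_at_right_field by (intro exI[of _ 1]) auto
  ultimately have ev: "\<forall>\<^sub>F r in at_right (0::real). S * r powr (-1/2) - c * r powr (-3/4) + D < 0 \<and> 0 < r \<and> r \<le> 1"
    by eventually_elim auto
  show ?thesis
    using eventually_norm_at[OF ev] M(2) eventually_active eventually_regular
  proof eventually_elim
    case (elim x)
    define z where "z = x - P"
    define r where "r = norm z"
    have x: "x \<noteq> 0" "x \<notin> vertices" and sub: "active x \<subseteq> active P" using elim by auto
    have r: "0 < r" "r \<le> 1" "S * r powr (-1/2) - c * r powr (-3/4) + D < 0" using elim by (auto simp: r_def z_def)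
    have z0: "z \<noteq> 0" using r by (auto simp: r_def)
    obtain v where v: "\<theta> \<bullet> v = 1" "norm v \<le> C2" "\<And>a. a \<in> active P \<Longrightarrow> \<bar>fst a \<bullet> v\<bar> \<le> C1 * (\<bar>fst a \<bullet> z\<bar> / r)"
      using C12(3)[OF z0] by (auto simp: r_def)
    have v0: "v \<noteq> 0" using v(1) by auto
    have vC: "v \<bullet> v \<le> C2\<^sup>2" using v(2) by (simp add: dot_square_norm power_mono)
    note q = qf_cut_hess[OF sub x, unfolded V0 sum.empty add_0_right, simplified]
    show ?case
    proof (rule psi_least[OF x])
      fix K :: real assume K: "0 \<le> K"
      have "cut_ridge2 K x a * (fst a \<bullet> v)\<^sup>2 \<le> C1\<^sup>2 * norm (fst a) powr (3/2) * r powr (-1/2)" if a: "a \<in> active P" for a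
      proof -
        have ell: "ell a x = fst a \<bullet> z" using a by (simp add: active_def ell_def z_def inner_diff_right)
        define l where "l = \<bar>fst a \<bullet> z\<bar>"
        show ?thesis
        proof (cases "ell a x = 0")
          case True
          then have "fst a \<bullet> v = 0" using v(3)[OF a] ell by simp
          then show ?thesis by simp
        next
          case False
          then have l: "l > 0" by (simp add: l_def ell)
          have lr: "l \<le> norm (fst a) * r" unfolding l_def r_def by (rule Cauchy_Schwarz_ineq2)
          have "(fst a \<bullet> v)\<^sup>2 \<le> (C1 * (l / r))\<^sup>2"
            using power_mono[OF v(3)[OF a] abs_ge_zero, of 2] unfolding l_def by simp
          then have "cut_ridge2 K x a * (fst a \<bullet> v)\<^sup>2 \<le> cut_ridge2 K x a * (C1 * (l / r))\<^sup>2"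
            using False by (intro mult_left_mono) (auto simp: cut_ridge2_def ridge2_nonneg)
          also have "\<dots> = 3/4 * (C1\<^sup>2 * (l powr (-1/2) * l powr 2) / r\<^sup>2)"
            using False l by (simp add: cut_ridge2_def ridge2_def ell l_def[symmetric] power_mult_distrib power_divide powr_numeral)
          also have "l powr (-1/2) * l powr 2 = l powr (3/2)" by (simp flip: powr_add)
          also have "3/4 * (C1\<^sup>2 * l powr (3/2) / r\<^sup>2) \<le> 1 * (C1\<^sup>2 * (norm (fst a) * r) powr (3/2) / r\<^sup>2)"
            using lr l by (intro mult_mono divide_right_mono mult_left_mono powr_mono2) auto
          also have "\<dots> = C1\<^sup>2 * norm (fst a) powr (3/2) * (r powr (3/2) * r powr (-2))"
          proof -
            have "r powr (-2) = inverse (r\<^sup>2)" using powr_minus[of r 2] r by simp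
            moreover have "(norm (fst a) * r) powr (3/2) = norm (fst a) powr (3/2) * r powr (3/2)"
              using r by (simp add: powr_mult)
            ultimately show ?thesis by (simp only: divide_inverse mult_1 mult.assoc)
          qed
          also have "r powr (3/2) * r powr (-2) = r powr (-1/2)" by (simp flip: powr_add)
          finally show ?thesis .
        qed
      qed
      then have "(\<Sum>a\<in>active P. cut_ridge2 K x a * (fst a \<bullet> v)\<^sup>2) \<le> (\<Sum>a\<in>active P. C1\<^sup>2 * norm (fst a) powr (3/2) * r powr (-1/2))"
        by (rule sum_mono)
      also have "\<dots> = S * r powr (-1/2)" by (simp add: S_def sum_distrib_right)
      finally have 1: "(\<Sum>a\<in>active P. cut_ridge2 K x a * (fst a \<bullet> v)\<^sup>2) \<le> S * r powr (-1/2)" .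
      have xP: "x \<noteq> P" using z0 by (auto simp: z_def)
      have 2: "c * r powr (-3/4) \<le> qf (cusp_hess slope P \<theta> x) v"
      proof -
        have "c * r powr (-3/4) \<le> 5/16 * gauge P \<theta> x powr (-3/8) * (\<theta> \<bullet> v)\<^sup>2"
          using gauge_powr_ge[OF norm_\<theta> _ xP] r by (simp add: c_def v(1) r_def z_def)
        also have "\<dots> \<le> qf (cusp_hess slope P \<theta> x) v" by (rule cusp_hess_lower[OF xP slope_ge(2)])
        finally show ?thesis .
      qed
      have 3: "qf (reg_hess P x) v \<le> M * C2\<^sup>2"
      proof -
        have "qf (reg_hess P x) v \<le> M * (v \<bullet> v)" using elim(2)[rule_format, of v] by linarith
        also have "\<dots> \<le> M * C2\<^sup>2" using vC M(1) by (rule mult_left_mono)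
        finally show ?thesis .
      qed
      have "qf (cut_hess K x) v \<le> S * r powr (-1/2) + M * C2\<^sup>2 - c * r powr (-3/4)"
        using 1 2 3 by (simp add: q)
      also have "\<dots> \<le> - T * C2\<^sup>2" using r(3) by (simp add: D_def)
      also have "\<dots> \<le> - T * (v \<bullet> v)" using vC T by simp
      finally have neg: "qf (cut_hess K x) v \<le> - T * (v \<bullet> v)" .
      have "qf (cut_hess K x) u \<le> - T * (u \<bullet> u)" if "u \<in> span {v}" for u
      proof -
        obtain k where "u = k *\<^sub>R v" using \<open>u \<in> span {v}\<close> by (auto simp: span_singleton)
        then show ?thesis using mult_left_mono[OF neg, of "k\<^sup>2"]
          by (simp add: qf_scaleR_vec power2_eq_square mult_ac)
      qed
      then show "arctan_op (cut_hess K x) \<le> (real CARD('n) - 1) * (pi / 2) - arctan T"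
        using arctan_op_upper[OF transpose_cut_hess subspace_span _ _ subspace_span, of 1 "{v}" K x "- T" 1 "{v}" "- T"] v0
        by (simp add: arctan_minus)
    qed
  qed
qed

text \<open>On the hyperplane orthogonal to \<theta> the cusp has bounded curvature from above,
  while the ridges through P have spanning normals and arbitrarily large coefficients; this makes n
  - 1 eigenvalues at least T.\<close>

lemma psi_vertex_lower:
  assumes P: "P \<in> vertices" and T: "T > 0"
  shows "\<forall>\<^sub>F x in at P. (real CARD('n) - 1) * arctan T - pi / 2 \<le> psi x"
proof -
  have P0: "P \<noteq> 0" using P zero_notin_vertices by blast
  have V0: "vertices \<inter> {P} = {P}" "{i::'n. P = 0} = {}" using P P0 by auto
  obtain M where M: "0 \<le> M" "\<forall>\<^sub>F x in at P. \<forall>v. \<bar>qf (reg_hess P x) v\<bar> \<le> M * (v \<bullet> v)"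
    using reg_hess_bounded .
  obtain \<kappa> where \<kappa>: "\<kappa> > 0" "\<And>v. \<kappa> * (v \<bullet> v) \<le> (\<Sum>a\<in>active P. (fst a \<bullet> v)\<^sup>2)"
    using spanning_quadratic_lower[OF finite_active[of P], of fst] P by (auto simp: vertices_def)
  \<comment> \<open>K times the positive definite Gram form has to cover T, the bounded part of the
    cusp Hessian and the regular part.\<close>
  define K where "K = (T + 12 * (slope + 1) + M) / \<kappa>"
  have K: "0 \<le> K" using \<kappa>(1) T M(1) slope_ge by (simp add: K_def)
  have "\<forall>\<^sub>F r in at_right (0::real). 2 * r\<^sup>2 \<le> 1 \<and> 0 < r \<and> r \<le> 1"
  proof -
    have "\<forall>\<^sub>F r in at_right (0::real). 0 < r \<and> r \<le> 1/2"
      unfolding eventually_at_right_field by (intro exI[of _ "1/2"]) auto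
    then show ?thesis
    proof eventually_elim
      case (elim r)
      then have "r\<^sup>2 \<le> (1/2)\<^sup>2" by (intro power_mono) auto
      then show ?case using elim by (simp add: power2_eq_square)
    qed
  qed
  from eventually_norm_at[OF this] show ?thesis
    using M(2) eventually_active eventually_regular
      eventually_ridge2[of P K]
  proof eventually_elim
    case (elim x)
    have x: "x \<noteq> 0" "x \<notin> vertices" and sub: "active x \<subseteq> active P" using elim by auto
    have xP: "x \<noteq> P" using elim(1) by auto
    note q = qf_cut_hess[OF sub x, unfolded V0 sum.empty add_0_right, simplified]
    have q1: "gauge P \<theta> x \<le> 1" using gauge_le[OF norm_\<theta>, of x P] elim(1) by linarith
    have low: "T * (v \<bullet> v) \<le> qf (cut_hess K x) v" if "v \<in> {v. \<theta> \<bullet> v = 0}" for v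
    proof -
      have "K * (\<kappa> * (v \<bullet> v)) \<le> K * (\<Sum>a\<in>active P. (fst a \<bullet> v)\<^sup>2)" using \<kappa>(2) K by (rule mult_left_mono)
      also have "\<dots> \<le> (\<Sum>a\<in>active P. cut_ridge2 K x a * (fst a \<bullet> v)\<^sup>2)"
        unfolding sum_distrib_left using elim(5) by (intro sum_mono mult_right_mono) (auto simp: cut_ridge2_def active_def)
      finally have 1: "(T + 12 * (slope + 1) + M) * (v \<bullet> v) \<le> (\<Sum>a\<in>active P. cut_ridge2 K x a * (fst a \<bullet> v)\<^sup>2)"
        using \<kappa>(1) by (simp add: K_def)
      have 2: "qf (cusp_hess slope P \<theta> x) v \<le> 12 * (slope + 1) * (v \<bullet> v)"
        using cusp_hess_upper[OF xP slope_ge(2) q1, of v] that by simp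
      have 3: "- (M * (v \<bullet> v)) \<le> qf (reg_hess P x) v" using elim(2)[rule_format, of v] by linarith
      show ?thesis using 1 2 3 by (simp add: q algebra_simps)
    qed
    have dim: "dim {v. \<theta> \<bullet> v = 0} = CARD('n) - 1" using norm_\<theta> by (subst dim_hyperplane) auto
    have "real (CARD('n) - 1) * arctan T + (real (CARD('n) - 1) - real (CARD('n) - 1)) * arctan T
        - (real CARD('n) - real (CARD('n) - 1)) * (pi / 2) \<le> arctan_op (cut_hess K x)"
      by (rule arctan_op_lower[OF transpose_cut_hess subspace_hyperplane _ low subspace_hyperplane _ low]) (auto simp: dim)
    also have "\<dots> \<le> psi x" by (rule psi_upper[OF x K])
    finally show ?case by (simp add: of_nat_diff)
  qed
qed

lemma tendsto_psi_vertex: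
  assumes P: "P \<in> vertices"
  shows "(psi \<longlongrightarrow> psi P) (at P)"
proof (rule tendstoI)
  fix e0 :: real assume e0: "e0 > 0"
  define e where "e = e0 / (2 * real CARD('n))"
  have n: "real CARD('n) \<ge> 1" by (simp add: Suc_leI)
  have e: "e > 0" "real CARD('n) * e = e0 / 2" using e0 n by (auto simp: e_def)
  have en: "e \<le> e0 / 2" using mult_right_mono[OF n, of e] e by simp
  obtain T where T: "T > 0" "pi / 2 - e < arctan T" using arctan_near_pi_half[OF e(1)] .
  have psiP: "psi P = (real CARD('n) - 2) * (pi / 2)" using P zero_notin_vertices by (auto simp: psi_def)
  show "\<forall>\<^sub>F x in at P. dist (psi x) (psi P) < e0"
    using psi_vertex_upper[OF P T(1)] psi_vertex_lower[OF P T(1)]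
  proof eventually_elim
    case (elim x)
    have "(real CARD('n) - 1) * (pi / 2 - e) \<le> (real CARD('n) - 1) * arctan T"
      using T(2) n by (intro mult_left_mono) auto
    then have "(real CARD('n) - 1) * (pi / 2) - real CARD('n) * e + e - pi / 2 \<le> psi x"
      using elim(2) by (simp add: algebra_simps)
    moreover have "(real CARD('n) - 1) * (pi / 2) - pi / 2 = psi P" by (simp add: psiP field_simps)
    ultimately have "psi P - e0 / 2 + e \<le> psi x" using e(2) by linarith
    moreover have "psi x \<le> psi P + e" using elim(1) T(2) by (simp add: psiP algebra_simps)
    ultimately show ?case using en e0 e(1) by (simp add: dist_real_def abs_less_iff)
  qed
qed

text \<open>No plane passes near the origin, so K is irrelevant there and the phase belongs to an
  honest Hessian, at bounded distance from that of the signed cusps.\<close>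

lemma psi_near_0:
  obtains M where "0 \<le> M"
    "\<forall>\<^sub>F x in at 0. \<exists>A. psi x = arctan_op A \<and> transpose A = A \<and> (\<forall>v. \<bar>qf (A - signed_cusps_hess I slope x) v\<bar> \<le> M * (v \<bullet> v))"
proof -
  obtain M where M: "0 \<le> M" "\<forall>\<^sub>F x in at 0. \<forall>v. \<bar>qf (reg_hess 0 x) v\<bar> \<le> M * (v \<bullet> v)"
    using reg_hess_bounded .
  have "\<forall>\<^sub>F x in at 0. \<exists>A. psi x = arctan_op A \<and> transpose A = A \<and> (\<forall>v. \<bar>qf (A - signed_cusps_hess I slope x) v\<bar> \<le> M * (v \<bullet> v))"
    using M(2) eventually_active[of 0] eventually_regular
  proof eventually_elim
    case (elim x)
    have x: "active x = {}" "x \<noteq> 0" "x \<notin> vertices" using elim active_0 by auto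
    have "psi x = arctan_op (cut_hess 0 x)"
      by (intro antisym psi_least psi_upper x(2,3)) (simp_all add: cut_hess_def normal_gram_def x(1))
    moreover have "qf (cut_hess 0 x - signed_cusps_hess I slope x) v = qf (reg_hess 0 x) v" for v
      using qf_cut_hess[of x 0 0 v] x zero_notin_vertices
      by (simp add: active_0 orient_def qf_diff signed_cusps_hess_def qf_sum qf_scaleR)
    ultimately show ?case using elim(1) transpose_cut_hess by metis
  qed
  then show thesis using that M(1) by blast
qed

lemma uminus_signed_cusps:
  assumes "transpose A = A" "\<forall>v. \<bar>qf (A - signed_cusps_hess J slope x) v\<bar> \<le> M * (v \<bullet> v)"
  shows "transpose (- A) = - A" "\<forall>v. \<bar>qf (- A - signed_cusps_hess (- J) slope x) v\<bar> \<le> M * (v \<bullet> v)"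
  using assms
  by (simp add: transpose_def vec_eq_iff, simp add: signed_cusps_hess_Compl qf_diff qf_uminus abs_minus_commute)

lemma card_Compl_I: "real (card (- I)) = real CARD('n) - real (card I)"
  by (simp add: Compl_eq_Diff_UNIV card_Diff_subset of_nat_diff card_mono)

lemma tendsto_psi_0: "(psi \<longlongrightarrow> psi 0) (at 0)"
proof (rule tendstoI)
  fix e0 :: real assume e0: "e0 > 0"
  define e where "e = e0 / (2 * real CARD('n))"
  have n: "real CARD('n) \<ge> 1" by (simp add: Suc_leI)
  have e: "e > 0" "real CARD('n) * e = e0 / 2" using e0 n by (auto simp: e_def)
  obtain T where T: "T > 0" "pi / 2 - e < arctan T" using arctan_near_pi_half[OF e(1)] .
  obtain M where M: "0 \<le> M"
    "\<forall>\<^sub>F x in at 0. \<exists>A. psi x = arctan_op A \<and> transpose A = A \<and> (\<forall>v. \<bar>qf (A - signed_cusps_hess I slope x) v\<bar> \<le> M * (v \<bullet> v))"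
    using psi_near_0 .
  show "\<forall>\<^sub>F x in at 0. dist (psi x) (psi 0) < e0"
    using M(2) arctan_op_near_signed_cusps[OF slope_ge(2), of I M T] arctan_op_near_signed_cusps[OF slope_ge(2), of "- I" M T]
  proof eventually_elim
    case (elim x)
    obtain A where A: "psi x = arctan_op A" "transpose A = A" "\<forall>v. \<bar>qf (A - signed_cusps_hess I slope x) v\<bar> \<le> M * (v \<bullet> v)"
      using elim(1) by blast
    have 1: "real (card I) * arctan T - (real CARD('n) - real (card I)) * (pi / 2) \<le> psi x"
      using elim(2) A by simp
    have 2: "real (card (- I)) * arctan T - (real CARD('n) - real (card (- I))) * (pi / 2) \<le> - psi x"
      using elim(3)[THEN spec, THEN mp, THEN mp, OF uminus_signed_cusps[OF A(2,3)]] by (simp add: A(1) arctan_op_uminus[OF A(2)])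
    have m: "real (card I) \<le> real CARD('n)" by (simp add: card_mono)
    have I: "real (card I) * (pi / 2 - arctan T) \<le> real CARD('n) * e"
      using T m arctan_ubound[of T] by (intro mult_mono) auto
    have J: "(real CARD('n) - real (card I)) * (pi / 2 - arctan T) \<le> real CARD('n) * e"
      using T m arctan_ubound[of T] by (intro mult_mono) auto
    have psi0: "psi 0 = (2 * real (card I) - real CARD('n)) * (pi / 2)" by (simp add: psi_def)
    have "psi 0 - e0 / 2 \<le> psi x"
      using 1 I[unfolded e(2)] unfolding psi0 by (simp add: field_simps)
    moreover have "psi x \<le> psi 0 + e0 / 2"
      using 2 J[unfolded e(2)] unfolding psi0 card_Compl_I by (simp add: field_simps)
    ultimately show ?case using e0 by (simp add: dist_real_def abs_less_iff)
  qed
qed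

lemma continuous_psi: "continuous_on S psi"
proof -
  have "(psi \<longlongrightarrow> psi x) (at x)" for x
    using tendsto_psi_regular tendsto_psi_vertex tendsto_psi_0 by (cases "x = 0"; cases "x \<in> vertices") auto
  then show ?thesis by (intro continuous_at_imp_continuous_on) (simp add: isCont_def)
qed

lemma psi_ray_q: "\<forall>\<^sub>F t in at_right 0. psi 0 < psi (t *\<^sub>R axis q 1)"
proof -
  obtain M where M: "0 \<le> M"
    "\<forall>\<^sub>F x in at 0. \<exists>A. psi x = arctan_op A \<and> transpose A = A \<and> (\<forall>v. \<bar>qf (A - signed_cusps_hess I slope x) v\<bar> \<le> M * (v \<bullet> v))"
    using psi_near_0 .
  show ?thesis
    using arctan_op_signed_cusps_ray[OF slope_ge(2) M(1) qI] eventually_compose_filterlim[OF M(2) axis_ray[of q]]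
  proof eventually_elim
    case (elim t)
    then show ?case by (auto simp: psi_def[of 0])
  qed
qed

text \<open>The mirror image of the ray through axis q: p lies outside the complement of I, so the
  same estimate applies to - A, and 2 card (- I) - n is the negative of 2 card I - n.\<close>

lemma psi_ray_p: "\<forall>\<^sub>F t in at_right 0. psi (t *\<^sub>R axis p 1) < psi 0"
proof -
  obtain M where M: "0 \<le> M"
    "\<forall>\<^sub>F x in at 0. \<exists>A. psi x = arctan_op A \<and> transpose A = A \<and> (\<forall>v. \<bar>qf (A - signed_cusps_hess I slope x) v\<bar> \<le> M * (v \<bullet> v))"
    using psi_near_0 .
  have "p \<notin> - I" using pI by simp
  from arctan_op_signed_cusps_ray[OF slope_ge(2) M(1) this] eventually_compose_filterlim[OF M(2) axis_ray[of p]]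
  show ?thesis
  proof eventually_elim
    case (elim t)
    obtain A where A: "psi (t *\<^sub>R axis p 1) = arctan_op A" "transpose A = A"
      "\<forall>v. \<bar>qf (A - signed_cusps_hess I slope (t *\<^sub>R axis p 1)) v\<bar> \<le> M * (v \<bullet> v)"
      using elim(2) by blast
    have "(2 * real (card (- I)) - real CARD('n)) * (pi / 2) < - psi (t *\<^sub>R axis p 1)"
      using elim(1)[THEN spec, THEN mp, THEN mp, OF uminus_signed_cusps[OF A(2,3)]] by (simp add: A(1) arctan_op_uminus[OF A(2)])
    then show ?case by (simp add: psi_def[of 0] card_Compl_I field_simps)
  qed
qed

end

section \<open>Contact with test functions\<close>

lemma eventually_nhds_0_abs: "0 < d \<Longrightarrow> \<forall>\<^sub>F t in nhds (0::real). \<bar>t\<bar> < d"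
  unfolding eventually_nhds_metric by (auto simp: dist_real_def)

lemma cusp_self [simp]: "cusp C P \<theta> P = 0"
  by (simp add: cusp_def gauge_def)

context arrangement
begin

text \<open>With \<open>s * L < 1\<close> a single ridge, whose slope in its normal direction is at
  least 1, beats s w. At the vertices this must also happen along a direction orthogonal to
  \<theta>, where the cusp has no kink; one v serves all vertices. The bound
  \<open>s \<le> 1\<close> keeps the Lipschitz constant of s w within what \<open>slope\<close>
  provides for.\<close>

definition small :: "real \<Rightarrow> bool" where
  "small s \<longleftrightarrow> 0 < s \<and> s \<le> 1 \<and> s * L < 1 \<and>
     (\<exists>v. norm v = 1 \<and> \<theta> \<bullet> v = 0 \<and> (\<forall>P\<in>vertices. s * L < (\<Sum>a\<in>active P. \<bar>fst a \<bullet> v\<bar>)))"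

lemma ex_small: obtains s0 where "s0 > 0" "\<And>s. 0 < s \<Longrightarrow> s < s0 \<Longrightarrow> small s"
proof -
  have "\<exists>v0. v0 \<noteq> 0 \<and> \<theta> \<bullet> v0 = 0"
  proof -
    have "p \<noteq> q" using pI qI by auto
    \<comment> \<open>Two distinct axes span a plane, which contains a nonzero vector orthogonal to
      \<theta>.\<close>
    then have "(\<theta> $ q) *\<^sub>R axis p 1 - (\<theta> $ p) *\<^sub>R axis q 1 \<noteq> (0::real^'n) \<or> axis p 1 \<noteq> (0::real^'n) \<and> \<theta> $ p = 0"
    proof (cases "\<theta> $ p = 0")
      case False
      then have "((\<theta> $ q) *\<^sub>R axis p 1 - (\<theta> $ p) *\<^sub>R axis q 1 :: real^'n) $ q \<noteq> 0"
        using \<open>p \<noteq> q\<close> by (simp add: axis_def)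
      then show ?thesis by (metis zero_index)
    qed (simp add: axis_eq_0_iff)
    then show ?thesis
    proof
      assume "(\<theta> $ q) *\<^sub>R axis p 1 - (\<theta> $ p) *\<^sub>R axis q 1 \<noteq> (0::real^'n)"
      moreover have "\<theta> \<bullet> ((\<theta> $ q) *\<^sub>R axis p 1 - (\<theta> $ p) *\<^sub>R axis q 1) = 0"
        by (simp add: inner_diff_right inner_axis)
      ultimately show ?thesis by blast
    next
      assume "axis p 1 \<noteq> (0::real^'n) \<and> \<theta> $ p = 0"
      then show ?thesis by (intro exI[of _ "axis p 1"]) (simp add: inner_axis)
    qed
  qed
  then obtain v0 where v0: "v0 \<noteq> 0" "\<theta> \<bullet> v0 = 0" by blast
  define v where "v = v0 /\<^sub>R norm v0"
  have v: "norm v = 1" "\<theta> \<bullet> v = 0" using v0 by (simp_all add: v_def)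
  define \<kappa> where "\<kappa> P = (\<Sum>a\<in>active P. \<bar>fst a \<bullet> v\<bar>)" for P
  \<comment> \<open>The normals at a vertex span the space, so v is not orthogonal to all of
    them.\<close>
  have \<kappa>: "\<kappa> P > 0" if P: "P \<in> vertices" for P
  proof -
    have "\<kappa> P \<noteq> 0"
    proof
      assume "\<kappa> P = 0"
      then have "\<forall>a\<in>active P. fst a \<bullet> v = 0"
        unfolding \<kappa>_def using finite_active by (simp add: sum_nonneg_eq_0_iff)
      then have "orthogonal v u" if "u \<in> fst ` active P" for u
        using that by (auto simp: orthogonal_def inner_commute)
      then have "orthogonal v v" using orthogonal_to_span[of v "fst ` active P" v] P by (auto simp: vertices_def)
      then show False using v(1) by (simp add: orthogonal_def)
    qed
    moreover have "\<kappa> P \<ge> 0" unfolding \<kappa>_def by (simp add: sum_nonneg)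
    ultimately show ?thesis by simp
  qed
  define k where "k = Min (insert 1 (\<kappa> ` vertices))"
  have k: "k > 0" "k \<le> 1" "\<And>P. P \<in> vertices \<Longrightarrow> k \<le> \<kappa> P"
    unfolding k_def using finite_vertices \<kappa> by (auto simp: Min_gr_iff)
  define s0 where "s0 = k / (L + 1)"
  have s0: "s0 > 0" "s0 \<le> 1" using k L0 by (auto simp: s0_def divide_le_eq)
  have "small s" if "0 < s" "s < s0" for s
  proof -
    have "s * (L + 1) < k" using that L0 by (simp add: s0_def pos_less_divide_eq)
    then have "s * L < k" using that by (simp add: algebra_simps)
    then show ?thesis
      unfolding small_def using that s0 k v \<kappa>_def by (intro conjI exI[of _ v] ballI) (auto intro: less_le_trans)
  qed
  then show thesis using that s0 by blast
qed

lemma w_increment: "s \<ge> 0 \<Longrightarrow> norm v = 1 \<Longrightarrow> \<bar>s * w (x + t *\<^sub>R v) - s * w x\<bar> \<le> s * L * \<bar>t\<bar>"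
  using mult_left_mono[OF w_lip[of "x + t *\<^sub>R v" x], of s]
  by (simp add: abs_mult mult.assoc flip: right_diff_distrib)

lemma soln_increment:
  "soln s (x0 + t *\<^sub>R v) - soln s x0 = reg_part x0 (x0 + t *\<^sub>R v) - reg_part x0 x0 + (\<Sum>a\<in>active x0. ridge (t * (fst a \<bullet> v)))
     + (\<Sum>i\<in>{i. x0 = 0}. orient i * cusp slope 0 (axis i 1) (0 + t *\<^sub>R v)) - (\<Sum>P\<in>vertices \<inter> {x0}. cusp slope P \<theta> (P + t *\<^sub>R v))
     + (s * w (x0 + t *\<^sub>R v) - s * w x0)"
proof -
  have "ell a (x0 + t *\<^sub>R v) = t * (fst a \<bullet> v)" "ell a x0 = 0" if "a \<in> active x0" for a
    using that by (auto simp: active_def ell_add)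
  then have 1: "(\<Sum>a\<in>active x0. ridge (ell a (x0 + t *\<^sub>R v))) = (\<Sum>a\<in>active x0. ridge (t * (fst a \<bullet> v)))"
    "(\<Sum>a\<in>active x0. ridge (ell a x0)) = 0" by simp_all
  have 2: "(\<Sum>P\<in>vertices \<inter> {x0}. cusp slope P \<theta> (x0 + t *\<^sub>R v)) = (\<Sum>P\<in>vertices \<inter> {x0}. cusp slope P \<theta> (P + t *\<^sub>R v))"
    "(\<Sum>P\<in>vertices \<inter> {x0}. cusp slope P \<theta> x0) = 0"
    by (auto intro!: sum.cong sum.neutral)
  have 3: "(\<Sum>i\<in>{i. x0 = 0}. orient i * cusp slope 0 (axis i 1) (x0 + t *\<^sub>R v)) = (\<Sum>i\<in>{i. x0 = 0}. orient i * cusp slope 0 (axis i 1) (0 + t *\<^sub>R v))"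
    "(\<Sum>i\<in>{i. x0 = 0}. orient i * cusp slope 0 (axis i 1) x0) = 0"
    by (auto intro!: sum.cong sum.neutral)
  show ?thesis
    by (subst soln_split[of s _ x0], subst soln_split[of s x0 x0]) (simp only: 1 2 3)
qed

text \<open>Along the normal of one active plane its ridge rises with slope at least 1, the other
  ridges do not decrease the sum, and s w costs at most s L < 1: a convex kink remains.\<close>

lemma no_touch_above_active:
  assumes s: "small s" and x0: "x0 \<noteq> 0" "x0 \<notin> vertices" "active x0 \<noteq> {}"
    and \<phi>: "C2_on U \<phi>" "x0 \<in> U" "touches_above_at \<phi> (soln s) x0"
  shows False
proof -
  obtain a where a: "a \<in> active x0" using x0 by blast
  define m where "m = norm (fst a)"
  have m: "1 \<le> m" using normal a by (auto simp: m_def active_def)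
  define v where "v = fst a /\<^sub>R m"
  have v: "norm v = 1" using m by (simp add: v_def flip: m_def)
  have av: "fst a \<bullet> v = m" using m by (simp add: v_def dot_square_norm power2_eq_square flip: m_def)
  have sets: "{i::'n. x0 = 0} = {}" "vertices \<inter> {x0} = {}" using x0 by auto
  have s0: "0 \<le> s" "s * L < 1" using s by (auto simp: small_def)
  show False
  proof (rule no_touch_above[OF \<phi> second_deriv0_reg_part[of x0 v], of "1 - s * L"])
    show "\<forall>\<^sub>F t in nhds 0. reg_part x0 (x0 + t *\<^sub>R v) - reg_part x0 (x0 + 0 *\<^sub>R v) + (1 - s * L) * \<bar>t\<bar> \<le> soln s (x0 + t *\<^sub>R v) - soln s x0"
    proof (intro always_eventually allI)
      fix t :: real
      have "\<bar>t\<bar> * 1 \<le> \<bar>t\<bar> * m" using m by (intro mult_left_mono) auto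
      also have "\<dots> = \<bar>t * (fst a \<bullet> v)\<bar>" using m by (simp add: av abs_mult)
      also have "\<dots> \<le> ridge (t * (fst a \<bullet> v))" by (rule ridge_ge)
      also have "\<dots> \<le> (\<Sum>a\<in>active x0. ridge (t * (fst a \<bullet> v)))"
        using order_trans[OF abs_ge_zero ridge_ge] by (intro member_le_sum[OF a]) (auto simp: finite_active)
      finally show "reg_part x0 (x0 + t *\<^sub>R v) - reg_part x0 (x0 + 0 *\<^sub>R v) + (1 - s * L) * \<bar>t\<bar> \<le> soln s (x0 + t *\<^sub>R v) - soln s x0"
        using soln_increment[of s x0 t v, unfolded sets sum.empty] w_increment[OF s0(1) v, of x0 t]
        by (simp only: scaleR_zero_left add_0_right diff_0_right left_diff_distrib mult_1 mult_1_right)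
    qed
  qed (use s0 in simp)
qed

text \<open>Orthogonally to \<theta> the subtracted cusp is O(t^2), so the kinks of the ridges
  survive along v.\<close>

lemma no_touch_above_vertex:
  assumes s: "small s" and P: "P \<in> vertices" and \<phi>: "C2_on U \<phi>" "P \<in> U" "touches_above_at \<phi> (soln s) P"
  shows False
proof -
  obtain v where v: "norm v = 1" "\<theta> \<bullet> v = 0" "\<And>P. P \<in> vertices \<Longrightarrow> s * L < (\<Sum>a\<in>active P. \<bar>fst a \<bullet> v\<bar>)"
    using s by (auto simp: small_def)
  have P0: "P \<noteq> 0" using P zero_notin_vertices by blast
  have sets: "{i::'n. P = 0} = {}" "vertices \<inter> {P} = {P}" using P P0 by auto
  have s0: "0 \<le> s" using s by (auto simp: small_def)
  define \<kappa> where "\<kappa> = (\<Sum>a\<in>active P. \<bar>fst a \<bullet> v\<bar>)"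
  \<comment> \<open>Half of the surplus slope absorbs the quadratic cusp for small t, the other half
    is the kink.\<close>
  define c where "c = (\<kappa> - s * L) / 2"
  have c: "c > 0" using v(3)[OF P] by (simp add: c_def \<kappa>_def)
  have d: "min 1 (c / (slope + 1)) > 0" using c slope_ge by simp
  show False
  proof (rule no_touch_above[OF \<phi> second_deriv0_reg_part[of P v] c])
    show "\<forall>\<^sub>F t in nhds 0. reg_part P (P + t *\<^sub>R v) - reg_part P (P + 0 *\<^sub>R v) + c * \<bar>t\<bar> \<le> soln s (P + t *\<^sub>R v) - soln s P"
      using eventually_nhds_0_abs[OF d]
    proof eventually_elim
      case (elim t)
      have "\<kappa> * \<bar>t\<bar> = (\<Sum>a\<in>active P. \<bar>t * (fst a \<bullet> v)\<bar>)"
        by (simp add: \<kappa>_def sum_distrib_left abs_mult mult.commute)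
      also have "\<dots> \<le> (\<Sum>a\<in>active P. ridge (t * (fst a \<bullet> v)))" by (intro sum_mono ridge_ge)
      finally have 1: "\<kappa> * \<bar>t\<bar> \<le> (\<Sum>a\<in>active P. ridge (t * (fst a \<bullet> v)))" .
      have "(slope + 1) * \<bar>t\<bar> \<le> c" using elim slope_ge by (simp add: pos_less_divide_eq mult.commute)
      then have "(slope + 1) * \<bar>t\<bar> * \<bar>t\<bar> \<le> c * \<bar>t\<bar>" by (rule mult_right_mono) simp
      then have "(slope + 1) * t\<^sup>2 \<le> c * \<bar>t\<bar>" by (simp add: power2_eq_square mult.assoc abs_mult_self_eq)
      then have 2: "cusp slope P \<theta> (P + t *\<^sub>R v) \<le> c * \<bar>t\<bar>"
        using cusp_orthogonal(2)[OF v(2,1) slope_ge(2), of t P] elim by simp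
      have "\<kappa> = 2 * c + s * L" by (simp add: c_def field_simps)
      then have "\<kappa> * \<bar>t\<bar> = 2 * (c * \<bar>t\<bar>) + s * L * \<bar>t\<bar>" by (simp add: algebra_simps)
      then show ?case
        unfolding soln_increment sets using w_increment[OF s0 v(1), of P t] 1 2 by (simp add: abs_le_iff)
    qed
  qed
qed

text \<open>Along \<theta> the downward kink of the cusp exceeds all upward kinks and the variation
  of s w, by the choice of \<open>slope\<close>.\<close>

lemma no_touch_below_vertex:
  assumes s: "small s" and P: "P \<in> vertices" and \<phi>: "C2_on U \<phi>" "P \<in> U" "touches_below_at \<phi> (soln s) P"
  shows False
proof -
  have P0: "P \<noteq> 0" using P zero_notin_vertices by blast
  have sets: "{i::'n. P = 0} = {}" "vertices \<inter> {P} = {P}" using P P0 by auto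
  have s0: "0 \<le> s" "s \<le> 1" using s by (auto simp: small_def)
  \<comment> \<open>For |t| below this bound the arguments of the ridges are at most 1 in absolute
    value, where a ridge is at most twice the absolute value.\<close>
  have d: "1 / slope > 0" using slope_ge by simp
  show False
  proof (rule no_touch_below[OF \<phi> second_deriv0_reg_part[of P \<theta>] zero_less_one])
    show "\<forall>\<^sub>F t in nhds 0. soln s (P + t *\<^sub>R \<theta>) - soln s P \<le> reg_part P (P + t *\<^sub>R \<theta>) - reg_part P (P + 0 *\<^sub>R \<theta>) - 1 * \<bar>t\<bar>"
      using eventually_nhds_0_abs[OF d]
    proof eventually_elim
      case (elim t)
      have tC: "\<bar>t\<bar> * slope \<le> 1" using elim slope_ge by (simp add: pos_less_divide_eq)
      have "ridge (t * (fst a \<bullet> \<theta>)) \<le> \<bar>t\<bar> * (2 * norm (fst a))" if "a \<in> active P" for a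
      proof -
        have *: "\<bar>t * (fst a \<bullet> \<theta>)\<bar> \<le> \<bar>t\<bar> * norm (fst a)"
          using Cauchy_Schwarz_ineq2[of "fst a" \<theta>] norm_\<theta> by (simp add: abs_mult mult_left_mono)
        have "2 * norm (fst a) \<le> (\<Sum>a\<in>planes. 2 * norm (fst a))"
          using that fin by (intro member_le_sum) (auto simp: active_def)
        then have "norm (fst a) \<le> slope" using L0 norm_ge_zero[of "fst a"] unfolding slope_def by linarith
        then have "\<bar>t\<bar> * norm (fst a) \<le> \<bar>t\<bar> * slope" by (rule mult_left_mono) simp
        then have "\<bar>t * (fst a \<bullet> \<theta>)\<bar> \<le> 1" using * tC by linarith
        from ridge_le[OF this] show ?thesis using * by simp
      qed
      then have "(\<Sum>a\<in>active P. ridge (t * (fst a \<bullet> \<theta>))) \<le> (\<Sum>a\<in>active P. \<bar>t\<bar> * (2 * norm (fst a)))" by (rule sum_mono)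
      also have "\<dots> \<le> (\<Sum>a\<in>planes. \<bar>t\<bar> * (2 * norm (fst a)))"
        by (rule sum_mono2) (auto simp: fin active_def)
      also have "\<dots> = \<bar>t\<bar> * (slope - L - 1)" by (simp add: slope_def sum_distrib_left)
      finally have 1: "(\<Sum>a\<in>active P. ridge (t * (fst a \<bullet> \<theta>))) \<le> slope * \<bar>t\<bar> - L * \<bar>t\<bar> - \<bar>t\<bar>" by (simp add: algebra_simps)
      have "s * L * \<bar>t\<bar> \<le> 1 * L * \<bar>t\<bar>" using s0 L0 by (intro mult_right_mono) auto
      then show ?case
        unfolding soln_increment sets
        using w_increment[OF s0(1) norm_\<theta>, of P t] 1 cusp_kink[OF norm_\<theta> slope_ge(2), of t P] by (simp add: abs_le_iff)
    qed
  qed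
qed

lemma cusps_along_axis:
  fixes j :: 'n
  assumes t: "\<bar>t\<bar> \<le> 1"
  shows "\<bar>(\<Sum>i\<in>UNIV. orient i * cusp slope 0 (axis i 1) (0 + t *\<^sub>R axis j 1)) - orient j * cusp slope 0 (axis j 1) (0 + t *\<^sub>R axis j 1)\<bar>
     \<le> real CARD('n) * ((slope + 1) * t\<^sup>2)"
proof -
  have "(\<Sum>i\<in>UNIV. orient i * cusp slope 0 (axis i 1) (0 + t *\<^sub>R axis j 1)) - orient j * cusp slope 0 (axis j 1) (0 + t *\<^sub>R axis j 1)
    = (\<Sum>i\<in>UNIV - {j}. orient i * cusp slope 0 (axis i 1) (0 + t *\<^sub>R axis j 1))"
    by (subst sum.remove[of UNIV j]) auto
  also have "\<bar>\<dots>\<bar> \<le> (\<Sum>i\<in>UNIV - {j}. (slope + 1) * t\<^sup>2)"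
  proof (rule order_trans[OF sum_abs], rule sum_mono)
    fix i assume "i \<in> UNIV - {j}"
    then have "axis i 1 \<bullet> axis j (1::real) = 0" by (simp add: inner_axis_axis)
    from cusp_orthogonal[OF this norm_axis_1 slope_ge(2) t, of 0]
    show "\<bar>orient i * cusp slope 0 (axis i 1) (0 + t *\<^sub>R axis j 1)\<bar> \<le> (slope + 1) * t\<^sup>2"
      by (simp add: orient_def)
  qed
  also have "\<dots> \<le> (\<Sum>i\<in>(UNIV::'n set). (slope + 1) * t\<^sup>2)"
    using slope_ge by (intro sum_mono2) auto
  finally show ?thesis by simp
qed

lemma eventually_quadratic_small:
  "\<forall>\<^sub>F t in nhds 0. \<bar>t\<bar> \<le> 1 \<and> real CARD('n) * ((slope + 1) * t\<^sup>2) \<le> 1/2 * \<bar>t\<bar>"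
proof -
  define k where "k = real CARD('n) * (slope + 1)"
  have k: "k > 0" using slope_ge by (simp add: k_def)
  have "min 1 (1 / (2 * k)) > 0" using k by simp
  from eventually_nhds_0_abs[OF this] show ?thesis
  proof eventually_elim
    case (elim t)
    then have "k * \<bar>t\<bar> \<le> 1/2" using k by (simp add: pos_less_divide_eq mult_ac)
    then have "k * \<bar>t\<bar> * \<bar>t\<bar> \<le> 1/2 * \<bar>t\<bar>" by (rule mult_right_mono) simp
    then show ?case using elim by (simp add: k_def power2_eq_square mult.assoc abs_mult_self_eq)
  qed
qed

text \<open>No plane passes through the origin, and the cusps of the other axes are O(t^2) along
  axis j. Besides the regular part, the cusp of axis j is left; s w and the quadratic terms stay 1/2
  |t| below its kink.\<close>

lemma soln_increment_axis:
  assumes s: "small s"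
  shows "\<forall>\<^sub>F t in nhds 0. \<bar>soln s (0 + t *\<^sub>R axis j 1) - soln s 0 - (reg_part 0 (0 + t *\<^sub>R axis j 1) - reg_part 0 (0 + 0 *\<^sub>R axis j 1))
     - orient j * cusp slope 0 (axis j 1) (0 + t *\<^sub>R axis j 1)\<bar> \<le> slope * \<bar>t\<bar> - 1/2 * \<bar>t\<bar>"
  using eventually_quadratic_small
proof eventually_elim
  case (elim t)
  have sets: "{i::'n. (0::real^'n) = 0} = UNIV" "vertices \<inter> {0} = {}" using zero_notin_vertices by auto
  have s0: "0 \<le> s" "s \<le> 1" using s by (auto simp: small_def)
  have "L + 1 \<le> slope" unfolding slope_def by (simp add: sum_nonneg)
  then have "(L + 1) * \<bar>t\<bar> \<le> slope * \<bar>t\<bar>" by (rule mult_right_mono) simp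
  then have "L * \<bar>t\<bar> + \<bar>t\<bar> \<le> slope * \<bar>t\<bar>" by (simp add: algebra_simps)
  moreover have "s * L * \<bar>t\<bar> \<le> 1 * L * \<bar>t\<bar>" using s0 L0 by (intro mult_right_mono) auto
  ultimately show ?case
    using soln_increment[of s 0 t "axis j 1", unfolded sets active_0 sum.empty]
      w_increment[OF s0(1) norm_axis_1, of 0 t j] cusps_along_axis[OF elim[THEN conjunct1], of j] elim
    by (simp only: scaleR_zero_left add_0_right add_0_left diff_0_right) linarith
qed

text \<open>The cusp of axis p enters with positive sign and gives a convex kink; axis q, with
  negative sign, will exclude contact from below in the same way.\<close>

lemma no_touch_above_0:
  assumes s: "small s" and \<phi>: "C2_on U \<phi>" "0 \<in> U" "touches_above_at \<phi> (soln s) 0"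
  shows False
proof (rule no_touch_above[OF \<phi> second_deriv0_reg_part[of 0 "axis p 1"], of "1/2"])
  show "\<forall>\<^sub>F t in nhds 0. reg_part 0 (0 + t *\<^sub>R axis p 1) - reg_part 0 (0 + 0 *\<^sub>R axis p 1) + 1/2 * \<bar>t\<bar> \<le> soln s (0 + t *\<^sub>R axis p 1) - soln s 0"
    using soln_increment_axis[OF s, of p]
  proof eventually_elim
    case (elim t)
    have "slope * \<bar>t\<bar> \<le> orient p * cusp slope 0 (axis p 1) (0 + t *\<^sub>R axis p 1)"
      using cusp_kink[OF norm_axis_1 slope_ge(2), of t 0 p] pI by (simp add: orient_def)
    with elim show ?case by linarith
  qed
qed simp

lemma no_touch_below_0:
  assumes s: "small s" and \<phi>: "C2_on U \<phi>" "0 \<in> U" "touches_below_at \<phi> (soln s) 0"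
  shows False
proof (rule no_touch_below[OF \<phi> second_deriv0_reg_part[of 0 "axis q 1"], of "1/2"])
  show "\<forall>\<^sub>F t in nhds 0. soln s (0 + t *\<^sub>R axis q 1) - soln s 0 \<le> reg_part 0 (0 + t *\<^sub>R axis q 1) - reg_part 0 (0 + 0 *\<^sub>R axis q 1) - 1/2 * \<bar>t\<bar>"
    using soln_increment_axis[OF s, of q]
  proof eventually_elim
    case (elim t)
    have "orient q * cusp slope 0 (axis q 1) (0 + t *\<^sub>R axis q 1) \<le> - (slope * \<bar>t\<bar>)"
      using cusp_kink[OF norm_axis_1 slope_ge(2), of t 0 q] qI by (simp add: orient_def)
    with elim show ?case by linarith
  qed
qed simp

text \<open>Along a line tangential to all active planes their ridges vanish and w is affine, so
  only the regular part has a second derivative. The result is free of s, which is why one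
  right-hand side serves the whole family.\<close>

lemma second_deriv0_soln:
  assumes x0: "x0 \<noteq> 0" "x0 \<notin> vertices" and v: "\<And>a. a \<in> active x0 \<Longrightarrow> fst a \<bullet> v = 0"
  shows "second_deriv0 (\<lambda>t. soln s (x0 + t *\<^sub>R v)) (qf (reg_hess x0 x0) v)"
proof -
  have sets: "{i::'n. x0 = 0} = {}" "vertices \<inter> {x0} = {}" using x0 by auto
  obtain d where d: "\<forall>\<^sub>F t in nhds 0. w (x0 + t *\<^sub>R v) = w x0 + t * d"
    using w_affine[of x0 v] v by (auto simp: active_def)
  have "second_deriv0 (\<lambda>t. reg_part x0 (x0 + t *\<^sub>R v) + (soln s x0 - reg_part x0 x0 + t * (s * d))) (qf (reg_hess x0 x0) v + 0)"
    by (intro second_deriv0_add second_deriv0_reg_part second_deriv0_affine)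
  then have "second_deriv0 (\<lambda>t. reg_part x0 (x0 + t *\<^sub>R v) + (soln s x0 - reg_part x0 x0 + t * (s * d))) (qf (reg_hess x0 x0) v)"
    by simp
  moreover have "\<forall>\<^sub>F t in nhds 0. soln s (x0 + t *\<^sub>R v) = reg_part x0 (x0 + t *\<^sub>R v) + (soln s x0 - reg_part x0 x0 + t * (s * d))"
    using d
  proof eventually_elim
    case (elim t)
    then show ?case using soln_increment[of s x0 t v, unfolded sets sum.empty] v by (simp add: algebra_simps)
  qed
  ultimately show ?thesis by (rule second_deriv0_cong)
qed

text \<open>Contact bounds the Hessian of the test function only in tangential directions.
  Domination by the Gram form extends the bound to all directions with a cut Hessian for some large
  K, up to e, and \<open>psi\<close> is the supremum over K.\<close>

lemma touch_below_regular:
  assumes x0: "x0 \<noteq> 0" "x0 \<notin> vertices" and \<phi>: "C2_on U \<phi>" "x0 \<in> U" "touches_below_at \<phi> (soln s) x0"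
  shows "arctan_op (hessian \<phi> x0) \<le> psi x0"
proof (rule field_le_epsilon)
  fix e0 :: real assume e0: "e0 > 0"
  define e where "e = e0 / real CARD('n)"
  have e: "e > 0" "real CARD('n) * e = e0" using e0 by (auto simp: e_def)
  have H: "transpose (hessian \<phi> x0) = hessian \<phi> x0" by (rule hessian_symmetric[OF \<phi>(1,2)])
  have "qf (hessian \<phi> x0 - reg_hess x0 x0) v \<le> 0" if v: "qf (normal_gram x0) v = 0" for v
  proof -
    have v': "\<And>a. a \<in> active x0 \<Longrightarrow> fst a \<bullet> v = 0" using v by (simp add: qf_normal_gram_eq_0)
    have "\<forall>\<^sub>F x in nhds x0. \<phi> x \<le> soln s x" using \<phi>(3) by (simp add: touches_below_at_def)
    then have ev: "\<forall>\<^sub>F t in nhds 0. \<phi> (x0 + t *\<^sub>R v) - soln s (x0 + t *\<^sub>R v) \<le> 0"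
      using eventually_compose_filterlim[OF _ line_filterlim[of x0 v], of "\<lambda>x. \<phi> x \<le> soln s x"] by simp
    have "qf (hessian \<phi> x0) v - qf (reg_hess x0 x0) v \<le> 0"
      by (rule second_deriv0_max_nonpos[OF second_deriv0_diff[OF second_deriv0_C2[OF \<phi>(1,2)] second_deriv0_soln[OF x0 v']] _ ev])
        (use v' \<phi>(3)[unfolded touches_below_at_def] in simp_all)
    then show ?thesis by (simp add: qf_diff)
  qed
  then obtain K where K: "0 \<le> K" "\<And>v. qf (hessian \<phi> x0 - reg_hess x0 x0) v \<le> K * qf (normal_gram x0) v + e * (v \<bullet> v)"
    using qf_dominate[OF qf_normal_gram_nonneg _ e(1)] by blast
  have "arctan_op (hessian \<phi> x0) \<le> arctan_op (cut_hess K x0) + real CARD('n) * e"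
    by (rule arctan_op_lipschitz[OF H transpose_cut_hess])
      (use K(2) e(1) in \<open>simp_all add: cut_hess_def qf_add qf_scaleR qf_diff algebra_simps\<close>)
  then show "arctan_op (hessian \<phi> x0) \<le> psi x0 + e0"
    using psi_upper[OF x0 K(1)] e(2) by linarith
qed

text \<open>Off the planes every direction is tangential and the cut Hessian does not depend on
  K.\<close>

lemma touch_above_regular:
  assumes x0: "x0 \<noteq> 0" "x0 \<notin> vertices" "active x0 = {}" and \<phi>: "C2_on U \<phi>" "x0 \<in> U" "touches_above_at \<phi> (soln s) x0"
  shows "psi x0 \<le> arctan_op (hessian \<phi> x0)"
proof (rule psi_least[OF x0(1,2)])
  fix K :: real
  have H: "transpose (hessian \<phi> x0) = hessian \<phi> x0" by (rule hessian_symmetric[OF \<phi>(1,2)])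
  show "arctan_op (cut_hess K x0) \<le> arctan_op (hessian \<phi> x0)"
  proof (rule arctan_op_mono[OF transpose_cut_hess H])
    fix v
    have "\<forall>\<^sub>F x in nhds x0. soln s x \<le> \<phi> x" using \<phi>(3) by (simp add: touches_above_at_def)
    then have ev: "\<forall>\<^sub>F t in nhds 0. soln s (x0 + t *\<^sub>R v) - \<phi> (x0 + t *\<^sub>R v) \<le> 0"
      using eventually_compose_filterlim[OF _ line_filterlim[of x0 v], of "\<lambda>x. soln s x \<le> \<phi> x"] by simp
    have "qf (reg_hess x0 x0) v - qf (hessian \<phi> x0) v \<le> 0"
      by (rule second_deriv0_max_nonpos[OF second_deriv0_diff[OF second_deriv0_soln[OF x0(1,2)] second_deriv0_C2[OF \<phi>(1,2)]] _ ev])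
        (use \<phi>(3)[unfolded touches_above_at_def] x0(3) in simp_all)
    then show "qf (cut_hess K x0) v \<le> qf (hessian \<phi> x0) v"
      by (simp add: cut_hess_def normal_gram_def x0(3) qf_add qf_scaleR qf_0)
  qed
qed

lemma continuous_soln: "continuous_on S (soln s)"
proof -
  have "continuous_on S w"
    by (rule lipschitz_on_continuous_on[of L], rule lipschitz_onI) (simp_all add: dist_real_def dist_norm w_lip L0)
  then show ?thesis
    unfolding soln_def[abs_def]
    by (intro continuous_intros continuous_cusp continuous_on_compose2[OF continuous_ridge[of UNIV]]) (auto simp: ell_def intro!: continuous_intros)
qed

lemma dirichlet_soln:
  assumes s: "small s"
  shows "restrict (soln s) (cball 0 1) \<in> dirichlet_solutions psi (soln 0)"
proof -
  let ?u = "restrict (soln s) (cball 0 1)"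
  \<comment> \<open>Contact is a local notion, so inside the open ball the extensional restriction
    can be exchanged for \<open>soln s\<close>.\<close>
  have near: "\<forall>\<^sub>F x in nhds x0. ?u x = soln s x" "?u x0 = soln s x0" if "x0 \<in> ball 0 1" for x0
  proof -
    have "\<forall>\<^sub>F x in nhds x0. x \<in> ball 0 1" using that by (intro eventually_nhds_in_open) auto
    then show "\<forall>\<^sub>F x in nhds x0. ?u x = soln s x" by eventually_elim auto
    show "?u x0 = soln s x0" using that by auto
  qed
  have cont: "continuous_on S ?u" if "S \<subseteq> cball 0 1" for S
    using continuous_soln[of S s] that by (rule_tac continuous_on_eq[of _ "soln s"]) auto
  have above: "touches_above_at \<phi> (soln s) x0" if "x0 \<in> ball 0 1" "touches_above_at \<phi> ?u x0" for \<phi> x0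
  proof -
    have "\<forall>\<^sub>F x in nhds x0. soln s x \<le> \<phi> x"
      using near(1)[OF that(1)] that(2)[unfolded touches_above_at_def, THEN conjunct2]
      by eventually_elim simp
    then show ?thesis using that(2) near(2)[OF that(1)] by (simp add: touches_above_at_def)
  qed
  have below: "touches_below_at \<phi> (soln s) x0" if "x0 \<in> ball 0 1" "touches_below_at \<phi> ?u x0" for \<phi> x0
  proof -
    have "\<forall>\<^sub>F x in nhds x0. \<phi> x \<le> soln s x"
      using near(1)[OF that(1)] that(2)[unfolded touches_below_at_def, THEN conjunct2]
      by eventually_elim simp
    then show ?thesis using that(2) near(2)[OF that(1)] by (simp add: touches_below_at_def)
  qed
  \<comment> \<open>The origin, the vertices and the other points of the planes admit no contact
    from above, so only points off the planes remain.\<close>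
  have "psi x0 \<le> arctan_op (hessian \<phi> x0)"
    if "x0 \<in> ball 0 1" "C2_on U \<phi>" "x0 \<in> U" "touches_above_at \<phi> ?u x0" for x0 \<phi> U
    using no_touch_above_0[OF s that(2), of] no_touch_above_vertex[OF s _ that(2,3)] no_touch_above_active[OF s _ _ _ that(2,3)]
      touch_above_regular[OF _ _ _ that(2,3)] above[OF that(1,4)] that(3)
    by (cases "x0 = 0"; cases "x0 \<in> vertices"; cases "active x0 = {}") blast+
  moreover have "arctan_op (hessian \<phi> x0) \<le> psi x0"
    if "x0 \<in> ball 0 1" "C2_on U \<phi>" "x0 \<in> U" "touches_below_at \<phi> ?u x0" for x0 \<phi> U
    using no_touch_below_0[OF s that(2), of] no_touch_below_vertex[OF s _ that(2,3)]
      touch_below_regular[OF _ _ that(2,3)] below[OF that(1,4)] that(3)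
    by (cases "x0 = 0"; cases "x0 \<in> vertices") blast+
  ultimately have "viscosity_solution (ball 0 1) psi ?u"
    unfolding viscosity_solution_def viscosity_subsolution_def viscosity_supersolution_def
    using cont[OF ball_subset_cball] by blast
  moreover have "\<forall>x\<in>sphere 0 1. ?u x = soln 0 x" using w_sphere by (auto simp: soln_def)
  ultimately show ?thesis
    unfolding dirichlet_solutions_def using cont[of "cball 0 1"] by simp
qed

lemma continuum: "has_continuum_of_solutions psi (soln 0)"
proof -
  obtain s0 where s0: "s0 > 0" "\<And>s. 0 < s \<Longrightarrow> s < s0 \<Longrightarrow> small s" using ex_small by blast
  define f where "f s = restrict (soln s) (cball 0 1)" for s
  \<comment> \<open>At this point the values of the solutions separate the parameters s.\<close>
  obtain x where x: "x \<in> ball 0 1" "w x \<noteq> 0" using w_nonzero by blast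
  have "inj_on f {0<..<s0}"
  proof (rule inj_onI)
    fix s s' assume "f s = f s'"
    then have "f s x = f s' x" by simp
    then have "soln s x = soln s' x" using x(1) by (simp add: f_def)
    then show "s = s'" using x(2) by (simp add: soln_def)
  qed
  then have "f ` {0<..<s0} \<approx> {0<..<s0}" by (rule inj_on_image_eqpoll_self)
  moreover have "{0<..<s0} \<approx> (UNIV::real set)" using s0(1) open_interval_eqpoll_reals by blast
  ultimately have "f ` {0<..<s0} \<approx> (UNIV::real set)" by (rule eqpoll_trans)
  moreover have "f ` {0<..<s0} \<subseteq> dirichlet_solutions psi (soln 0)"
    using dirichlet_soln s0(2) by (auto simp: f_def)
  ultimately show ?thesis unfolding has_continuum_of_solutions_def by blast
qed

lemma admissible: "admissible_data psi (soln 0)"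
  unfolding admissible_data_def using continuous_psi continuous_soln psi_bounds by auto

end

section \<open>The hat function\<close>

definition signs :: "(real^'n) set" where
  "signs = {\<sigma>. \<forall>i. \<sigma> $ i = 1 \<or> \<sigma> $ i = - 1}"

lemma finite_signs: "finite (signs :: (real^'n) set)"
proof -
  have "\<sigma> = (\<chi> i. if i \<in> {i. \<sigma> $ i = 1} then 1 else - 1)" if "\<sigma> \<in> signs" for \<sigma> :: "real^'n"
    using that by (auto simp: signs_def vec_eq_iff)
  then have "signs \<subseteq> (\<lambda>J. (\<chi> i. if i \<in> J then 1 else - 1) :: real^'n) ` (UNIV :: 'n set set)" by blast
  then show ?thesis by (rule finite_subset) simp
qed

text \<open>Equal nonzero coordinates keep the origin off the coordinate planes through the centre;
  since the cross-polytope has radius 1 / (4 n), they also keep it off the planes of its faces. The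
  coordinates add up to 1/2, so the support lies inside the unit ball.\<close>

definition hat_center :: "real^'n" where
  "hat_center = (\<chi> i. 1 / (2 * real CARD('n)))"

definition hat :: "real^'n \<Rightarrow> real" where
  "hat x = max 0 (1 - 4 * real CARD('n) * (\<Sum>i\<in>UNIV. \<bar>(x - hat_center) $ i\<bar>))"

text \<open>The hat bends where a coordinate of x minus the centre changes sign and on the boundary
  of the cross-polytope outside which it vanishes; the sign vectors are the normals of the 2^n
  faces.\<close>

definition hat_planes :: "((real^'n) \<times> real) set" where
  "hat_planes = (\<lambda>i. (axis i 1, hat_center $ i)) ` UNIV
     \<union> (\<lambda>\<sigma>. (\<sigma>, \<sigma> \<bullet> hat_center + 1 / (4 * real CARD('n)))) ` signs"

lemma finite_hat_planes: "finite hat_planes"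
  by (simp add: hat_planes_def finite_signs)

lemma norm_hat_planes: "a \<in> hat_planes \<Longrightarrow> 1 \<le> norm (fst a)"
proof -
  have "1 \<le> norm \<sigma>" if "\<sigma> \<in> signs" for \<sigma> :: "real^'n"
  proof -
    have "\<bar>\<sigma> $ undefined\<bar> = 1" using that by (auto simp: signs_def dest: spec[of _ undefined])
    then show ?thesis using component_le_norm_cart[of \<sigma> undefined] by simp
  qed
  then show "1 \<le> norm (fst a)" if "a \<in> hat_planes" using that by (auto simp: hat_planes_def)
qed

text \<open>For a sign vector the offset is \<open>(2 * k + 1) / (4 * n)\<close> with an integer \<open>k\<close>.\<close>

lemma hat_planes_avoid_0:
  assumes "a \<in> (hat_planes :: ((real^'n) \<times> real) set)" shows "snd a \<noteq> 0"
proof -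
  have n: "real CARD('n) > 0" by simp
  have "\<sigma> \<bullet> hat_center + 1 / (4 * real CARD('n)) \<noteq> 0" if "\<sigma> \<in> signs" for \<sigma> :: "real^'n"
  proof
    assume *: "\<sigma> \<bullet> hat_center + 1 / (4 * real CARD('n)) = 0"
    have "(\<Sum>i\<in>UNIV. \<sigma> $ i) \<in> \<int>"
    proof (rule Ints_sum)
      fix i
      have "\<sigma> $ i = 1 \<or> \<sigma> $ i = - 1" using that by (simp add: signs_def)
      then show "\<sigma> $ i \<in> \<int>" by (metis Ints_1 Ints_minus)
    qed
    then obtain k :: int where k: "(\<Sum>i\<in>UNIV. \<sigma> $ i) = of_int k" by (rule Ints_cases)
    have "\<sigma> \<bullet> hat_center = (\<Sum>i\<in>UNIV. \<sigma> $ i) / (2 * real CARD('n))"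
      by (simp add: hat_center_def inner_vec_def sum_divide_distrib)
    then have "of_int k / (2 * real CARD('n)) + 1 / (4 * real CARD('n)) = 0" using * k by simp
    then have "2 * of_int k + 1 = (0::real)" using n by (simp add: field_simps)
    then have "of_int (2 * k + 1) = (0::real)" by simp
    then have "2 * k + 1 = 0" using of_int_eq_0_iff by blast
    then show False by presburger
  qed
  then show ?thesis using assms by (auto simp: hat_planes_def hat_center_def)
qed

lemma sum_abs_le_card_norm: "(\<Sum>i\<in>UNIV. \<bar>x $ i\<bar>) \<le> real CARD('n) * norm (x :: real^'n)"
  using sum_bounded_above[of UNIV "\<lambda>i. \<bar>x $ i\<bar>" "norm x"] by (simp add: component_le_norm_cart)

lemma hat_lipschitz: "\<bar>hat x - hat y\<bar> \<le> 4 * real CARD('n) * real CARD('n) * norm (x - y :: real^'n)"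
proof -
  let ?s = "\<lambda>x :: real^'n. \<Sum>i\<in>UNIV. \<bar>(x - hat_center) $ i\<bar>"
  have "\<bar>?s x - ?s y\<bar> \<le> (\<Sum>i\<in>UNIV. \<bar>\<bar>(x - hat_center) $ i\<bar> - \<bar>(y - hat_center) $ i\<bar>\<bar>)"
    unfolding sum_subtractf[symmetric] by (rule sum_abs)
  also have "\<dots> \<le> (\<Sum>i\<in>UNIV. \<bar>(x - y) $ i\<bar>)"
    by (intro sum_mono order_trans[OF abs_triangle_ineq3]) simp
  also have "\<dots> \<le> real CARD('n) * norm (x - y)" by (rule sum_abs_le_card_norm)
  finally have "4 * real CARD('n) * \<bar>?s x - ?s y\<bar> \<le> 4 * real CARD('n) * (real CARD('n) * norm (x - y))"
    by (rule mult_left_mono) simp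
  moreover have "\<bar>hat x - hat y\<bar> \<le> \<bar>4 * real CARD('n) * ?s x - 4 * real CARD('n) * ?s y\<bar>"
    unfolding hat_def by linarith
  moreover have "\<bar>4 * real CARD('n) * ?s x - 4 * real CARD('n) * ?s y\<bar> = 4 * real CARD('n) * \<bar>?s x - ?s y\<bar>"
    by (simp add: abs_mult flip: right_diff_distrib)
  ultimately show ?thesis unfolding mult.assoc by linarith
qed

lemma norm_hat_center: "norm (hat_center :: real^'n) \<le> 1/2"
  using norm_le_l1_cart[of "hat_center :: real^'n"] by (simp add: hat_center_def)

lemma hat_sphere:
  fixes x :: "real^'n"
  assumes "norm x = 1" "CARD('n) \<ge> 2" shows "hat x = 0"
proof -
  have "1/2 \<le> norm (x - hat_center)"
    using norm_triangle_ineq2[of x hat_center] norm_hat_center[where 'n = 'n] assms(1) by linarith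
  also have "\<dots> \<le> (\<Sum>i\<in>UNIV. \<bar>(x - hat_center) $ i\<bar>)" by (rule norm_le_l1_cart)
  finally have "4 * real CARD('n) * (1/2) \<le> 4 * real CARD('n) * (\<Sum>i\<in>UNIV. \<bar>(x - hat_center) $ i\<bar>)"
    by (rule mult_left_mono) simp
  moreover have "real CARD('n) \<ge> 2" using assms(2) by simp
  ultimately have "1 \<le> 4 * real CARD('n) * (\<Sum>i\<in>UNIV. \<bar>(x - hat_center) $ i\<bar>)" by linarith
  then show ?thesis by (simp add: hat_def)
qed

text \<open>Coordinates of y that are 0 stay 0 along the line, so the sum of absolute values is
  affine near t = 0. The maximum with 0 then matters only at a boundary point of the cross-polytope;
  there v is tangential to a face and the sum is constant.\<close>

lemma hat_affine:
  fixes x v :: "real^'n"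
  assumes orth: "\<And>a. a \<in> hat_planes \<Longrightarrow> ell a x = 0 \<Longrightarrow> fst a \<bullet> v = 0"
  shows "\<exists>d. \<forall>\<^sub>F t in nhds 0. hat (x + t *\<^sub>R v) = hat x + t * d"
proof -
  define n where "n = real CARD('n)"
  have n: "n > 0" by (simp add: n_def)
  define y where "y = x - hat_center"
  define S where "S = (\<Sum>i\<in>UNIV. \<bar>y $ i\<bar>)"
  define D where "D = (\<Sum>i\<in>UNIV. sgn (y $ i) * v $ i)"
  have yv: "v $ i = 0" if "y $ i = 0" for i
  proof -
    have "(axis i 1, hat_center $ i) \<in> hat_planes" by (simp add: hat_planes_def)
    from orth[OF this] that show ?thesis by (simp add: ell_def y_def inner_axis')
  qed
  have "\<forall>\<^sub>F t in nhds 0. \<bar>y $ i + t * v $ i\<bar> = \<bar>y $ i\<bar> + t * (sgn (y $ i) * v $ i)" for i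
  proof (cases "y $ i = 0")
    case False
    have "((\<lambda>t. sgn (y $ i) * (y $ i + t * v $ i)) \<longlongrightarrow> sgn (y $ i) * (y $ i + 0 * v $ i)) (nhds 0)"
      by (intro tendsto_intros filterlim_ident)
    moreover have "0 < sgn (y $ i) * (y $ i + 0 * v $ i)" using False by (simp add: sgn_if)
    ultimately have "\<forall>\<^sub>F t in nhds 0. 0 < sgn (y $ i) * (y $ i + t * v $ i)" by (rule order_tendstoD)
    then show ?thesis
      by eventually_elim (use False in \<open>auto simp: sgn_if abs_if split: if_splits\<close>)
  qed (simp add: yv)
  then have "\<forall>\<^sub>F t in nhds 0. \<forall>i. \<bar>y $ i + t * v $ i\<bar> = \<bar>y $ i\<bar> + t * (sgn (y $ i) * v $ i)"
    by (simp add: eventually_all_finite)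
  then have line: "\<forall>\<^sub>F t in nhds 0. hat (x + t *\<^sub>R v) = max 0 (1 - 4 * n * (S + t * D))"
  proof eventually_elim
    case (elim t)
    have "\<bar>(x + t *\<^sub>R v - hat_center) $ i\<bar> = \<bar>y $ i\<bar> + t * (sgn (y $ i) * v $ i)" for i
    proof -
      have "(x + t *\<^sub>R v - hat_center) $ i = y $ i + t * v $ i" by (simp add: y_def)
      then show ?thesis using elim by metis
    qed
    then have "(\<Sum>i\<in>UNIV. \<bar>(x + t *\<^sub>R v - hat_center) $ i\<bar>) = S + t * D"
      by (simp only: S_def D_def sum.distrib sum_distrib_left)
    then show ?case by (simp add: hat_def n_def)
  qed
  have hx: "hat x = max 0 (1 - 4 * n * S)" by (simp add: hat_def n_def S_def y_def)
  have lim: "((\<lambda>t. 1 - 4 * n * (S + t * D)) \<longlongrightarrow> 1 - 4 * n * (S + 0 * D)) (nhds 0)"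
    by (intro tendsto_intros filterlim_ident)
  consider "1 - 4 * n * S > 0" | "1 - 4 * n * S < 0" | "1 - 4 * n * S = 0" by linarith
  then show ?thesis
  proof cases
    case 1
    then have "\<forall>\<^sub>F t in nhds 0. 0 < 1 - 4 * n * (S + t * D)"
      by (intro order_tendstoD(1)[OF lim]) simp
    then have "\<forall>\<^sub>F t in nhds 0. hat (x + t *\<^sub>R v) = hat x + t * (- 4 * n * D)"
      using line by eventually_elim (use 1 in \<open>simp add: hx algebra_simps\<close>)
    then show ?thesis by blast
  next
    case 2
    then have "\<forall>\<^sub>F t in nhds 0. 1 - 4 * n * (S + t * D) < 0"
      by (intro order_tendstoD(2)[OF lim]) simp
    then have "\<forall>\<^sub>F t in nhds 0. hat (x + t *\<^sub>R v) = hat x + t * 0"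
      using line by eventually_elim (use 2 in \<open>simp add: hx\<close>)
    then show ?thesis by blast
  next
    case 3
    \<comment> \<open>The normal of a face containing x. Where a coordinate of y is 0 either sign
      will do, because v vanishes there too.\<close>
    define \<sigma> :: "real^'n" where "\<sigma> = (\<chi> i. if y $ i \<ge> 0 then 1 else - 1)"
    have "(\<sigma>, \<sigma> \<bullet> hat_center + 1 / (4 * real CARD('n))) \<in> hat_planes"
      by (auto simp: hat_planes_def signs_def \<sigma>_def)
    moreover have "ell (\<sigma>, \<sigma> \<bullet> hat_center + 1 / (4 * real CARD('n))) x = 0"
    proof -
      have "\<sigma> \<bullet> y = S" unfolding S_def inner_vec_def by (intro sum.cong) (auto simp: \<sigma>_def)
      moreover have "S = 1 / (4 * real CARD('n))" using 3 n by (simp add: n_def field_simps)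
      ultimately show ?thesis by (simp add: ell_def y_def inner_diff_right)
    qed
    ultimately have "\<sigma> \<bullet> v = 0" using orth by fastforce
    moreover have "\<sigma> \<bullet> v = D"
      unfolding D_def inner_vec_def by (intro sum.cong) (auto simp: \<sigma>_def sgn_if yv)
    ultimately have "D = 0" by simp
    from line have "\<forall>\<^sub>F t in nhds 0. hat (x + t *\<^sub>R v) = hat x + t * 0"
      by eventually_elim (simp add: hx \<open>D = 0\<close>)
    then show ?thesis by blast
  qed
qed

text \<open>A finite union of proper subspaces is negligible, so some vector lies outside all of
  them; joining 0 to the union allows it to be normalised.\<close>

lemma generic_unit_vector:
  fixes A :: "((real^'n) \<times> real) set"
  assumes "finite A"
  obtains \<theta> where "norm \<theta> = 1" "\<And>J. J \<subseteq> A \<Longrightarrow> \<theta> \<in> span (fst ` J) \<Longrightarrow> span (fst ` J) = UNIV"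
proof -
  define B where "B = {J. J \<subseteq> A \<and> span (fst ` J) \<noteq> UNIV}"
  have "negligible (\<Union>J\<in>B. span (fst ` J))"
  proof (rule negligible_Union)
    show "finite ((\<lambda>J. span (fst ` J)) ` B)" using assms by (simp add: B_def)
    fix T assume "T \<in> (\<lambda>J. span (fst ` J)) ` B"
    then obtain J where J: "J \<in> B" "T = span (fst ` J)" by blast
    have "dim T < DIM(real^'n)"
    proof -
      have "span T \<noteq> UNIV" unfolding J(2) span_span using J(1) by (simp add: B_def)
      then have "dim T \<noteq> DIM(real^'n)" using dim_eq_full[of T] by blast
      then show ?thesis using dim_subset_UNIV[of T] by linarith
    qed
    then show "negligible T" by (rule negligible_lowdim)
  qed
  then have "insert 0 (\<Union>J\<in>B. span (fst ` J)) \<noteq> (UNIV :: (real^'n) set)"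
    using non_negligible_UNIV by (metis negligible_insert)
  then obtain z where z: "z \<noteq> 0" "z \<notin> (\<Union>J\<in>B. span (fst ` J))" by blast
  show thesis
  proof (rule that[of "z /\<^sub>R norm z"])
    show "norm (z /\<^sub>R norm z) = 1" using z by simp
    fix J assume J: "J \<subseteq> A" "z /\<^sub>R norm z \<in> span (fst ` J)"
    have "norm z *\<^sub>R (z /\<^sub>R norm z) \<in> span (fst ` J)" using J(2) by (rule span_scale)
    then have "z \<in> span (fst ` J)" using z(1) by simp
    then show "span (fst ` J) = UNIV" using z(2) J(1) by (auto simp: B_def)
  qed
qed

lemma continuum_of_solutions:
  fixes p q :: "'n::finite"
  assumes "p \<in> I" "q \<notin> I"
  shows "\<exists>\<psi> g :: real^'n \<Rightarrow> real. admissible_data \<psi> g \<and> has_continuum_of_solutions \<psi> g \<and>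
    \<psi> 0 = (2 * real (card I) - real CARD('n)) * (pi / 2) \<and>
    (\<forall>\<^sub>F t in at_right 0. \<psi> (t *\<^sub>R axis p 1) < \<psi> 0 \<and> \<psi> 0 < \<psi> (t *\<^sub>R axis q 1))"
proof -
  have "{p, q} \<subseteq> UNIV" "p \<noteq> q" using assms by auto
  then have n: "CARD('n) \<ge> 2" using card_mono[of UNIV "{p, q}"] by simp
  obtain \<theta> :: "real^'n" where \<theta>: "norm \<theta> = 1"
    "\<And>J. J \<subseteq> hat_planes \<Longrightarrow> \<theta> \<in> span (fst ` J) \<Longrightarrow> span (fst ` J) = UNIV"
    using generic_unit_vector[OF finite_hat_planes] by blast
  have "hat (hat_center :: real^'n) \<noteq> 0" "(hat_center :: real^'n) \<in> ball 0 1"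
    using norm_hat_center[where 'n = 'n] by (simp_all add: hat_def)
  then interpret arrangement hat_planes hat "4 * real CARD('n) * real CARD('n)" \<theta> I p q
  proof unfold_locales
    show "\<exists>d. \<forall>\<^sub>F t in nhds 0. hat (x + t *\<^sub>R v) = hat x + t * d"
      if "\<And>a. a \<in> hat_planes \<Longrightarrow> ell a x = 0 \<Longrightarrow> fst a \<bullet> v = 0" for x v :: "real^'n"
      using that by (rule hat_affine)
  qed (use finite_hat_planes norm_hat_planes hat_planes_avoid_0 hat_lipschitz hat_sphere n \<theta> assms in auto)
  have "psi 0 = (2 * real (card I) - real CARD('n)) * (pi / 2)" by (simp add: psi_def)
  then show ?thesis
    using admissible continuum eventually_conj[OF psi_ray_p psi_ray_q] by blast
qed

theorem theorem1p1:
  fixes e :: "nat \<Rightarrow> real^'n"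
  assumes "bij_betw e {1..CARD('n)} (range (\<lambda>i. axis i 1))"
  shows "(CARD('n) \<ge> 2 \<longrightarrow>
            (\<exists>\<psi> g :: real^'n \<Rightarrow> real.
               admissible_data \<psi> g \<and> has_continuum_of_solutions \<psi> g)) \<and>
         (CARD('n) \<ge> 3 \<longrightarrow>
            (\<forall>m::nat \<in> {1..CARD('n) - 1}.
               \<exists>\<psi> g :: real^'n \<Rightarrow> real.
                 admissible_data \<psi> g \<and> has_continuum_of_solutions \<psi> g \<and>
                 \<psi> 0 = - (real CARD('n) - 2 * real m) * (pi / 2) \<and>
                 (\<forall>\<^sub>F t in at_right (0::real).
                    \<psi> (t *\<^sub>R e 1) < - (real CARD('n) - 2 * real m) * (pi / 2) \<and>
                    - (real CARD('n) - 2 * real m) * (pi / 2) < \<psi> (t *\<^sub>R e CARD('n)))))"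
proof -
  have main: "\<exists>\<psi> g :: real^'n \<Rightarrow> real.
                 admissible_data \<psi> g \<and> has_continuum_of_solutions \<psi> g \<and>
                 \<psi> 0 = - (real CARD('n) - 2 * real m) * (pi / 2) \<and>
                 (\<forall>\<^sub>F t in at_right (0::real).
                    \<psi> (t *\<^sub>R e 1) < - (real CARD('n) - 2 * real m) * (pi / 2) \<and>
                    - (real CARD('n) - 2 * real m) * (pi / 2) < \<psi> (t *\<^sub>R e CARD('n)))"
    if n: "CARD('n) \<ge> 2" and m: "m \<in> {1..CARD('n) - 1}" for m
  proof -
    have "e 1 \<in> range (\<lambda>i. axis i 1)" "e CARD('n) \<in> range (\<lambda>i. axis i 1)"
      using bij_betwE[OF assms] n by auto
    then obtain p q where pq: "e 1 = axis p 1" "e CARD('n) = axis q 1" by blast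
    have "e 1 \<noteq> e CARD('n)"
      using inj_onD[OF bij_betw_imp_inj_on[OF assms], of 1 "CARD('n)"] n by auto
    then have "p \<noteq> q" using pq by auto
    then have "card (UNIV - {p, q}) = CARD('n) - 2" by (simp add: card_Diff_subset)
    \<comment> \<open>Besides p, the set I needs m - 1 further indices, and n - 2 are available when
      p and q are left out.\<close>
    moreover have "m - 1 \<le> CARD('n) - 2"
    proof -
      have "m \<le> CARD('n) - 1" using m by simp
      then show ?thesis by arith
    qed
    ultimately have "m - 1 \<le> card (UNIV - {p, q})" by simp
    then obtain I0 where I0: "I0 \<subseteq> UNIV - {p, q}" "card I0 = m - 1"
      using obtain_subset_with_card_n by metis
    define I where "I = insert p I0"
    have "p \<in> I" "q \<notin> I" using I0 \<open>p \<noteq> q\<close> by (auto simp: I_def)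
    then obtain \<psi> g :: "real^'n \<Rightarrow> real" where \<psi>: "admissible_data \<psi> g" "has_continuum_of_solutions \<psi> g"
      "\<psi> 0 = (2 * real (card I) - real CARD('n)) * (pi / 2)"
      "\<forall>\<^sub>F t in at_right 0. \<psi> (t *\<^sub>R axis p 1) < \<psi> 0 \<and> \<psi> 0 < \<psi> (t *\<^sub>R axis q 1)"
      using continuum_of_solutions by blast
    have "card I = m" using I0 m by (auto simp: I_def card_insert_if finite_subset)
    then have \<psi>0: "- (real CARD('n) - 2 * real m) * (pi / 2) = \<psi> 0"
      unfolding \<psi>(3) by simp
    show ?thesis
      unfolding pq \<psi>0 using \<psi>(1,2,4) by blast
  qed
  show ?thesis
  proof (intro conjI impI ballI)
    assume n: "CARD('n) \<ge> 2"
    \<comment> \<open>The first claim is the case m = 1 of the second construction, which works from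
      n = 2 on.\<close>
    then have "1 \<in> {1..CARD('n) - 1}" by auto
    from main[OF n this] show "\<exists>\<psi> g :: real^'n \<Rightarrow> real. admissible_data \<psi> g \<and> has_continuum_of_solutions \<psi> g" by blast
  next
    fix m assume "CARD('n) \<ge> 3" "m \<in> {1..CARD('n) - 1}"
    then show "\<exists>\<psi> g :: real^'n \<Rightarrow> real.
                 admissible_data \<psi> g \<and> has_continuum_of_solutions \<psi> g \<and>
                 \<psi> 0 = - (real CARD('n) - 2 * real m) * (pi / 2) \<and>
                 (\<forall>\<^sub>F t in at_right (0::real).
                    \<psi> (t *\<^sub>R e 1) < - (real CARD('n) - 2 * real m) * (pi / 2) \<and>
                    - (real CARD('n) - 2 * real m) * (pi / 2) < \<psi> (t *\<^sub>R e CARD('n)))"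
      by (intro main) auto
  qed
qed

end
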